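(* Let $p$ be a prime with $5\le p\le 19$. For any integers $a_{1,p},\dots,a_{(p-1)/2,p}$ coprime to $p$ whose classes in $(\mathbb Z/p\mathbb Z)^*/\{\pm1\}$ are distinct, there is a direct sum decomposition $$\mathcal M_1(\Gamma_1(p))=\bigoplus_{k=1}^{(p-1)/2}\mathbb C\,\langle a_{k,p}\rangle(\mathcal E_p).$$ Moreover, if the $a_{k,p}$ are chosen as $(a_{k,5})=(1,2)$, $(a_{k,7})=(1,2,3)$, $(a_{k,11})=(1,2,3,5,7)$, $(a_{k,13})=(1,2,3,4,5,7)$, $(a_{k,17})=(1,2,3,5,7,8,11,13)$, $(a_{k,19})=(1,2,3,4,5,7,9,11,13)$, then each basis element $\langle a_{k,p}\rangle(\mathcal E_p)$ has first nonzero coefficient equal to $1$ in its $q$-expansion.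
   Context: $q=e^{2\pi i\tau}$, $\tau$ in the upper half plane. $\mathcal M_1(\Gamma_1(p))$ is the complex vector space of holomorphic weight-one modular forms for $\Gamma_1(p)=\{\gamma\in SL(2,\mathbb Z):\gamma_{21}\equiv0,\ \gamma_{11}\equiv\gamma_{22}\equiv1\pmod p\}$. For an odd Dirichlet character $\chi$ mod $p$, $E_{1,\chi}(\tau)=1+\frac{2}{L(0,\chi)}\sum_{n\ge1}\chi(n)\frac{q^n}{1-q^n}$, with $L(0,\chi)$ the value at $0$ of the analytically continued Dirichlet $L$-function. $\mathcal E_p=\frac{2}{p-1}\sum_{\chi\text{ odd}}E_{1,\chi}$ (sum over odd primitive characters mod $p$). For $a$ coprime to $p$, $\langle a\rangle(\mathcal E_p)(\tau)=(\gamma_{21}\tau+\gamma_{22})^{-1}\mathcal E_p(\gamma\tau)$ for any $\gamma\in SL(2,\mathbb Z)$ with $\gamma_{21}\equiv0$ and $\gamma_{22}\equiv a\pmod p$; equivalently $\langle a\rangle(\mathcal E_p)=\frac{2}{p-1}\sum_{\chi\text{ odd}}\chi(a)E_{1,\chi}$. *)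

theory Defs
  imports
    "HOL-Analysis.Analysis"
    "HOL-Complex_Analysis.Complex_Analysis"
    "HOL-Computational_Algebra.Computational_Algebra"
    "HOL-Number_Theory.Number_Theory"
    "HOL-Library.Function_Algebras"
begin

section \<open>The vector space of complex functions and internal direct sums\<close>

definition cscale :: "complex \<Rightarrow> (complex \<Rightarrow> complex) \<Rightarrow> complex \<Rightarrow> complex" where
  "cscale c f = (\<lambda>\<tau>. c * f \<tau>)"

interpretation cfun: vector_space cscale
  by unfold_locales (auto simp: cscale_def fun_eq_iff algebra_simps)

text \<open>The sum of functions below is the pointwise one of \<^theory>\<open>HOL-Library.Function_Algebras\<close>;
  \<^term>\<open>Pi\<^sub>E I V\<close> consists of the families \<open>(v k)\<close>, indexed by \<open>I\<close>, with \<open>v k \<in> V k\<close>.\<close>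

definition internal_direct_sum ::
    "(complex \<Rightarrow> complex) set \<Rightarrow> nat set \<Rightarrow> (nat \<Rightarrow> (complex \<Rightarrow> complex) set) \<Rightarrow> bool" where
  "internal_direct_sum M I V \<longleftrightarrow>
     cfun.subspace M \<and>
     (\<forall>k\<in>I. cfun.subspace (V k) \<and> V k \<subseteq> M) \<and>
     (\<forall>f\<in>M. \<exists>!v. v \<in> Pi\<^sub>E I V \<and> f = (\<Sum>k\<in>I. v k))"


section \<open>Modular forms\<close>

text \<open>A function on the upper half plane is represented by its extension by \<open>0\<close> to the whole
  complex plane, so that equality of such functions is equality in \<^typ>\<open>complex \<Rightarrow> complex\<close>.\<close>

definition upper_half_plane :: "complex set" where
  "upper_half_plane = {\<tau>. Im \<tau> > 0}"

definition SL2Z :: "(int^2^2) set" where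
  "SL2Z = {\<gamma>. det \<gamma> = 1}"

definition Gamma1 :: "nat \<Rightarrow> (int^2^2) set" where
  "Gamma1 N = {\<gamma> \<in> SL2Z. [\<gamma>$2$1 = 0] (mod int N) \<and>
                 [\<gamma>$1$1 = 1] (mod int N) \<and> [\<gamma>$2$2 = 1] (mod int N)}"

definition slash :: "int \<Rightarrow> (complex \<Rightarrow> complex) \<Rightarrow> int^2^2 \<Rightarrow> complex \<Rightarrow> complex" where
  "slash k f \<gamma> = (\<lambda>\<tau>. if \<tau> \<in> upper_half_plane
     then (of_int (\<gamma>$2$1) * \<tau> + of_int (\<gamma>$2$2)) powi (- k) *
          f ((of_int (\<gamma>$1$1) * \<tau> + of_int (\<gamma>$1$2)) / (of_int (\<gamma>$2$1) * \<tau> + of_int (\<gamma>$2$2)))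
     else 0)"

definition bounded_at_i_infinity :: "(complex \<Rightarrow> complex) \<Rightarrow> bool" where
  "bounded_at_i_infinity f \<longleftrightarrow> (\<exists>B Y. \<forall>\<tau>. Im \<tau> > Y \<longrightarrow> norm (f \<tau>) \<le> B)"

text \<open>Holomorphy at the cusps is the boundedness of \<open>f|\<gamma>\<close> at \<open>i\<infinity>\<close> for all \<open>\<gamma>\<close>
  in \<open>SL(2,\<int>)\<close>, not only for \<open>\<gamma>\<close> in the congruence subgroup \<open>G\<close>.\<close>

definition modular_forms :: "int \<Rightarrow> (int^2^2) set \<Rightarrow> (complex \<Rightarrow> complex) set" where
  "modular_forms k G = {f. (\<forall>\<tau>. \<tau> \<notin> upper_half_plane \<longrightarrow> f \<tau> = 0) \<and>
      f holomorphic_on upper_half_plane \<and>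
      (\<forall>\<gamma>\<in>G. slash k f \<gamma> = f) \<and>
      (\<forall>\<gamma>\<in>SL2Z. bounded_at_i_infinity (slash k f \<gamma>))}"

text \<open>The diamond operator of weight \<open>k\<close> and level \<open>N\<close>; on functions invariant under the weight
  \<open>k\<close> action of \<^term>\<open>Gamma1 N\<close> the result does not depend on the chosen matrix.\<close>

definition diamond_matrix :: "nat \<Rightarrow> int \<Rightarrow> int^2^2 \<Rightarrow> bool" where
  "diamond_matrix N a \<gamma> \<longleftrightarrow>
     \<gamma> \<in> SL2Z \<and> [\<gamma>$2$1 = 0] (mod int N) \<and> [\<gamma>$2$2 = a] (mod int N)"

definition diamond :: "int \<Rightarrow> nat \<Rightarrow> int \<Rightarrow> (complex \<Rightarrow> complex) \<Rightarrow> complex \<Rightarrow> complex" where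
  "diamond k N a f = slash k f (SOME \<gamma>. diamond_matrix N a \<gamma>)"


section \<open>\<open>q\<close>-expansions\<close>

definition qvar :: "complex \<Rightarrow> complex" where
  "qvar \<tau> = exp (2 * of_real pi * \<i> * \<tau>)"

definition has_q_expansion :: "(complex \<Rightarrow> complex) \<Rightarrow> complex fps \<Rightarrow> bool" where
  "has_q_expansion f F \<longleftrightarrow>
     (\<forall>\<tau>\<in>upper_half_plane. (\<lambda>n. fps_nth F n * qvar \<tau> ^ n) sums f \<tau>)"

text \<open>Since \<^term>\<open>subdegree 0 = 0\<close>, the equation with right-hand side \<open>1\<close> forces \<open>F \<noteq> 0\<close>.\<close>

definition first_nonzero_q_coeff_eq_1 :: "(complex \<Rightarrow> complex) \<Rightarrow> bool" where
  "first_nonzero_q_coeff_eq_1 f \<longleftrightarrow>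
     (\<exists>F. has_q_expansion f F \<and> fps_nth F (subdegree F) = 1)"


section \<open>Dirichlet characters and \<open>L\<close>-functions\<close>

text \<open>Characters of \<open>(\<int>/N\<int>)\<^sup>*\<close>, extended by zero to all integers; the value \<open>1\<close> at \<open>1\<close>
  follows from multiplicativity and non-vanishing. They are called \<open>\<psi>\<close> because \<open>\<chi>\<close> is the
  vector binder of the library.\<close>

definition dirichlet_character :: "nat \<Rightarrow> (int \<Rightarrow> complex) \<Rightarrow> bool" where
  "dirichlet_character N \<psi> \<longleftrightarrow>
     (\<forall>m n. \<psi> (m * n) = \<psi> m * \<psi> n) \<and>
     (\<forall>m n. [m = n] (mod int N) \<longrightarrow> \<psi> m = \<psi> n) \<and>
     (\<forall>n. \<psi> n \<noteq> 0 \<longleftrightarrow> coprime n (int N))"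

definition primitive_character :: "nat \<Rightarrow> (int \<Rightarrow> complex) \<Rightarrow> bool" where
  "primitive_character N \<psi> \<longleftrightarrow> dirichlet_character N \<psi> \<and>
     (\<forall>d. d dvd N \<and> d < N \<longrightarrow>
        \<not> (\<exists>\<phi>. dirichlet_character d \<phi> \<and> (\<forall>n. coprime n (int N) \<longrightarrow> \<psi> n = \<phi> n)))"

definition odd_primitive_characters :: "nat \<Rightarrow> (int \<Rightarrow> complex) set" where
  "odd_primitive_characters N = {\<psi>. primitive_character N \<psi> \<and> \<psi> (- 1) = - 1}"

text \<open>The \<open>L\<close>-function is the analytic continuation of the Dirichlet series to the plane
  punctured at \<open>1\<close>, the only possible pole; the identity theorem makes its value
  at \<open>s \<noteq> 1\<close> unique.\<close>

definition dirichlet_L :: "(int \<Rightarrow> complex) \<Rightarrow> complex \<Rightarrow> complex" where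
  "dirichlet_L \<psi> s = (THE z. \<exists>F. F holomorphic_on (- {1}) \<and>
     (\<forall>w. Re w > 1 \<longrightarrow> (\<lambda>n. \<psi> (int (Suc n)) / of_nat (Suc n) powr w) sums F w) \<and>
     z = F s)"


section \<open>Eisenstein series of weight one\<close>

definition eisenstein1 :: "(int \<Rightarrow> complex) \<Rightarrow> complex \<Rightarrow> complex" where
  "eisenstein1 \<psi> = (\<lambda>\<tau>. if \<tau> \<in> upper_half_plane
     then 1 + 2 / dirichlet_L \<psi> 0 *
            (\<Sum>n. \<psi> (int (Suc n)) * (qvar \<tau> ^ Suc n / (1 - qvar \<tau> ^ Suc n)))
     else 0)"

definition calE :: "nat \<Rightarrow> complex \<Rightarrow> complex" where
  "calE p = (\<lambda>\<tau>. 2 / (of_nat p - 1) * (\<Sum>\<psi>\<in>odd_primitive_characters p. eisenstein1 \<psi> \<tau>))"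

definition chosen_classes :: "nat \<Rightarrow> int list" where
  "chosen_classes p =
    (if p = 5 then [1, 2]
     else if p = 7 then [1, 2, 3]
     else if p = 11 then [1, 2, 3, 5, 7]
     else if p = 13 then [1, 2, 3, 4, 5, 7]
     else if p = 17 then [1, 2, 3, 5, 7, 8, 11, 13]
     else if p = 19 then [1, 2, 3, 4, 5, 7, 9, 11, 13]
     else [])"

end

theory Submission
  imports Defs
begin

text \<open>
  The space \<open>M\<close> of weight one forms for \<open>\<Gamma>\<^sub>1(p)\<close> is controlled by the values of its elements at the cusps,
  i.e.\ by the constant terms \<open>f\<^sub>v(\<infinity>)\<close> of \<open>f\<^sub>v = f|\<gamma>\<close>, where \<open>v \<noteq> 0\<close> is the bottom row of \<open>\<gamma>\<close> mod \<open>p\<close>.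

  If all of them vanish then \<open>f = 0\<close>: the product \<open>G\<close> of all \<open>f\<^sub>v\<close> is a form of level one and weight
  \<open>p\<^sup>2 - 1\<close> that vanishes to order \<open>2(p - 1)\<close> at infinity, and Hecke's argument (the invariant function
  \<open>|G|\<^sup>2 (Im \<tau>)\<^sup>k\<close> attains its supremum in the fundamental domain, the maximum principle in the \<open>q\<close>-disc
  contradicts this) kills \<open>G\<close> as soon as \<open>(p + 1) / (8 \<pi>) < 4/5\<close>, which holds for \<open>p \<le> 19\<close>.

  The sum over \<open>v\<close> of \<open>f\<^sub>v g\<^sub>v\<close> is a form of level one and weight two, so its constant term is \<open>0\<close>: the primitive
  of such a form is invariant under \<open>S\<close> and \<open>S T\<close>, which have fixed points, hence under \<open>T\<close>. Thus the
  cusp values form an isotropic space. Since the diamond translates of \<open>\<E>\<^sub>p\<close> take arbitrary odd values at the cusps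
  \<open>v = (0, d)\<close>, isotropy makes the symmetric matrix of their values at the cusps \<open>v = (c, 0)\<close> invertible,
  and a form vanishing at all cusps \<open>(0, d)\<close> also vanishes at all cusps \<open>(c, 0)\<close>.

  The Eisenstein series are finite Fourier transforms in \<open>v\<close> of the division values of the quasi-periodic
  function with simple poles on a lattice, whose transformation law under \<open>SL(2,\<int>)\<close> is Liouville's theorem. The numbers
  \<open>2 / L(0,\<chi>)\<close> are read off from an explicit convolution inverse of \<open>a \<mapsto> 1/2 - a/p\<close>, which turns \<open>\<E>\<^sub>p\<close> into a
  \<open>q\<close>-series with integer coefficients.
\<close>

text \<open>Two meanings of the infix dollar sign would make parsing exponential in the number of its occurrences.\<close>

no_notation fps_nth (infixl "$" 75)

section \<open>The action of the modular group\<close>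

text \<open>Behind the steps is a dimension count on cusp values. Since
  \<open>f_(-v) = - f_v\<close>, the values at \<open>(0, d)\<close> and at \<open>(c, 0)\<close>
  give two odd functions \<open>x\<close>, \<open>y\<close> mod \<open>p\<close>, a space of
  dimension \<open>p - 1\<close> with the nondegenerate form \<open>x.x + p y.y\<close>. An
  isotropic subspace has dimension at most \<open>(p - 1)/2\<close>, and the diamond translates
  already fill that. What remains is the injectivity of the cusp values, where the bound on
  \<open>p\<close> is genuine: at \<open>p = 23\<close> a cusp form of weight one exists. The
  estimate is tight too: the cut height 4/5 must exceed \<open>20 / (8 pi) = 0.7957...\<close> for
  \<open>p = 19\<close> and stay below \<open>sqrt 3 / 2\<close>. Lattice sums of weight one do not
  converge absolutely, so modularity is taken from \<open>kap\<close>, which is only quasi-periodic;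
  the summand \<open>c / p\<close> in \<open>eis\<close> repairs this. Of the L-functions only the
  value at 0 is needed. That it is nonzero also falls out of the tables, through
  \<open>tab_transform p \<psi> * dirichlet_L \<psi> 0 = 4\<close>.\<close>

definition jfac :: "int^2^2 \<Rightarrow> complex \<Rightarrow> complex" where
  "jfac \<gamma> \<tau> = of_int (\<gamma>$2$1) * \<tau> + of_int (\<gamma>$2$2)"

definition moeb :: "int^2^2 \<Rightarrow> complex \<Rightarrow> complex" where
  "moeb \<gamma> \<tau> = (of_int (\<gamma>$1$1) * \<tau> + of_int (\<gamma>$1$2)) / jfac \<gamma> \<tau>"

definition mat22 :: "int \<Rightarrow> int \<Rightarrow> int \<Rightarrow> int \<Rightarrow> int^2^2" where
  "mat22 a b c d = vector [vector [a, b], vector [c, d]]"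

lemma mat22_sel [simp]:
  "mat22 a b c d $ 1 $ 1 = a" "mat22 a b c d $ 1 $ 2 = b"
  "mat22 a b c d $ 2 $ 1 = c" "mat22 a b c d $ 2 $ 2 = d"
  by (simp_all add: mat22_def)

lemma mat2_mult_sel: "((A :: int^2^2) ** B)$i$j = A$i$1 * B$1$j + A$i$2 * B$2$j"
  by (simp add: matrix_matrix_mult_def sum_2)

lemma mat2_eq_iff: "(A :: int^2^2) = B \<longleftrightarrow> A$1$1 = B$1$1 \<and> A$1$2 = B$1$2 \<and> A$2$1 = B$2$1 \<and> A$2$2 = B$2$2"
  by (simp only: vec_eq_iff forall_2 conj_assoc)

lemma SL2Z_iff: "\<gamma> \<in> SL2Z \<longleftrightarrow> \<gamma>$1$1 * \<gamma>$2$2 - \<gamma>$1$2 * \<gamma>$2$1 = 1"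
  by (simp add: SL2Z_def det_2)

lemma SL2Z_det_of_int:
  "\<gamma> \<in> SL2Z \<Longrightarrow> of_int (\<gamma>$1$1) * of_int (\<gamma>$2$2) - of_int (\<gamma>$1$2) * of_int (\<gamma>$2$1) = (1 :: 'a :: ring_1)"
  unfolding SL2Z_iff of_int_mult[symmetric] of_int_diff[symmetric] by (simp only: of_int_1)

lemma SL2Z_mult: "A \<in> SL2Z \<Longrightarrow> B \<in> SL2Z \<Longrightarrow> A ** B \<in> SL2Z"
  by (simp add: SL2Z_def det_mul)

definition adj2 :: "int^2^2 \<Rightarrow> int^2^2" where
  "adj2 \<gamma> = mat22 (\<gamma>$2$2) (- \<gamma>$1$2) (- \<gamma>$2$1) (\<gamma>$1$1)"

lemma adj2_SL2Z: "\<gamma> \<in> SL2Z \<Longrightarrow> adj2 \<gamma> \<in> SL2Z"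
  by (simp add: SL2Z_iff adj2_def algebra_simps)

lemma adj2_mult: "\<gamma> \<in> SL2Z \<Longrightarrow> adj2 \<gamma> ** \<gamma> = mat22 1 0 0 1" "\<gamma> \<in> SL2Z \<Longrightarrow> \<gamma> ** adj2 \<gamma> = mat22 1 0 0 1"
  by (auto simp: SL2Z_iff mat2_eq_iff adj2_def mat2_mult_sel algebra_simps)

lemma uhp_iff: "\<tau> \<in> upper_half_plane \<longleftrightarrow> Im \<tau> > 0"
  by (simp add: upper_half_plane_def)

lemma open_uhp: "open upper_half_plane"
  unfolding upper_half_plane_def by (rule open_halfspace_Im_gt)

lemma convex_uhp: "convex upper_half_plane"
  unfolding upper_half_plane_def by (rule convex_halfspace_Im_gt)

lemma connected_uhp: "connected upper_half_plane"
  by (rule convex_connected[OF convex_uhp])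

lemma jfac_nonzero:
  assumes "\<gamma> \<in> SL2Z" "Im \<tau> > 0"
  shows "jfac \<gamma> \<tau> \<noteq> 0"
proof
  assume "jfac \<gamma> \<tau> = 0"
  hence "Im (jfac \<gamma> \<tau>) = 0" "Re (jfac \<gamma> \<tau>) = 0" by simp_all
  hence "\<gamma>$2$1 = 0" "\<gamma>$2$2 = 0" using assms(2) by (auto simp: jfac_def)
  thus False using assms(1) by (simp add: SL2Z_iff)
qed

lemma Im_moeb:
  assumes "\<gamma> \<in> SL2Z"
  shows "Im (moeb \<gamma> \<tau>) = Im \<tau> / (norm (jfac \<gamma> \<tau>))\<^sup>2"
proof -
  have "Im (moeb \<gamma> \<tau>) = Im \<tau> * of_int (\<gamma>$1$1 * \<gamma>$2$2 - \<gamma>$1$2 * \<gamma>$2$1) / (norm (jfac \<gamma> \<tau>))\<^sup>2"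
    unfolding moeb_def Im_divide cmod_power2 by (simp add: jfac_def algebra_simps)
  thus ?thesis using assms by (simp only: SL2Z_iff of_int_1 mult_1_right)
qed

lemma Im_moeb_pos: "\<gamma> \<in> SL2Z \<Longrightarrow> Im \<tau> > 0 \<Longrightarrow> Im (moeb \<gamma> \<tau>) > 0"
  by (simp add: Im_moeb jfac_nonzero)

lemma jfac_mult:
  assumes "B \<in> SL2Z" "Im \<tau> > 0"
  shows "jfac (A ** B) \<tau> = jfac A (moeb B \<tau>) * jfac B \<tau>"
  using jfac_nonzero[OF assms]
  by (simp add: moeb_def jfac_def[of A] jfac_def[of "A**B"] mat2_mult_sel field_simps) (simp add: jfac_def algebra_simps)

lemma moeb_mult:
  assumes "A \<in> SL2Z" "B \<in> SL2Z" "Im \<tau> > 0"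
  shows "moeb (A ** B) \<tau> = moeb A (moeb B \<tau>)"
proof -
  let ?j = "jfac B \<tau>"
  have nz: "?j \<noteq> 0" by (rule jfac_nonzero[OF assms(2,3)])
  have "of_int ((A**B)$1$1) * \<tau> + of_int ((A**B)$1$2) = (of_int (A$1$1) * moeb B \<tau> + of_int (A$1$2)) * ?j"
    using nz by (simp add: moeb_def mat2_mult_sel field_simps) (simp add: jfac_def algebra_simps)
  thus ?thesis using nz unfolding moeb_def[of "A**B"] moeb_def[of A] jfac_mult[OF assms(2,3)] by simp
qed

lemma moeb_one [simp]: "moeb (mat22 1 0 0 1) \<tau> = \<tau>" and jfac_one [simp]: "jfac (mat22 1 0 0 1) \<tau> = 1"
  by (simp_all add: moeb_def jfac_def)

lemma slash_eq: "Im \<tau> > 0 \<Longrightarrow> slash k f \<gamma> \<tau> = jfac \<gamma> \<tau> powi (- k) * f (moeb \<gamma> \<tau>)"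
  by (simp add: slash_def moeb_def jfac_def uhp_iff)

lemma slash_outside: "\<not> Im \<tau> > 0 \<Longrightarrow> slash k f \<gamma> \<tau> = 0"
  by (simp add: slash_def uhp_iff)

lemma slash_slash:
  assumes "A \<in> SL2Z" "B \<in> SL2Z"
  shows "slash k (slash k f A) B = slash k f (A ** B)"
proof
  fix \<tau>
  show "slash k (slash k f A) B \<tau> = slash k f (A ** B) \<tau>"
  proof (cases "Im \<tau> > 0")
    case True
    show ?thesis using True assms
      by (simp add: slash_eq Im_moeb_pos moeb_mult jfac_mult power_int_mult_distrib)
  qed (simp add: slash_outside)
qed

lemma slash_add: "slash k (\<lambda>\<tau>. f \<tau> + g \<tau>) \<gamma> = (\<lambda>\<tau>. slash k f \<gamma> \<tau> + slash k g \<gamma> \<tau>)"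
  by (auto simp: slash_def fun_eq_iff algebra_simps)

lemma slash_cmult: "slash k (\<lambda>\<tau>. c * f \<tau>) \<gamma> = (\<lambda>\<tau>. c * slash k f \<gamma> \<tau>)"
  by (auto simp: slash_def fun_eq_iff algebra_simps)

lemma holomorphic_moeb:
  assumes "\<gamma> \<in> SL2Z"
  shows "moeb \<gamma> holomorphic_on upper_half_plane"
  unfolding moeb_def[abs_def] jfac_def
  using jfac_nonzero[OF assms] by (auto intro!: holomorphic_intros simp: jfac_def uhp_iff)

lemma holomorphic_slash:
  assumes "f holomorphic_on upper_half_plane" "\<gamma> \<in> SL2Z"
  shows "slash k f \<gamma> holomorphic_on upper_half_plane"
proof -
  have "(\<lambda>\<tau>. jfac \<gamma> \<tau> powi (- k) * f (moeb \<gamma> \<tau>)) holomorphic_on upper_half_plane"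
  proof (intro holomorphic_on_mult)
    show "(\<lambda>\<tau>. jfac \<gamma> \<tau> powi (- k)) holomorphic_on upper_half_plane"
      unfolding jfac_def using jfac_nonzero[OF assms(2)] by (auto intro!: holomorphic_intros simp: jfac_def uhp_iff)
    have "f \<circ> moeb \<gamma> holomorphic_on upper_half_plane"
      by (rule holomorphic_on_compose_gen[OF holomorphic_moeb[OF assms(2)] assms(1)])
         (use Im_moeb_pos[OF assms(2)] in \<open>auto simp: uhp_iff\<close>)
    thus "(\<lambda>\<tau>. f (moeb \<gamma> \<tau>)) holomorphic_on upper_half_plane" by (simp add: o_def)
  qed
  thus ?thesis by (rule holomorphic_transform) (simp add: slash_eq uhp_iff)
qed

text \<open>The optimal constant is \<open>\<surd>3 / 2\<close>. Any value above \<open>4/5\<close> suffices below, and then a nearly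
  maximal imaginary part in the orbit is enough.\<close>

lemma exists_moeb_Im_large:
  assumes "Im \<tau> > 0"
  obtains \<gamma> where "\<gamma> \<in> SL2Z" "Im (moeb \<gamma> \<tau>) \<ge> 161/200"
proof -
  define S where "S = (\<lambda>\<gamma>. Im (moeb \<gamma> \<tau>)) ` SL2Z"
  define y where "y = Im \<tau>"
  have y: "y > 0" using assms by (simp add: y_def)
  \<comment> \<open>Heights in the orbit are bounded: a bottom row \<open>(0, d)\<close> has
    \<open>d = 1\<close> or \<open>d = - 1\<close> and keeps the height, and otherwise the
    automorphy factor has modulus at least \<open>y\<close>.\<close>
  have bnd: "x \<le> max y (1 / y)" if "x \<in> S" for x
  proof -
    from that obtain \<gamma> where g: "\<gamma> \<in> SL2Z" and x: "x = y / (norm (jfac \<gamma> \<tau>))\<^sup>2"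
      by (auto simp: S_def Im_moeb y_def)
    show ?thesis
    proof (cases "\<gamma>$2$1 = 0")
      case True
      hence "\<gamma>$1$1 * \<gamma>$2$2 = 1" using g by (simp add: SL2Z_iff)
      hence "\<bar>\<gamma>$2$2\<bar> = 1" using zmult_eq_1_iff by fastforce
      hence "\<bar>of_int (\<gamma>$2$2) :: real\<bar> = 1" by (metis of_int_1 of_int_abs)
      hence "norm (jfac \<gamma> \<tau>) = 1" using True by (simp add: jfac_def)
      thus ?thesis using x by simp
    next
      case False
      hence "1 \<le> \<bar>\<gamma>$2$1\<bar>" by simp
      hence "1 \<le> \<bar>real_of_int (\<gamma>$2$1)\<bar>" by linarith
      hence "y \<le> \<bar>real_of_int (\<gamma>$2$1)\<bar> * y" using y by (simp add: mult_le_cancel_right1)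
      also have "\<dots> = \<bar>Im (jfac \<gamma> \<tau>)\<bar>" using y by (simp add: jfac_def y_def abs_mult)
      also have "\<dots> \<le> norm (jfac \<gamma> \<tau>)" by (rule abs_Im_le_cmod)
      finally have y2: "y \<le> norm (jfac \<gamma> \<tau>)" .
      hence "y\<^sup>2 \<le> (norm (jfac \<gamma> \<tau>))\<^sup>2" using y by (intro power_mono) auto
      hence "x \<le> y / y\<^sup>2" unfolding x using y by (intro divide_left_mono) (auto intro!: mult_pos_pos zero_less_power less_le_trans[OF y y2])
      also have "\<dots> = 1 / y" using y by (simp add: power2_eq_square)
      finally show ?thesis by simp
    qed
  qed
  have bdd: "bdd_above S" using bnd by (auto simp: bdd_above_def)
  have one: "mat22 1 0 0 1 \<in> SL2Z" by (simp add: SL2Z_iff)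
  have ne: "S \<noteq> {}" using one by (auto simp: S_def)
  define s where "s = Sup S"
  have up: "Im (moeb \<gamma> \<tau>) \<le> s" if "\<gamma> \<in> SL2Z" for \<gamma>
    unfolding s_def by (rule cSup_upper[OF _ bdd]) (use that in \<open>auto simp: S_def\<close>)
  have s: "s > 0" using up[OF one] y by (simp add: y_def)
  \<comment> \<open>The supremum need not be attained. A point above \<open>91/100 * s\<close>,
    translated to \<open>|Re w| <= 1/2\<close> and compared with its image under inversion,
    satisfies \<open>|w|^2 > 91/100\<close>, so \<open>(Im w)^2 > 91/100 - 1/4 = 0.66\<close>, which
    still exceeds \<open>(161/200)^2 = 0.648...\<close>.\<close>
  hence "91/100 * s < Sup S" by (simp add: s_def)
  then obtain x where "x \<in> S" "91/100 * s < x" using less_cSupE[OF _ ne] by blast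
  then obtain \<gamma> where g: "\<gamma> \<in> SL2Z" and gs: "91/100 * s < Im (moeb \<gamma> \<tau>)"
    unfolding S_def by blast
  define n where "n = round (Re (moeb \<gamma> \<tau>))"
  define \<delta> where "\<delta> = mat22 1 (- n) 0 1 ** \<gamma>"
  have T: "mat22 1 (- n) 0 1 \<in> SL2Z" by (simp add: SL2Z_iff)
  have d: "\<delta> \<in> SL2Z" unfolding \<delta>_def by (rule SL2Z_mult[OF T g])
  define w where "w = moeb \<delta> \<tau>"
  have w: "w = moeb \<gamma> \<tau> - of_int n"
    unfolding w_def \<delta>_def moeb_mult[OF T g assms] by (simp add: moeb_def[of "mat22 1 (-n) 0 1"] jfac_def)
  have rw: "\<bar>Re w\<bar> \<le> 1/2" unfolding w n_def using of_int_round_abs_le[of "Re (moeb \<gamma> \<tau>)"] by (simp add: abs_minus_commute)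
  have iw: "91/100 * s < Im w" using gs by (simp add: w)
  have iw0: "Im w > 0" using iw s by simp
  have S: "mat22 0 (-1) 1 0 \<in> SL2Z" by (simp add: SL2Z_iff)
  have "Im w / (norm w)\<^sup>2 = Im (moeb (mat22 0 (-1) 1 0 ** \<delta>) \<tau>)"
    unfolding moeb_mult[OF S d assms] w_def[symmetric] Im_moeb[OF S] by (simp add: jfac_def)
  also have "\<dots> \<le> s" by (rule up[OF SL2Z_mult[OF S d]])
  finally have "Im w \<le> s * (norm w)\<^sup>2" using iw0 by (simp add: divide_le_eq split: if_splits)
  with iw have "91/100 * s < s * (norm w)\<^sup>2" by linarith
  hence "91/100 < (norm w)\<^sup>2" using s by simp
  moreover have "(Re w)\<^sup>2 \<le> (1/2)\<^sup>2" using rw by (intro abs_le_square_iff[THEN iffD1]) simp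
  ultimately have "(161/200)\<^sup>2 \<le> (Im w)\<^sup>2" unfolding cmod_power2 by (simp add: power2_eq_square)
  hence "161/200 \<le> Im w" using iw0 by (intro power2_le_imp_le[of "161/200"]) auto
  thus ?thesis using that[OF d] by (simp add: w_def)
qed

section \<open>Expansions at infinity and vanishing in level one\<close>

lemma norm_qvar: "norm (qvar \<tau>) = exp (- 2 * pi * Im \<tau>)"
  by (simp add: qvar_def)

lemma qvar_nonzero [simp]: "qvar \<tau> \<noteq> 0" by (simp add: qvar_def)

lemma qvar_add: "qvar (a + b) = qvar a * qvar b"
  by (simp add: qvar_def exp_add[symmetric] algebra_simps)

lemma qvar_of_int [simp]: "qvar (of_int n) = 1"
  unfolding qvar_def by (simp add: exp_eq_1)

lemma norm_qvar_less_1: "Im \<tau> > 0 \<Longrightarrow> norm (qvar \<tau>) < 1"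
  by (simp add: norm_qvar)

lemma qvar_Ln:
  assumes "x \<noteq> 0"
  shows "qvar (Ln x / (2 * of_real pi * \<i>)) = x"
  using assms by (simp add: qvar_def)

lemma qvar_eq_iff: "qvar a = qvar b \<longleftrightarrow> (\<exists>n. a = b + of_int n)"
proof
  assume "qvar a = qvar b"
  then obtain n :: int where "2 * of_real pi * \<i> * a = 2 * of_real pi * \<i> * b + 2 * of_int n * of_real pi * \<i>"
    unfolding qvar_def by (auto simp: exp_eq)
  hence "(2 * of_real pi * \<i>) * (a - (b + of_int n)) = 0" by (simp add: algebra_simps)
  hence "a = b + of_int n" by simp
  thus "\<exists>n. a = b + of_int n" ..
qed (auto simp: qvar_add)

lemma holomorphic_qvar: "qvar holomorphic_on A"
  unfolding qvar_def[abs_def] by (intro holomorphic_intros)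

lemma holomorphic_qvar' [holomorphic_intros]: "f holomorphic_on A \<Longrightarrow> (\<lambda>x. qvar (f x)) holomorphic_on A"
  unfolding qvar_def by (intro holomorphic_intros)

lemma periodic_int:
  fixes F :: "complex \<Rightarrow> complex" and N :: real
  assumes "\<And>\<tau>. Im \<tau> > 0 \<Longrightarrow> F (\<tau> + of_real N) = F \<tau>" "Im \<tau> > 0"
  shows "F (\<tau> + of_real N * of_int n) = F \<tau>"
proof -
  have nat: "F (\<tau> + of_real N * of_nat n) = F \<tau>" if "Im \<tau> > 0" for n \<tau>
  proof (induction n)
    case (Suc n)
    have "F (\<tau> + of_real N * of_nat (Suc n)) = F ((\<tau> + of_real N * of_nat n) + of_real N)"
      by (simp add: algebra_simps)
    also have "\<dots> = F (\<tau> + of_real N * of_nat n)" using that by (intro assms(1)) simp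
    finally show ?case using Suc by simp
  qed simp
  show ?thesis
  proof (cases "n \<ge> 0")
    case True
    thus ?thesis using nat[OF assms(2), of "nat n"] by simp
  next
    case False
    define m where "m = nat (- n)"
    have n: "of_int n = - (of_nat m :: complex)" using False by (simp add: m_def)
    have "Im (\<tau> + of_real N * of_int n) > 0" using assms(2) by simp
    from nat[OF this, of m] show ?thesis by (simp add: n)
  qed
qed

lemma holomorphic_on_local:
  assumes "\<And>x. x \<in> S \<Longrightarrow> \<exists>U. open U \<and> x \<in> U \<and> f holomorphic_on U"
  shows "f holomorphic_on S"
proof (rule holomorphic_onI)
  fix x assume "x \<in> S"
  then obtain U where "open U" "x \<in> U" "f holomorphic_on U" using assms by blast
  thus "f field_differentiable at x within S"
    using field_differentiable_at_within holomorphic_on_imp_differentiable_at by blast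
qed

text \<open>\<open>F\<close> factors through \<open>x = qvar (\<tau> / N)\<close>. The principal
  logarithm in \<open>L\<close> jumps only by a period of \<open>F\<close>, so \<open>L\<close> is
  holomorphic on the punctured disc, and boundedness at infinity makes the puncture
  removable.\<close>

lemma q_descent:
  fixes F :: "complex \<Rightarrow> complex" and N :: real
  assumes N: "N > 0" and hol: "F holomorphic_on upper_half_plane"
    and per: "\<And>\<tau>. Im \<tau> > 0 \<Longrightarrow> F (\<tau> + of_real N) = F \<tau>"
    and bd: "bounded_at_i_infinity F"
  obtains h where "h holomorphic_on ball 0 1" "\<And>\<tau>. Im \<tau> > 0 \<Longrightarrow> F \<tau> = h (qvar (\<tau> / of_real N))"
proof -
  define c where "c = of_real N / (2 * of_real pi * \<i>)"
  have cnz: "c \<noteq> 0" using N by (simp add: c_def)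
  define L where "L = (\<lambda>x. F (c * Ln x))"
  have Imc: "Im (c * z) = - N / (2 * pi) * Re z" for z
    by (simp add: c_def Im_divide field_simps power2_eq_square)
  have F_any: "F z = L x" if "qvar (z / of_real N) = x" "Im z > 0" for x z
  proof -
    have x: "x \<noteq> 0" using that(1) by auto
    have "qvar (z / of_real N) = qvar (Ln x / (2 * of_real pi * \<i>))" using qvar_Ln[OF x] that by simp
    then obtain n where "z / of_real N = Ln x / (2 * of_real pi * \<i>) + of_int n" by (auto simp: qvar_eq_iff)
    hence z: "c * Ln x = z + of_real N * of_int (- n)" using N by (simp add: c_def field_simps)
    have "F (z + of_real N * of_int (- n)) = F z"
      using per that(2) by (rule periodic_int)
    thus ?thesis by (simp add: L_def z)
  qed
  have hol1: "L holomorphic_on (ball 0 1 - {0})"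
  proof (rule holomorphic_on_local)
    fix x0 :: complex assume x0: "x0 \<in> ball 0 1 - {0}"
    define U where "U = ball 0 1 \<inter> ball x0 (norm x0)"
    \<comment> \<open>A branch of the logarithm near \<open>x0\<close>: on the disc of radius
      \<open>|x0|\<close> about \<open>x0\<close> the quotient \<open>x / x0\<close> has positive
      real part, so the cut is avoided wherever \<open>x0\<close> lies.\<close>
    define g where "g = (\<lambda>x. c * (Ln (x / x0) + Ln x0))"
    have U: "x \<noteq> 0" "norm x < 1" "Re (x / x0) > 0" if "x \<in> U" for x
    proof -
      from that have *: "norm (x0 - x) < norm x0" by (simp add: U_def dist_norm)
      thus "x \<noteq> 0" by auto
      show "norm x < 1" using that by (simp add: U_def)
      have "norm (1 - x / x0) = norm (x0 - x) / norm x0" using x0 by (simp add: norm_divide[symmetric] diff_divide_distrib)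
      also have "\<dots> < 1" using * x0 by simp
      finally have "norm (1 - x / x0) < 1" .
      moreover have "Re (1 - x / x0) \<le> norm (1 - x / x0)" by (rule complex_Re_le_cmod)
      ultimately show "Re (x / x0) > 0" by simp
    qed
    have nonpos: "x / x0 \<notin> \<real>\<^sub>\<le>\<^sub>0" if "x \<in> U" for x
      using U(3)[OF that] by (auto simp: complex_nonpos_Reals_iff)
    have expg: "exp (Ln (x / x0) + Ln x0) = x" if "x \<in> U" for x
      using U(1)[OF that] x0 by (simp add: exp_add)
    have Im_g: "Im (g x) > 0" if "x \<in> U" for x
    proof -
      have "exp (Re (Ln (x / x0) + Ln x0)) < 1"
        using U(2)[OF that] expg[OF that] by (metis norm_exp_eq_Re)
      hence "Re (Ln (x / x0) + Ln x0) < 0" by (metis exp_less_one_iff)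
      thus ?thesis unfolding g_def Imc using N by (simp only: neg_less_0_iff_less zero_less_mult_iff zero_less_divide_iff mult_less_0_iff divide_less_0_iff) simp
    qed
    have qg: "qvar (g x / of_real N) = x" if "x \<in> U" for x
      using expg[OF that] N by (simp add: qvar_def g_def c_def)
    have "g holomorphic_on U" unfolding g_def using x0 nonpos by (intro holomorphic_intros) auto
    hence "F \<circ> g holomorphic_on U"
      by (rule holomorphic_on_compose_gen[OF _ hol]) (use Im_g in \<open>auto simp: uhp_iff\<close>)
    hence "L holomorphic_on U"
      by (rule holomorphic_transform) (use F_any[OF qg Im_g] in simp)
    moreover have "open U" "x0 \<in> U" using x0 by (auto simp: U_def)
    ultimately show "\<exists>U. open U \<and> x0 \<in> U \<and> L holomorphic_on U" by blast
  qed
  obtain B Y where BY: "\<And>\<tau>. Im \<tau> > Y \<Longrightarrow> norm (F \<tau>) \<le> B"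
    using bd by (auto simp: bounded_at_i_infinity_def)
  have "eventually (\<lambda>x. norm (L x) \<le> B) (at 0)"
    unfolding eventually_at
  proof (intro exI conjI ballI impI)
    show "exp (- 2 * pi / N * Y) > 0" by simp
    fix x :: complex assume x: "x \<noteq> 0 \<and> dist x 0 < exp (- 2 * pi / N * Y)"
    hence "ln (norm x) < ln (exp (- 2 * pi / N * Y))" by (subst ln_less_cancel_iff) auto
    hence "ln (norm x) < - 2 * pi / N * Y" by simp
    hence "Im (c * Ln x) > Y" unfolding Imc using x N by (simp add: field_simps)
    thus "norm (L x) \<le> B" unfolding L_def by (rule BY)
  qed
  hence "\<exists>g. g holomorphic_on ball 0 1 \<and> (\<forall>z \<in> ball 0 1 - {0}. g z = L z)"
    by (subst holomorphic_on_extend_bounded[OF hol1]) (auto simp: interior_open)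
  then obtain h where h: "h holomorphic_on ball 0 1" and hL: "\<And>z. z \<in> ball 0 1 - {0} \<Longrightarrow> h z = L z" by blast
  have "F \<tau> = h (qvar (\<tau> / of_real N))" if "Im \<tau> > 0" for \<tau>
    using F_any[OF refl that] hL[of "qvar (\<tau> / of_real N)"] norm_qvar_less_1[of "\<tau> / of_real N"] that N
    by (simp add: divide_pos_pos)
  thus ?thesis using that h by blast
qed

text \<open>The bound \<open>k < 16 \<pi> m / 5\<close> says that \<open>y\<^sup>k exp(-4 \<pi> m y)\<close> is decreasing for \<open>y \<ge> 4/5\<close>.\<close>

lemma level_one_vanishing:
  assumes hol: "G holomorphic_on upper_half_plane"
    and mod: "\<And>\<gamma> \<tau>. \<gamma> \<in> SL2Z \<Longrightarrow> Im \<tau> > 0 \<Longrightarrow> G (moeb \<gamma> \<tau>) = jfac \<gamma> \<tau> ^ k * G \<tau>"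
    and bd: "bounded_at_i_infinity (\<lambda>\<tau>. G \<tau> / qvar \<tau> ^ m)"
    and km: "real k * 5 < 16 * pi * real m" and \<tau>: "Im \<tau> > 0"
  shows "G \<tau> = 0"
proof -
  define T where "T = mat22 1 1 0 1"
  have T: "T \<in> SL2Z" by (simp add: T_def SL2Z_iff)
  have per: "G (\<tau> + 1) = G \<tau>" if "Im \<tau> > 0" for \<tau>
    using mod[OF T that] by (simp add: T_def moeb_def jfac_def)
  obtain h where h: "h holomorphic_on ball 0 1"
    and Gh: "\<And>\<tau>. Im \<tau> > 0 \<Longrightarrow> G \<tau> / qvar \<tau> ^ m = h (qvar \<tau>)"
  proof (rule q_descent[of 1 "\<lambda>\<tau>. G \<tau> / qvar \<tau> ^ m"])
    show "(\<lambda>\<tau>. G \<tau> / qvar \<tau> ^ m) holomorphic_on upper_half_plane"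
      by (intro holomorphic_intros hol holomorphic_qvar) auto
    show "G (\<tau> + of_real 1) / qvar (\<tau> + of_real 1) ^ m = G \<tau> / qvar \<tau> ^ m" if "Im \<tau> > 0" for \<tau>
      using per[OF that] qvar_of_int[of 1] by (simp add: qvar_add)
  qed (use bd that in auto)
  define \<phi> where "\<phi> = (\<lambda>\<tau>. (norm (G \<tau>))\<^sup>2 * Im \<tau> ^ k)"
  have inv: "\<phi> (moeb \<gamma> \<tau>) = \<phi> \<tau>" if "\<gamma> \<in> SL2Z" "Im \<tau> > 0" for \<gamma> \<tau>
    using jfac_nonzero[OF that] unfolding \<phi>_def mod[OF that] Im_moeb[OF that(1)]
    by (simp add: norm_mult norm_power power_divide power_mult_distrib power_mult[symmetric] mult.commute)
  \<comment> \<open>The line \<open>Im \<tau> = 4/5\<close> becomes the circle of radius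
    \<open>r\<close> in the \<open>q\<close>-disc, and all higher points lie inside it.\<close>
  define r where "r = exp (- 2 * pi * (4/5))"
  have r: "0 < r" "r < 1" by (auto simp: r_def)
  have sph: "sphere 0 r \<subseteq> ball (0::complex) 1" "cball 0 r \<subseteq> ball (0::complex) 1" using r by auto
  have "compact (sphere (0::complex) r)" "sphere (0::complex) r \<noteq> {}" using r by auto
  moreover have "continuous_on (sphere 0 r) (\<lambda>x. norm (h x))"
    by (intro continuous_intros holomorphic_on_imp_continuous_on holomorphic_on_subset[OF h] sph)
  ultimately obtain x1 where x1: "norm x1 = r" and max1: "\<And>x. norm x = r \<Longrightarrow> norm (h x) \<le> norm (h x1)"
    using continuous_attains_sup[of "sphere 0 r" "\<lambda>x. norm (h x)"] by auto
  have max2: "norm (h x) \<le> norm (h x1)" if "norm x \<le> r" for x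
  proof (rule maximum_modulus_frontier[of h "cball 0 r"])
    show "h holomorphic_on interior (cball 0 r)" "continuous_on (closure (cball 0 r)) h"
      using sph(2) by (auto intro!: holomorphic_on_imp_continuous_on holomorphic_on_subset[OF h])
  qed (use r max1 that in \<open>auto simp: frontier_cball\<close>)
  define \<tau>1 where "\<tau>1 = Ln x1 / (2 * of_real pi * \<i>)"
  have x1nz: "x1 \<noteq> 0" using x1 r by auto
  have q1: "qvar \<tau>1 = x1" unfolding \<tau>1_def by (rule qvar_Ln[OF x1nz])
  have "exp (- 2 * pi * Im \<tau>1) = exp (- 2 * pi * (4/5))" using x1 unfolding q1[symmetric] norm_qvar r_def .
  hence Im1: "Im \<tau>1 = 4/5" by simp
  obtain \<gamma>1 where g1: "\<gamma>1 \<in> SL2Z" and Im2: "Im (moeb \<gamma>1 \<tau>1) \<ge> 161/200"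
    using exists_moeb_Im_large[of \<tau>1] Im1 by auto
  define \<tau>2 where "\<tau>2 = moeb \<gamma>1 \<tau>1"
  \<comment> \<open>The maximum principle bounds \<open>h\<close> by its value at \<open>x1\<close>,
    and \<open>1 + x <= exp x\<close> gives \<open>t <= 4/5 * exp (5/4 * (t - 4/5))\<close> for the
    height. Together they bound \<open>\<phi>\<close> above height 4/5 by an exponential whose rate
    is negative by \<open>km\<close>.\<close>
  have main: "\<phi> \<tau> \<le> exp ((real k * 5/4 - 4 * pi * real m) * (Im \<tau> - 4/5)) * \<phi> \<tau>1"
    if "Im \<tau> \<ge> 4/5" for \<tau>
  proof -
    have GI: "norm (G \<tau>) = exp (- 2 * pi * Im \<tau>) ^ m * norm (h (qvar \<tau>))" if "Im \<tau> > 0" for \<tau>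
      by (simp add: Gh[OF that, symmetric] norm_divide norm_power norm_qvar)
    have a: "norm (h (qvar \<tau>)) \<le> norm (h x1)" using that by (intro max2) (simp add: norm_qvar r_def)
    have aux: "t \<le> 4/5 * E" if "1 + 5/4 * (t - 4/5) \<le> E" for t E :: real
      using that by (simp add: field_simps)
    have b: "Im \<tau> ^ k \<le> (4/5) ^ k * exp (real k * (5/4 * (Im \<tau> - 4/5)))"
    proof -
      have "Im \<tau> \<le> 4/5 * exp (5/4 * (Im \<tau> - 4/5))"
        using aux[OF exp_ge_add_one_self] .
      hence "Im \<tau> ^ k \<le> (4/5 * exp (5/4 * (Im \<tau> - 4/5))) ^ k"
        using that by (intro power_mono) auto
      also have "\<dots> = (4/5) ^ k * exp (real k * (5/4 * (Im \<tau> - 4/5)))"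
        by (simp only: power_mult_distrib exp_of_nat_mult)
      finally show ?thesis .
    qed
    have "\<phi> \<tau> = (exp (- 2 * pi * Im \<tau>) ^ m)\<^sup>2 * (norm (h (qvar \<tau>)))\<^sup>2 * Im \<tau> ^ k"
      using that by (simp add: \<phi>_def GI power_mult_distrib)
    also have "\<dots> \<le> (exp (- 2 * pi * Im \<tau>) ^ m)\<^sup>2 * (norm (h x1))\<^sup>2 * ((4/5) ^ k * exp (real k * (5/4 * (Im \<tau> - 4/5))))"
      using that a b by (intro mult_mono power_mono) auto
    also have "\<dots> = exp ((real k * 5/4 - 4 * pi * real m) * (Im \<tau> - 4/5)) * ((exp (- 2 * pi * (4/5)) ^ m)\<^sup>2 * (norm (h x1))\<^sup>2 * (4/5) ^ k)"
    proof -
      have sq: "(exp x ^ m)\<^sup>2 = exp (2 * real m * x)" for x :: real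
        by (simp only: power_mult[symmetric] exp_of_nat_mult[symmetric]) simp
      have "exp (2 * real m * (- 2 * pi * Im \<tau>)) * exp (real k * (5/4 * (Im \<tau> - 4/5))) =
            exp ((real k * 5/4 - 4 * pi * real m) * (Im \<tau> - 4/5)) * exp (2 * real m * (- 2 * pi * (4/5)))"
        unfolding exp_add[symmetric] by (rule arg_cong[of _ _ exp]) (simp add: algebra_simps)
      moreover have "a * H * (C * b) = c * (d * H * C)" if "a * b = c * d" for a b c d H C :: real
      proof -
        have "a * H * (C * b) = (a * b) * (H * C)" by (simp only: mult_ac)
        thus ?thesis unfolding that by (simp only: mult_ac)
      qed
      ultimately show ?thesis unfolding sq by blast
    qed
    also have "(exp (- 2 * pi * (4/5)) ^ m)\<^sup>2 * (norm (h x1))\<^sup>2 * (4/5) ^ k = \<phi> \<tau>1"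
      using GI[of \<tau>1] by (simp add: \<phi>_def Im1 q1 power_mult_distrib)
    finally show ?thesis .
  qed
  have neg: "real k * 5/4 - 4 * pi * real m < 0" using km by simp
  define \<theta> where "\<theta> = exp ((real k * 5/4 - 4 * pi * real m) * (Im \<tau>2 - 4/5))"
  have \<theta>: "\<theta> < 1" unfolding \<theta>_def using neg Im2 by (simp add: \<tau>2_def mult_neg_pos)
  \<comment> \<open>The maximum point \<open>\<tau>1\<close> has an orbit mate at height at least
    161/200, strictly above 4/5, so \<open>\<phi> \<tau>1\<close> is at most \<open>\<theta>\<close>
    times itself with \<open>\<theta> < 1\<close>, which leaves only 0.\<close>
  have "\<phi> \<tau>1 = \<phi> \<tau>2" using inv[OF g1] Im1 by (simp add: \<tau>2_def)
  also have "\<dots> \<le> \<theta> * \<phi> \<tau>1" unfolding \<theta>_def by (rule main) (use Im2 in \<open>simp add: \<tau>2_def\<close>)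
  finally have "(1 - \<theta>) * \<phi> \<tau>1 \<le> 0" by (simp add: algebra_simps)
  hence le0: "\<phi> \<tau>1 \<le> 0" using \<theta> by (simp add: mult_le_0_iff)
  obtain \<gamma> where g: "\<gamma> \<in> SL2Z" and Im\<gamma>: "Im (moeb \<gamma> \<tau>) \<ge> 161/200"
    using exists_moeb_Im_large[OF \<tau>] .
  have "\<phi> \<tau> = \<phi> (moeb \<gamma> \<tau>)" using inv[OF g \<tau>] by simp
  also have "\<dots> \<le> exp ((real k * 5/4 - 4 * pi * real m) * (Im (moeb \<gamma> \<tau>) - 4/5)) * \<phi> \<tau>1"
    by (rule main) (use Im\<gamma> in simp)
  also have "\<dots> \<le> 0" by (rule mult_nonneg_nonpos[OF exp_ge_zero le0])
  finally have "(norm (G \<tau>))\<^sup>2 * Im \<tau> ^ k \<le> 0" by (simp add: \<phi>_def)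
  moreover have "Im \<tau> ^ k > 0" using \<tau> by simp
  ultimately have "(norm (G \<tau>))\<^sup>2 \<le> 0" by (simp only: mult_le_0_iff) auto
  thus ?thesis by simp
qed

section \<open>Components at the cusps\<close>

lemma mat22_one_mult: "mat22 1 0 0 1 ** A = A" "A ** mat22 1 0 0 1 = A"
  by (simp_all add: mat2_eq_iff mat2_mult_sel)

definition lift2 :: "nat \<Rightarrow> int \<Rightarrow> int \<Rightarrow> int^2^2" where
  "lift2 p c d = (SOME \<gamma>. \<gamma> \<in> SL2Z \<and> [\<gamma>$2$1 = c] (mod int p) \<and> [\<gamma>$2$2 = d] (mod int p))"

definition admissible :: "nat \<Rightarrow> int \<Rightarrow> int \<Rightarrow> bool" where
  "admissible p c d \<longleftrightarrow> \<not> (int p dvd c \<and> int p dvd d)"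

lemma SL2Z_row_exists:
  assumes "coprime c d"
  shows "\<exists>\<gamma>. \<gamma> \<in> SL2Z \<and> \<gamma>$2$1 = c \<and> \<gamma>$2$2 = d"
proof -
  obtain u v where uv: "u * c + v * d = 1" using bezout_int[of c d] assms by auto
  have "mat22 v (- u) c d \<in> SL2Z" using uv by (simp add: SL2Z_iff algebra_simps)
  thus ?thesis by (intro exI[of _ "mat22 v (- u) c d"]) simp
qed

lemma lift2_exists:
  assumes p: "prime p" and adm: "admissible p c d"
  shows "\<exists>\<gamma>. \<gamma> \<in> SL2Z \<and> [\<gamma>$2$1 = c] (mod int p) \<and> [\<gamma>$2$2 = d] (mod int p)"
proof (cases "int p dvd c")
  case False
  hence "coprime (int p) c" using p by (intro prime_imp_coprime) simp_all
  \<comment> \<open>A bottom row has to be coprime over the integers, not only mod \<open>p\<close>;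
    prescribing \<open>x\<close> to be 1 mod \<open>c\<close> achieves this without disturbing its
    class mod \<open>p\<close>.\<close>
  then obtain x where x: "[x = d] (mod int p)" "[x = 1] (mod c)"
    using binary_chinese_remainder_int by blast
  from x(2) have "coprime c x" by (metis cong_imp_coprime cong_sym coprime_1_left coprime_commute)
  from SL2Z_row_exists[OF this] x(1) show ?thesis by force
next
  case True
  hence "\<not> int p dvd d" using adm by (simp add: admissible_def)
  hence "coprime (int p) d" using p by (intro prime_imp_coprime) simp_all
  \<comment> \<open>Here the row is \<open>(p, d)\<close>: the entry \<open>c\<close> may be
    replaced by \<open>p\<close>, since both are 0 mod \<open>p\<close>.\<close>
  from SL2Z_row_exists[OF this] True show ?thesis
    by (force simp: cong_iff_dvd_diff)
qed

lemma lift2: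
  assumes "prime p" "admissible p c d"
  shows "lift2 p c d \<in> SL2Z" "[lift2 p c d $2$1 = c] (mod int p)" "[lift2 p c d $2$2 = d] (mod int p)"
  using someI_ex[OF lift2_exists[OF assms]] unfolding lift2_def by blast+

text \<open>If the bottom rows of \<open>A\<close> and \<open>B\<close> agree mod \<open>p\<close>,
  then \<open>A B^(-1)\<close> lies in \<open>Gamma1 p\<close>. This makes the component attached to
  a vector mod \<open>p\<close> independent of the chosen lift.\<close>

lemma modular_forms_slash_row:
  assumes f: "f \<in> modular_forms k (Gamma1 p)" and A: "A \<in> SL2Z" and B: "B \<in> SL2Z"
    and 1: "[A$2$1 = B$2$1] (mod int p)" and 2: "[A$2$2 = B$2$2] (mod int p)"
  shows "slash k f A = slash k f B"
proof -
  define \<delta> where "\<delta> = A ** adj2 B"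
  have \<delta>: "\<delta> \<in> SL2Z" unfolding \<delta>_def by (rule SL2Z_mult[OF A adj2_SL2Z[OF B]])
  have dB: "B$1$1 * B$2$2 - B$1$2 * B$2$1 = 1" using B by (simp add: SL2Z_iff)
  have "\<delta>$2$1 = A$2$1 * B$2$2 - A$2$2 * B$2$1" by (simp add: \<delta>_def mat2_mult_sel adj2_def)
  moreover have "[A$2$1 * B$2$2 - A$2$2 * B$2$1 = B$2$1 * B$2$2 - B$2$2 * B$2$1] (mod int p)"
    by (intro cong_diff cong_mult 1 2 cong_refl)
  ultimately have d21: "[\<delta>$2$1 = 0] (mod int p)" by (simp add: mult.commute)
  have "\<delta>$2$2 = B$1$1 * A$2$2 - B$1$2 * A$2$1" by (simp add: \<delta>_def mat2_mult_sel adj2_def)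
  moreover have "[B$1$1 * A$2$2 - B$1$2 * A$2$1 = B$1$1 * B$2$2 - B$1$2 * B$2$1] (mod int p)"
    by (intro cong_diff cong_mult 1 2 cong_refl)
  ultimately have d22: "[\<delta>$2$2 = 1] (mod int p)" using dB by simp
  \<comment> \<open>The congruence for the upper left entry is forced by the other two and the
    determinant.\<close>
  have "[\<delta>$1$1 * 1 = \<delta>$1$1 * \<delta>$2$2 - \<delta>$1$2 * 0] (mod int p)"
    unfolding mult_zero_right diff_0_right by (intro cong_mult cong_refl cong_sym[OF d22])
  also have "[\<delta>$1$1 * \<delta>$2$2 - \<delta>$1$2 * 0 = \<delta>$1$1 * \<delta>$2$2 - \<delta>$1$2 * \<delta>$2$1] (mod int p)"
    by (intro cong_diff cong_mult cong_refl cong_sym[OF d21])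
  also have "\<delta>$1$1 * \<delta>$2$2 - \<delta>$1$2 * \<delta>$2$1 = 1" using \<delta> by (simp add: SL2Z_iff)
  finally have "\<delta> \<in> Gamma1 p" using \<delta> d21 d22 by (simp add: Gamma1_def)
  hence inv: "slash k f \<delta> = f" using f by (simp add: modular_forms_def)
  have "\<delta> ** B = A" by (simp add: \<delta>_def matrix_mul_assoc[symmetric] adj2_mult[OF B] mat22_one_mult)
  hence "slash k f A = slash k (slash k f \<delta>) B" by (simp add: slash_slash[OF \<delta> B])
  thus ?thesis by (simp add: inv)
qed

text \<open>\<open>comp2 p k f c d\<close> is the component \<open>f\<^sub>v\<close> for \<open>v = (c, d)\<close>; it is meaningful for admissible \<open>v\<close> only.\<close>

definition comp2 :: "nat \<Rightarrow> int \<Rightarrow> (complex \<Rightarrow> complex) \<Rightarrow> int \<Rightarrow> int \<Rightarrow> complex \<Rightarrow> complex" where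
  "comp2 p k f c d = slash k f (lift2 p c d)"

lemma admissible_row:
  assumes "prime p" "\<gamma> \<in> SL2Z" "[\<gamma>$2$1 = c] (mod int p)" "[\<gamma>$2$2 = d] (mod int p)"
  shows "admissible p c d"
  unfolding admissible_def
proof
  assume "int p dvd c \<and> int p dvd d"
  hence "int p dvd \<gamma>$2$1" "int p dvd \<gamma>$2$2" using assms(3,4) by (auto simp: cong_dvd_iff)
  hence "int p dvd \<gamma>$1$1 * \<gamma>$2$2 - \<gamma>$1$2 * \<gamma>$2$1" by (intro dvd_diff dvd_mult)
  thus False using assms(1,2) by (auto simp: SL2Z_iff)
qed

lemma comp2_eqI:
  assumes p: "prime p" and f: "f \<in> modular_forms k (Gamma1 p)" and g: "\<gamma> \<in> SL2Z"
    and 1: "[\<gamma>$2$1 = c] (mod int p)" and 2: "[\<gamma>$2$2 = d] (mod int p)"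
  shows "comp2 p k f c d = slash k f \<gamma>"
proof -
  have adm: "admissible p c d" by (rule admissible_row[OF p g 1 2])
  show ?thesis unfolding comp2_def
    using lift2[OF p adm] 1 2 by (intro modular_forms_slash_row[OF f _ g]) (auto intro: cong_trans cong_sym)
qed

lemma comp2_cong:
  assumes "prime p" "f \<in> modular_forms k (Gamma1 p)" "admissible p c d" "[c' = c] (mod int p)" "[d' = d] (mod int p)"
  shows "comp2 p k f c' d' = comp2 p k f c d"
proof -
  have "comp2 p k f c' d' = slash k f (lift2 p c d)"
    using lift2[OF assms(1,3)] assms(4,5) by (intro comp2_eqI[OF assms(1,2)]) (auto intro: cong_trans cong_sym)
  thus ?thesis by (simp add: comp2_def)
qed

lemma slash_comp2:
  assumes p: "prime p" and f: "f \<in> modular_forms k (Gamma1 p)" and adm: "admissible p c d" and g: "\<gamma> \<in> SL2Z"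
  shows "slash k (comp2 p k f c d) \<gamma> = comp2 p k f (c * \<gamma>$1$1 + d * \<gamma>$2$1) (c * \<gamma>$1$2 + d * \<gamma>$2$2)"
proof -
  note l = lift2[OF p adm]
  show ?thesis unfolding comp2_def[of p k f c d] slash_slash[OF l(1) g]
    by (rule comp2_eqI[OF p f SL2Z_mult[OF l(1) g], symmetric])
       (auto simp: mat2_mult_sel intro!: cong_add cong_mult l(2,3))
qed

lemma comp2_moeb:
  assumes "prime p" "f \<in> modular_forms 1 (Gamma1 p)" "admissible p c d" "\<gamma> \<in> SL2Z" "Im \<tau> > 0"
  shows "comp2 p 1 f c d (moeb \<gamma> \<tau>) =
     jfac \<gamma> \<tau> * comp2 p 1 f (c * \<gamma>$1$1 + d * \<gamma>$2$1) (c * \<gamma>$1$2 + d * \<gamma>$2$2) \<tau>"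
  using jfac_nonzero[OF assms(4,5)]
  by (simp add: slash_comp2[OF assms(1-4), symmetric] slash_eq[OF assms(5)] power_int_minus)

lemma comp2_uminus:
  assumes "prime p" "f \<in> modular_forms 1 (Gamma1 p)" "admissible p c d"
  shows "comp2 p 1 f (- c) (- d) = (\<lambda>\<tau>. - comp2 p 1 f c d \<tau>)"
proof
  fix \<tau>
  have I: "mat22 (-1) 0 0 (-1) \<in> SL2Z" by (simp add: SL2Z_iff)
  show "comp2 p 1 f (- c) (- d) \<tau> = - comp2 p 1 f c d \<tau>"
  proof (cases "Im \<tau> > 0")
    case True
    thus ?thesis using comp2_moeb[OF assms I True] by (simp add: moeb_def jfac_def)
  next
    case False
    thus ?thesis by (simp add: comp2_def slash_outside)
  qed
qed

lemma comp2_holomorphic: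
  assumes "prime p" "f \<in> modular_forms k (Gamma1 p)" "admissible p c d"
  shows "comp2 p k f c d holomorphic_on upper_half_plane"
  unfolding comp2_def by (rule holomorphic_slash) (use assms lift2 in \<open>auto simp: modular_forms_def\<close>)

lemma comp2_bounded:
  assumes "prime p" "f \<in> modular_forms k (Gamma1 p)" "admissible p c d"
  shows "bounded_at_i_infinity (comp2 p k f c d)"
  unfolding comp2_def using assms lift2(1)[OF assms(1,3)] by (auto simp: modular_forms_def)

text \<open>The cusp width: translation by it fixes \<open>(c, d)\<close> mod \<open>p\<close> under
  right multiplication. A component vanishing at infinity therefore has order at least
  \<open>1 / width\<close> in \<open>qvar \<tau>\<close>.\<close>

definition width :: "nat \<Rightarrow> int \<Rightarrow> nat" where
  "width p c = (if int p dvd c then 1 else p)"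

lemma comp2_periodic:
  assumes "prime p" "f \<in> modular_forms 1 (Gamma1 p)" "admissible p c d" "Im \<tau> > 0"
  shows "comp2 p 1 f c d (\<tau> + of_nat (width p c)) = comp2 p 1 f c d \<tau>"
proof -
  have T: "mat22 1 (int (width p c)) 0 1 \<in> SL2Z" by (simp add: SL2Z_iff)
  have "comp2 p 1 f c d (moeb (mat22 1 (int (width p c)) 0 1) \<tau>) = comp2 p 1 f c (c * int (width p c) + d) \<tau>"
    using comp2_moeb[OF assms(1-3) T assms(4)] by (simp add: jfac_def)
  also have "comp2 p 1 f c (c * int (width p c) + d) = comp2 p 1 f c d"
    by (rule comp2_cong[OF assms(1-3)]) (auto simp: width_def cong_iff_dvd_diff)
  finally show ?thesis by (simp add: moeb_def jfac_def)
qed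

lemma comp2_descent:
  assumes "prime p" "f \<in> modular_forms 1 (Gamma1 p)" "admissible p c d"
  obtains h where "h holomorphic_on ball 0 1"
    "\<And>\<tau>. Im \<tau> > 0 \<Longrightarrow> comp2 p 1 f c d \<tau> = h (qvar (\<tau> / of_nat (width p c)))"
proof (rule q_descent[of "real (width p c)" "comp2 p 1 f c d"])
  show "real (width p c) > 0" using prime_gt_0_nat[OF assms(1)] by (simp add: width_def)
  show "comp2 p 1 f c d (\<tau> + of_real (real (width p c))) = comp2 p 1 f c d \<tau>" if "Im \<tau> > 0" for \<tau>
    using comp2_periodic[OF assms that] by simp
  fix h assume "h holomorphic_on ball 0 1"
    "\<And>\<tau>. Im \<tau> > 0 \<Longrightarrow> comp2 p 1 f c d \<tau> = h (qvar (\<tau> / of_real (real (width p c))))"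
  thus thesis by (intro that[of h]) simp_all
qed (use comp2_holomorphic[OF assms] comp2_bounded[OF assms] in auto)

text \<open>The constant term, taken as a limit along the imaginary axis so that no function on the
  \<open>q\<close>-disc has to be chosen. For components the limit exists by
  \<open>tendsto_cuspval_comp2\<close>.\<close>

definition cuspval :: "(complex \<Rightarrow> complex) \<Rightarrow> complex" where
  "cuspval F = Lim at_top (\<lambda>y::real. F (\<i> * of_real y))"

lemma cuspval_eqI: "((\<lambda>y::real. F (\<i> * of_real y)) \<longlongrightarrow> L) at_top \<Longrightarrow> cuspval F = L"
  unfolding cuspval_def by (rule tendsto_Lim) auto

lemma tendsto_descent:
  assumes h: "h holomorphic_on ball 0 1" and N: "N > 0"
    and F: "\<And>\<tau>. Im \<tau> > 0 \<Longrightarrow> F \<tau> = h (qvar (\<tau> / of_nat N))"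
  shows "((\<lambda>y::real. F (\<i> * of_real y)) \<longlongrightarrow> h 0) at_top"
proof -
  have "isCont h 0"
    by (rule continuous_on_interior[of "ball 0 1"]) (use h in \<open>auto simp: interior_open intro: holomorphic_on_imp_continuous_on\<close>)
  moreover have "((\<lambda>y::real. qvar (\<i> * of_real y / of_nat N)) \<longlongrightarrow> 0) at_top"
  proof (rule tendsto_norm_zero_cancel)
    have "((\<lambda>y::real. exp (- (2 * pi / real N) * y)) \<longlongrightarrow> 0) at_top"
      using N by real_asymp
    thus "((\<lambda>y::real. norm (qvar (\<i> * of_real y / of_nat N))) \<longlongrightarrow> 0) at_top"
      by (simp add: norm_qvar)
  qed
  ultimately have "((\<lambda>y::real. h (qvar (\<i> * of_real y / of_nat N))) \<longlongrightarrow> h 0) at_top"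
    by (rule isCont_tendsto_compose)
  thus ?thesis
    by (rule Lim_transform_eventually) (rule eventually_mono[OF eventually_gt_at_top[of 0]], simp add: F)
qed

lemma tendsto_cuspval_comp2:
  assumes "prime p" "f \<in> modular_forms 1 (Gamma1 p)" "admissible p c d"
  shows "((\<lambda>y::real. comp2 p 1 f c d (\<i> * of_real y)) \<longlongrightarrow> cuspval (comp2 p 1 f c d)) at_top"
proof -
  obtain h where h: "h holomorphic_on ball 0 1"
    "\<And>\<tau>. Im \<tau> > 0 \<Longrightarrow> comp2 p 1 f c d \<tau> = h (qvar (\<tau> / of_nat (width p c)))"
    using comp2_descent[OF assms] by blast
  have "width p c > 0" using prime_gt_0_nat[OF assms(1)] by (simp add: width_def)
  from tendsto_descent[OF h(1) this h(2)] show ?thesis using cuspval_eqI by metis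
qed

text \<open>The disc function \<open>h\<close> vanishes at 0 and its derivative is bounded on a
  smaller closed disc, so \<open>|h x| <= B |x|\<close> there; the condition
  \<open>Im \<tau> > 1\<close> keeps the disc variable in it.\<close>

lemma comp2_decay:
  assumes "prime p" "f \<in> modular_forms 1 (Gamma1 p)" "admissible p c d" "cuspval (comp2 p 1 f c d) = 0"
  shows "\<exists>B. \<forall>\<tau>. Im \<tau> > 1 \<longrightarrow> norm (comp2 p 1 f c d \<tau>) \<le> B * norm (qvar (\<tau> / of_nat (width p c)))"
proof -
  obtain h where h: "h holomorphic_on ball 0 1"
    and F: "\<And>\<tau>. Im \<tau> > 0 \<Longrightarrow> comp2 p 1 f c d \<tau> = h (qvar (\<tau> / of_nat (width p c)))"
    using comp2_descent[OF assms(1-3)] by blast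
  have w: "width p c > 0" using prime_gt_0_nat[OF assms(1)] by (simp add: width_def)
  have h0: "h 0 = 0" using cuspval_eqI[OF tendsto_descent[OF h w F]] assms(4) by simp
  define r where "r = exp (- 2 * pi / real (width p c))"
  have r: "0 < r" "r < 1" using w by (auto simp: r_def)
  have sub: "cball (0::complex) r \<subseteq> ball 0 1" using r by auto
  have "continuous_on (cball 0 r) (deriv h)"
    by (intro holomorphic_on_imp_continuous_on holomorphic_on_subset[OF holomorphic_deriv[OF h] sub]) auto
  hence "bounded (deriv h ` cball 0 r)" by (intro compact_imp_bounded compact_continuous_image) auto
  then obtain B where B: "\<And>x. x \<in> cball 0 r \<Longrightarrow> norm (deriv h x) \<le> B" unfolding bounded_iff by blast
  have "norm (h x - h 0) \<le> B * norm (x - 0)" if "x \<in> cball 0 r" for x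
    using that r sub h B
    by (intro field_differentiable_bound[of "cball 0 r" h "deriv h"])
       (auto intro!: has_field_derivative_at_within holomorphic_derivI[OF h open_ball])
  hence hB: "norm (h x) \<le> B * norm x" if "norm x \<le> r" for x using that h0 by auto
  show ?thesis
  proof (intro exI allI impI)
    fix \<tau> :: complex assume t: "Im \<tau> > 1"
    have "norm (qvar (\<tau> / of_nat (width p c))) \<le> r"
      using t w by (simp add: norm_qvar r_def field_simps)
    thus "norm (comp2 p 1 f c d \<tau>) \<le> B * norm (qvar (\<tau> / of_nat (width p c)))" using F t hB by simp
  qed
qed

text \<open>Representatives of the nonzero vectors mod \<open>p\<close>, in two blocks because the
  first consists of the cusps of width 1 and the second of those of width \<open>p\<close>.\<close>

definition row_vectors :: "nat \<Rightarrow> (int \<times> int) set" where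
  "row_vectors p = {0::int} \<times> {1..<int p} \<union> {1..<int p} \<times> {0..<int p}"

lemma finite_row_vectors [simp]: "finite (row_vectors p)" by (simp add: row_vectors_def)

lemma row_vectors_iff: "(c, d) \<in> row_vectors p \<longleftrightarrow> 0 \<le> c \<and> c < int p \<and> 0 \<le> d \<and> d < int p \<and> admissible p c d"
  by (auto simp: row_vectors_def admissible_def zdvd_not_zless)
     (metis dvd_0_right linorder_not_less order_le_less zle_iff_zadd int_one_le_iff_zero_less)+

lemma admissible_mod: "admissible p (c mod int p) (d mod int p) \<longleftrightarrow> admissible p c d"
  by (simp add: admissible_def dvd_mod_iff)

lemma admissible_mult:
  assumes "\<gamma> \<in> SL2Z" "admissible p c d"
  shows "admissible p (c * \<gamma>$1$1 + d * \<gamma>$2$1) (c * \<gamma>$1$2 + d * \<gamma>$2$2)"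
  unfolding admissible_def
proof
  let ?c = "c * \<gamma>$1$1 + d * \<gamma>$2$1" and ?d = "c * \<gamma>$1$2 + d * \<gamma>$2$2"
  assume *: "int p dvd ?c \<and> int p dvd ?d"
  have det: "\<gamma>$1$1 * \<gamma>$2$2 - \<gamma>$1$2 * \<gamma>$2$1 = 1" using assms(1) by (simp add: SL2Z_iff)
  have "c = c * (\<gamma>$1$1 * \<gamma>$2$2 - \<gamma>$1$2 * \<gamma>$2$1)" "d = d * (\<gamma>$1$1 * \<gamma>$2$2 - \<gamma>$1$2 * \<gamma>$2$1)" by (simp_all add: det)
  hence "c = ?c * \<gamma>$2$2 - ?d * \<gamma>$2$1" "d = ?d * \<gamma>$1$1 - ?c * \<gamma>$1$2" by (simp_all add: algebra_simps)
  hence "int p dvd c" "int p dvd d" using * by (metis dvd_diff dvd_mult2)+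
  thus False using assms(2) by (simp add: admissible_def)
qed

definition row_act :: "nat \<Rightarrow> int^2^2 \<Rightarrow> int \<times> int \<Rightarrow> int \<times> int" where
  "row_act p \<gamma> v = ((fst v * \<gamma>$1$1 + snd v * \<gamma>$2$1) mod int p, (fst v * \<gamma>$1$2 + snd v * \<gamma>$2$2) mod int p)"

lemma row_act_row_vectors: "p > 0 \<Longrightarrow> \<gamma> \<in> SL2Z \<Longrightarrow> v \<in> row_vectors p \<Longrightarrow> row_act p \<gamma> v \<in> row_vectors p"
  by (cases v) (simp add: row_act_def row_vectors_iff admissible_mod admissible_mult)

lemma row_act_mult:
  "row_act p B (row_act p A v) = row_act p (A ** B) v"
proof -
  have *: "((x mod int p) * a + (y mod int p) * b) mod int p = (x * a + y * b) mod int p" for x y a b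
    unfolding cong_def[symmetric] by (intro cong_add cong_mult) (simp_all add: cong_def)
  show ?thesis unfolding row_act_def fst_conv snd_conv * mat2_mult_sel
    by (simp only: ring_distribs ac_simps)
qed

lemma row_act_one: "v \<in> row_vectors p \<Longrightarrow> row_act p (mat22 1 0 0 1) v = v"
  by (cases v) (simp add: row_act_def row_vectors_iff)

lemma bij_row_act:
  assumes "p > 0" "\<gamma> \<in> SL2Z"
  shows "bij_betw (row_act p \<gamma>) (row_vectors p) (row_vectors p)"
  by (rule bij_betw_byWitness[where f' = "row_act p (adj2 \<gamma>)"])
     (use assms adj2_SL2Z in \<open>auto simp: row_act_mult adj2_mult row_act_one row_act_row_vectors\<close>)

lemma comp2_row_act:
  assumes "prime p" "f \<in> modular_forms 1 (Gamma1 p)" "v \<in> row_vectors p" "\<gamma> \<in> SL2Z" "Im \<tau> > 0"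
  shows "comp2 p 1 f (fst v) (snd v) (moeb \<gamma> \<tau>) =
     jfac \<gamma> \<tau> * comp2 p 1 f (fst (row_act p \<gamma> v)) (snd (row_act p \<gamma> v)) \<tau>"
proof -
  have adm: "admissible p (fst v) (snd v)" using assms(3) by (cases v) (simp add: row_vectors_iff)
  have "comp2 p 1 f (fst (row_act p \<gamma> v)) (snd (row_act p \<gamma> v)) =
      comp2 p 1 f (fst v * \<gamma>$1$1 + snd v * \<gamma>$2$1) (fst v * \<gamma>$1$2 + snd v * \<gamma>$2$2)"
    unfolding row_act_def fst_conv snd_conv
    by (rule comp2_cong[OF assms(1,2) admissible_mult[OF assms(4) adm]]) (simp_all add: cong_def)
  thus ?thesis by (simp only: comp2_moeb[OF assms(1,2) adm assms(4,5)])
qed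

text \<open>Holomorphic functions on a connected open set have no zero divisors: where one factor is
  nonzero, on an open set, the remaining product vanishes, hence everywhere by the identity
  theorem.\<close>

lemma prod_holomorphic_zero:
  assumes "finite I" "open S" "connected S" "S \<noteq> {}"
    and "\<And>i. i \<in> I \<Longrightarrow> f i holomorphic_on S" and "\<And>z. z \<in> S \<Longrightarrow> (\<Prod>i\<in>I. f i z) = (0::complex)"
  shows "\<exists>i\<in>I. \<forall>z\<in>S. f i z = 0"
  using assms(1,5,6)
proof (induction I)
  case empty
  thus ?case using assms(4) by auto
next
  case (insert i I)
  show ?case
  proof (cases "\<forall>z\<in>S. f i z = 0")
    case False
    then obtain z0 where z0: "z0 \<in> S" "f i z0 \<noteq> 0" by blast
    define U where "U = {z \<in> S. f i z \<noteq> 0}"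
    have hi: "f i holomorphic_on S" using insert.prems by simp
    have "U = S \<inter> f i -` (- {0})" by (auto simp: U_def)
    hence "open U"
      using continuous_open_preimage[OF holomorphic_on_imp_continuous_on[OF hi] assms(2), of "- {0}"]
      by (simp add: open_Compl)
    moreover have "U \<noteq> {}" "U \<subseteq> S" using z0 by (auto simp: U_def)
    moreover have "(\<lambda>z. \<Prod>i\<in>I. f i z) holomorphic_on S" using insert.prems by (intro holomorphic_intros) auto
    moreover have "(\<Prod>i\<in>I. f i z) = 0" if "z \<in> U" for z
      using insert.prems(2)[of z] that insert.hyps by (simp add: U_def)
    ultimately have "(\<Prod>i\<in>I. f i z) = 0" if "z \<in> S" for z
      using analytic_continuation_open[of U S "\<lambda>z. \<Prod>i\<in>I. f i z" "\<lambda>_. 0" z] assms(2,3) that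
      by (auto intro: holomorphic_on_const)
    thus ?thesis using insert by auto
  qed auto
qed

theorem no_cusp_forms:
  assumes p: "prime p" "p \<le> 19" and f: "f \<in> modular_forms 1 (Gamma1 p)"
    and cv: "\<And>c d. admissible p c d \<Longrightarrow> cuspval (comp2 p 1 f c d) = 0"
  shows "f = 0"
proof -
  have p0: "p > 0" using prime_gt_0_nat[OF p(1)] .
  let ?F = "\<lambda>v. comp2 p 1 f (fst v) (snd v)"
  define G where "G = (\<lambda>\<tau>. \<Prod>v\<in>row_vectors p. ?F v \<tau>)"
  have adm: "admissible p (fst v) (snd v)" if "v \<in> row_vectors p" for v using that by (cases v) (simp add: row_vectors_iff)
  have card1: "card ({0::int} \<times> {1..<int p}) = p - 1" "card ({1..<int p} \<times> {0..<int p}) = (p - 1) * p"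
    by (auto simp: card_cartesian_product nat_diff_distrib)
  have card: "card (row_vectors p) = (p - 1) + (p - 1) * p"
    unfolding row_vectors_def by (subst card_Un_disjoint) (auto simp: card1)
  have hol: "G holomorphic_on upper_half_plane"
    unfolding G_def by (intro holomorphic_intros comp2_holomorphic p f adm)
  have mod: "G (moeb \<gamma> \<tau>) = jfac \<gamma> \<tau> ^ card (row_vectors p) * G \<tau>" if g: "\<gamma> \<in> SL2Z" "Im \<tau> > 0" for \<gamma> \<tau>
  proof -
    have "G (moeb \<gamma> \<tau>) = (\<Prod>v\<in>row_vectors p. jfac \<gamma> \<tau> * ?F (row_act p \<gamma> v) \<tau>)"
      unfolding G_def by (intro prod.cong refl comp2_row_act p f g)
    also have "\<dots> = jfac \<gamma> \<tau> ^ card (row_vectors p) * (\<Prod>v\<in>row_vectors p. ?F (row_act p \<gamma> v) \<tau>)"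
      by (simp add: prod.distrib)
    also have "(\<Prod>v\<in>row_vectors p. ?F (row_act p \<gamma> v) \<tau>) = G \<tau>"
      unfolding G_def by (rule prod.reindex_bij_betw[OF bij_row_act[OF p0 g(1)]])
    finally show ?thesis .
  qed
  have "\<forall>v\<in>row_vectors p. \<exists>B. \<forall>\<tau>. Im \<tau> > 1 \<longrightarrow> norm (?F v \<tau>) \<le> B * norm (qvar (\<tau> / of_nat (width p (fst v))))"
    using comp2_decay[OF p(1) f adm cv[OF adm]] by blast
  then obtain B where B: "\<And>v \<tau>. v \<in> row_vectors p \<Longrightarrow> Im \<tau> > 1 \<Longrightarrow> norm (?F v \<tau>) \<le> B v * norm (qvar (\<tau> / of_nat (width p (fst v))))"
    by metis
  \<comment> \<open>The order of \<open>G\<close> at infinity: \<open>p - 1\<close> vectors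
    contribute 1 each, and \<open>p (p - 1)\<close> vectors contribute \<open>1 / p\<close>
    each.\<close>
  have sumw: "(\<Sum>v\<in>row_vectors p. 1 / real (width p (fst v))) = 2 * real (p - 1)"
  proof -
    have "(\<Sum>v\<in>row_vectors p. 1 / real (width p (fst v))) =
       (\<Sum>v\<in>{0::int} \<times> {1..<int p}. 1 / real (width p (fst v))) + (\<Sum>v\<in>{1..<int p} \<times> {0..<int p}. 1 / real (width p (fst v)))"
      unfolding row_vectors_def by (rule sum.union_disjoint) auto
    also have "(\<Sum>v\<in>{0::int} \<times> {1..<int p}. 1 / real (width p (fst v))) = (\<Sum>v\<in>{0::int} \<times> {1..<int p}. 1)"
      by (intro sum.cong) (auto simp: width_def)
    also have "(\<Sum>v\<in>{1..<int p} \<times> {0..<int p}. 1 / real (width p (fst v))) = (\<Sum>v\<in>{1..<int p} \<times> {0..<int p}. 1 / real p)"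
      by (intro sum.cong) (auto simp: width_def zdvd_not_zless)
    finally show ?thesis using p0 by (simp add: card1 del: card_cartesian_product)
  qed
  have bd: "bounded_at_i_infinity (\<lambda>\<tau>. G \<tau> / qvar \<tau> ^ (2 * (p - 1)))"
    unfolding bounded_at_i_infinity_def
  proof (intro exI allI impI)
    fix \<tau> :: complex assume t: "Im \<tau> > 1"
    have "norm (G \<tau>) \<le> (\<Prod>v\<in>row_vectors p. B v * norm (qvar (\<tau> / of_nat (width p (fst v)))))"
      unfolding G_def prod_norm[symmetric] by (intro prod_mono conjI B t) auto
    also have "\<dots> = (\<Prod>v\<in>row_vectors p. B v) * (\<Prod>v\<in>row_vectors p. exp (- 2 * pi * Im \<tau> * (1 / real (width p (fst v)))))"
      by (simp add: prod.distrib norm_qvar)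
    also have "(\<Prod>v\<in>row_vectors p. exp (- 2 * pi * Im \<tau> * (1 / real (width p (fst v))))) = exp (- 2 * pi * Im \<tau> * (2 * real (p - 1)))"
      by (subst exp_sum[symmetric]) (simp_all only: finite_row_vectors sum_distrib_left[symmetric] sumw)
    also have "\<dots> = norm (qvar \<tau>) ^ (2 * (p - 1))"
      unfolding norm_qvar exp_of_nat_mult[symmetric] by (simp add: mult_ac)
    finally show "norm (G \<tau> / qvar \<tau> ^ (2 * (p - 1))) \<le> (\<Prod>v\<in>row_vectors p. B v)"
      by (simp add: norm_divide norm_power divide_le_eq)
  qed
  \<comment> \<open>After division by \<open>p - 1\<close> this reads
    \<open>5 (p + 1) < 32 pi\<close>; for \<open>p = 19\<close> it is
    \<open>100 < 100.53...\<close>.\<close>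
  have km: "real (card (row_vectors p)) * 5 < 16 * pi * real (2 * (p - 1))"
  proof -
    have "(x + x * y) * 5 = x * (5 * (1 + y))" for x y :: real by (simp add: algebra_simps)
    hence "real (card (row_vectors p)) * 5 = real (p - 1) * (5 * (1 + real p))"
      unfolding card of_nat_add of_nat_mult by blast
    also have "\<dots> < real (p - 1) * (32 * pi)"
      using p(2) prime_gt_1_nat[OF p(1)] pi_approx(1) by (intro mult_strict_left_mono) auto
    also have "x * (32 * pi) = 16 * pi * (2 * x)" for x by simp
    finally show ?thesis unfolding of_nat_mult of_nat_numeral .
  qed
  have "G \<tau> = 0" if "\<tau> \<in> upper_half_plane" for \<tau>
    using level_one_vanishing[OF hol mod bd km] that by (simp add: uhp_iff)
  hence "\<exists>v\<in>row_vectors p. \<forall>z\<in>upper_half_plane. ?F v z = 0"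
    unfolding G_def
  proof (intro prod_holomorphic_zero open_uhp connected_uhp)
    show "upper_half_plane \<noteq> {}" by (auto simp: upper_half_plane_def intro: exI[of _ \<i>])
  qed (use comp2_holomorphic[OF p(1) f adm] in auto)
  \<comment> \<open>One vanishing component suffices: undoing its matrix recovers \<open>f\<close>
    from it.\<close>
  then obtain v where v: "v \<in> row_vectors p" "\<And>z. Im z > 0 \<Longrightarrow> ?F v z = 0" by (auto simp: uhp_iff)
  note l = lift2[OF p(1) adm[OF v(1)]]
  show ?thesis
  proof
    fix \<tau>
    show "f \<tau> = 0 \<tau>"
    proof (cases "Im \<tau> > 0")
      case True
      let ?\<tau> = "moeb (adj2 (lift2 p (fst v) (snd v))) \<tau>"
      have I: "Im ?\<tau> > 0" by (rule Im_moeb_pos[OF adj2_SL2Z[OF l(1)] True])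
      have e: "moeb (lift2 p (fst v) (snd v)) ?\<tau> = \<tau>"
        using moeb_mult[OF l(1) adj2_SL2Z[OF l(1)] True] by (simp add: adj2_mult[OF l(1)])
      show ?thesis using v(2)[OF I] jfac_nonzero[OF l(1) I] by (simp add: comp2_def slash_eq[OF I] e)
    next
      case False
      thus ?thesis using f by (simp add: modular_forms_def uhp_iff)
    qed
  qed
qed

section \<open>Isotropy of the cusp values\<close>

lemma has_field_derivative_moeb:
  assumes "\<gamma> \<in> SL2Z" "Im \<tau> > 0"
  shows "(moeb \<gamma> has_field_derivative 1 / (jfac \<gamma> \<tau>)\<^sup>2) (at \<tau>)"
proof -
  have nz: "of_int (\<gamma>$2$1) * \<tau> + of_int (\<gamma>$2$2) \<noteq> 0" using jfac_nonzero[OF assms] by (simp add: jfac_def)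
  have det: "of_int (\<gamma>$1$1) * of_int (\<gamma>$2$2) - of_int (\<gamma>$1$2) * of_int (\<gamma>$2$1) = (1::complex)"
    by (rule SL2Z_det_of_int[OF assms(1)])
  have "(of_int (\<gamma>$1$1) * (of_int (\<gamma>$2$1) * \<tau> + of_int (\<gamma>$2$2)) -
      (of_int (\<gamma>$1$1) * \<tau> + of_int (\<gamma>$1$2)) * of_int (\<gamma>$2$1)) =
      of_int (\<gamma>$1$1) * of_int (\<gamma>$2$2) - of_int (\<gamma>$1$2) * (of_int (\<gamma>$2$1) :: complex)"
    by (simp add: algebra_simps)
  note num = this[unfolded det]
  show ?thesis unfolding moeb_def[abs_def] jfac_def
    by (rule derivative_eq_intros refl nz)+ (simp add: num power2_eq_square)
qed

lemma weight2_level_one_constant_term: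
  assumes hol: "W holomorphic_on upper_half_plane"
    and mod: "\<And>\<gamma> \<tau>. \<gamma> \<in> SL2Z \<Longrightarrow> Im \<tau> > 0 \<Longrightarrow> W (moeb \<gamma> \<tau>) = (jfac \<gamma> \<tau>)\<^sup>2 * W \<tau>"
    and h: "h holomorphic_on ball 0 1" and Wh: "\<And>\<tau>. Im \<tau> > 0 \<Longrightarrow> W \<tau> = h (qvar \<tau>)"
  shows "h 0 = 0"
proof -
  obtain A where "\<And>\<tau>. \<tau> \<in> upper_half_plane \<Longrightarrow> (A has_field_derivative W \<tau>) (at \<tau> within upper_half_plane)"
    using holomorphic_convex_primitive'[OF convex_uhp open_uhp hol] by blast
  hence A: "(A has_field_derivative W \<tau>) (at \<tau>)" if "Im \<tau> > 0" for \<tau>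
    using that by (metis at_within_open open_uhp uhp_iff)
  have const: "f \<tau> = f \<tau>'" if "\<And>\<tau>. Im \<tau> > 0 \<Longrightarrow> (f has_field_derivative 0) (at \<tau>)" "Im \<tau> > 0" "Im \<tau>' > 0"
    for f :: "complex \<Rightarrow> complex" and \<tau> \<tau>'
    using has_field_derivative_zero_constant[OF convex_uhp, of f] that
    by (metis has_field_derivative_at_within uhp_iff)
  \<comment> \<open>Weight two is exactly what cancels the derivative of
    \<open>moeb \<gamma>\<close>, so \<open>A\<close> changes by a constant under
    \<open>\<gamma>\<close>; evaluation at the fixed point shows that this constant is 0.\<close>
  have inv: "A (moeb \<gamma> \<tau>) = A \<tau>" if g: "\<gamma> \<in> SL2Z" and z: "Im z > 0" "moeb \<gamma> z = z" and t: "Im \<tau> > 0" for \<gamma> z \<tau>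
  proof -
    have "A (moeb \<gamma> \<tau>) - A \<tau> = A (moeb \<gamma> z) - A z"
    proof (rule const[of "\<lambda>\<tau>. A (moeb \<gamma> \<tau>) - A \<tau>", OF _ t z(1)])
      fix s :: complex assume s: "Im s > 0"
      have "((\<lambda>\<tau>. A (moeb \<gamma> \<tau>)) has_field_derivative W (moeb \<gamma> s) * (1 / (jfac \<gamma> s)\<^sup>2)) (at s)"
        by (rule DERIV_chain2[OF A[OF Im_moeb_pos[OF g s]] has_field_derivative_moeb[OF g s]])
      hence "((\<lambda>\<tau>. A (moeb \<gamma> \<tau>) - A \<tau>) has_field_derivative W (moeb \<gamma> s) * (1 / (jfac \<gamma> s)\<^sup>2) - W s) (at s)"
        by (rule DERIV_diff[OF _ A[OF s]])
      thus "((\<lambda>\<tau>. A (moeb \<gamma> \<tau>) - A \<tau>) has_field_derivative 0) (at s)"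
        using jfac_nonzero[OF g s] by (simp add: mod[OF g s])
    qed
    thus ?thesis by (simp add: z)
  qed
  define S R where "S = mat22 0 (-1) 1 0" and "R = mat22 0 (-1) 1 1"
  have SR: "S \<in> SL2Z" "R \<in> SL2Z" by (simp_all add: S_def R_def SL2Z_iff)
  define \<rho> where "\<rho> = Complex (-1/2) (sqrt 3 / 2)"
  have \<rho>: "Im \<rho> > 0" by (simp add: \<rho>_def)
  have "\<rho> * \<rho> + \<rho> + 1 = 0" by (simp add: \<rho>_def complex_eq_iff)
  hence "\<rho> * (\<rho> + 1) = - 1" by (simp add: algebra_simps add_eq_0_iff)
  moreover from this have "\<rho> + 1 \<noteq> 0" by auto
  ultimately have "- 1 / (\<rho> + 1) = \<rho>" by (metis nonzero_divide_eq_eq)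
  hence fR: "moeb R \<rho> = \<rho>" by (simp add: R_def moeb_def jfac_def)
  have fS: "moeb S \<i> = \<i>" by (simp add: S_def moeb_def jfac_def)
  have per: "A (\<tau> + 1) = A \<tau>" if t: "Im \<tau> > 0" for \<tau>
  proof -
    have "A (\<tau> + 1) = A (moeb S (\<tau> + 1))" using inv[OF SR(1) _ fS] t by simp
    also have "moeb S (\<tau> + 1) = moeb R \<tau>" by (simp add: S_def R_def moeb_def jfac_def)
    also have "A \<dots> = A \<tau>" by (rule inv[OF SR(2) \<rho> fR t])
    finally show ?thesis .
  qed
  \<comment> \<open>Dividing \<open>h - h 0\<close> by the disc variable separates the constant term
    of \<open>W\<close> from a part with a 1-periodic primitive. Hence \<open>B\<close> below is a
    primitive of \<open>W\<close> whose increment from \<open>\<tau>\<close> to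
    \<open>\<tau> + 1\<close> is exactly \<open>h 0\<close>.\<close>
  define k where "k = (\<lambda>z. if z = 0 then deriv h 0 else (h z - h 0) / (z - 0))"
  have k: "k holomorphic_on ball 0 1" unfolding k_def
    by (rule pole_lemma[OF h]) (simp add: interior_open)
  obtain K where "\<And>x. x \<in> ball 0 1 \<Longrightarrow> (K has_field_derivative k x) (at x within ball 0 1)"
    using holomorphic_convex_primitive'[OF convex_ball open_ball k] by blast
  hence K: "(K has_field_derivative k x) (at x)" if "x \<in> ball 0 1" for x
    using that by (metis at_within_open open_ball)
  define B where "B = (\<lambda>\<tau>. h 0 * \<tau> + K (qvar \<tau>) / (2 * of_real pi * \<i>))"
  have B: "(B has_field_derivative W \<tau>) (at \<tau>)" if t: "Im \<tau> > 0" for \<tau>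
  proof -
    have q: "(qvar has_field_derivative qvar \<tau> * (2 * of_real pi * \<i>)) (at \<tau>)"
      unfolding qvar_def[abs_def] by (auto intro!: derivative_eq_intros)
    have "((\<lambda>\<tau>. K (qvar \<tau>)) has_field_derivative k (qvar \<tau>) * (qvar \<tau> * (2 * of_real pi * \<i>))) (at \<tau>)"
      by (rule DERIV_chain2[OF K q]) (use norm_qvar_less_1[OF t] in simp)
    hence "(B has_field_derivative h 0 * 1 + k (qvar \<tau>) * (qvar \<tau> * (2 * of_real pi * \<i>)) / (2 * of_real pi * \<i>)) (at \<tau>)"
      unfolding B_def by (intro DERIV_add DERIV_cdivide DERIV_cmult DERIV_ident)
    moreover have "h 0 * 1 + k (qvar \<tau>) * (qvar \<tau> * (2 * of_real pi * \<i>)) / (2 * of_real pi * \<i>) = W \<tau>"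
      by (simp add: Wh[OF t] k_def)
    ultimately show ?thesis by simp
  qed
  have "A (\<i> + 1) - B (\<i> + 1) = A \<i> - B \<i>"
    by (rule const[of "\<lambda>\<tau>. A \<tau> - B \<tau>"]) (use DERIV_diff[OF A B] in force)+
  hence "B (\<i> + 1) = B \<i>" using per[of \<i>] by simp
  thus ?thesis using qvar_of_int[of 1] by (simp add: B_def qvar_add algebra_simps)
qed

lemma cuspval_isotropic:
  assumes p: "prime p" and f: "f \<in> modular_forms 1 (Gamma1 p)" and g: "g \<in> modular_forms 1 (Gamma1 p)"
  shows "(\<Sum>v\<in>row_vectors p. cuspval (comp2 p 1 f (fst v) (snd v)) * cuspval (comp2 p 1 g (fst v) (snd v))) = 0"
proof -
  have p0: "p > 0" using prime_gt_0_nat[OF p] .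
  let ?F = "\<lambda>v. comp2 p 1 f (fst v) (snd v)" and ?G = "\<lambda>v. comp2 p 1 g (fst v) (snd v)"
  have adm: "admissible p (fst v) (snd v)" if "v \<in> row_vectors p" for v using that by (cases v) (simp add: row_vectors_iff)
  define W where "W = (\<lambda>\<tau>. \<Sum>v\<in>row_vectors p. ?F v \<tau> * ?G v \<tau>)"
  have hol: "W holomorphic_on upper_half_plane"
    unfolding W_def by (intro holomorphic_intros comp2_holomorphic p f g adm)
  have mod: "W (moeb \<gamma> \<tau>) = (jfac \<gamma> \<tau>)\<^sup>2 * W \<tau>" if m: "\<gamma> \<in> SL2Z" "Im \<tau> > 0" for \<gamma> \<tau>
  proof -
    have "W (moeb \<gamma> \<tau>) = (\<Sum>v\<in>row_vectors p. (jfac \<gamma> \<tau>)\<^sup>2 * (?F (row_act p \<gamma> v) \<tau> * ?G (row_act p \<gamma> v) \<tau>))"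
      unfolding W_def
    proof (rule sum.cong[OF refl])
      fix v assume v: "v \<in> row_vectors p"
      show "?F v (moeb \<gamma> \<tau>) * ?G v (moeb \<gamma> \<tau>) = (jfac \<gamma> \<tau>)\<^sup>2 * (?F (row_act p \<gamma> v) \<tau> * ?G (row_act p \<gamma> v) \<tau>)"
        unfolding comp2_row_act[OF p f v m] comp2_row_act[OF p g v m] by (simp only: power2_eq_square mult_ac)
    qed
    also have "\<dots> = (jfac \<gamma> \<tau>)\<^sup>2 * (\<Sum>v\<in>row_vectors p. ?F (row_act p \<gamma> v) \<tau> * ?G (row_act p \<gamma> v) \<tau>)"
      by (simp only: sum_distrib_left)
    also have "(\<Sum>v\<in>row_vectors p. ?F (row_act p \<gamma> v) \<tau> * ?G (row_act p \<gamma> v) \<tau>) = W \<tau>"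
      unfolding W_def by (rule sum.reindex_bij_betw[OF bij_row_act[OF p0 m(1)]])
    finally show ?thesis .
  qed
  have "\<exists>B Y. \<forall>\<tau>. Im \<tau> > Y \<longrightarrow> norm (?F v \<tau> * ?G v \<tau>) \<le> B" if v: "v \<in> row_vectors p" for v
  proof -
    obtain B1 Y1 B2 Y2 where "\<And>\<tau>. Im \<tau> > Y1 \<Longrightarrow> norm (?F v \<tau>) \<le> B1" "\<And>\<tau>. Im \<tau> > Y2 \<Longrightarrow> norm (?G v \<tau>) \<le> B2"
      using comp2_bounded[OF p f adm[OF v]] comp2_bounded[OF p g adm[OF v]] unfolding bounded_at_i_infinity_def by blast
    hence "norm (?F v \<tau> * ?G v \<tau>) \<le> B1 * B2" if "Im \<tau> > max Y1 Y2" for \<tau>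
      unfolding norm_mult using that
      by (intro mult_mono) (auto intro: order_trans[OF norm_ge_zero])
    thus ?thesis by blast
  qed
  then obtain B Y where BY: "\<And>v \<tau>. v \<in> row_vectors p \<Longrightarrow> Im \<tau> > Y v \<Longrightarrow> norm (?F v \<tau> * ?G v \<tau>) \<le> B v"
    by metis
  have bd: "bounded_at_i_infinity W" unfolding bounded_at_i_infinity_def
  proof (intro exI allI impI)
    fix \<tau> :: complex assume "Im \<tau> > Max (Y ` row_vectors p)"
    hence "Im \<tau> > Y v" if "v \<in> row_vectors p" for v
      using that by (meson Max_ge finite_imageI finite_row_vectors imageI le_less_trans)
    thus "norm (W \<tau>) \<le> sum B (row_vectors p)" unfolding W_def by (intro sum_norm_le BY)
  qed
  have T: "mat22 1 1 0 1 \<in> SL2Z" by (simp add: SL2Z_iff)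
  have per: "W (\<tau> + of_real 1) = W \<tau>" if "Im \<tau> > 0" for \<tau>
    using mod[OF T that] by (simp add: moeb_def jfac_def)
  obtain h where h: "h holomorphic_on ball 0 1" and Wh: "\<And>\<tau>. Im \<tau> > 0 \<Longrightarrow> W \<tau> = h (qvar (\<tau> / of_real 1))"
    using q_descent[OF zero_less_one hol per bd] by blast
  have h0: "h 0 = 0" by (rule weight2_level_one_constant_term[OF hol mod h]) (use Wh in simp_all)
  have "((\<lambda>y::real. W (\<i> * of_real y)) \<longlongrightarrow> h 0) at_top"
    by (rule tendsto_descent[OF h, of 1]) (use Wh in simp_all)
  moreover have "((\<lambda>y::real. W (\<i> * of_real y)) \<longlongrightarrow> (\<Sum>v\<in>row_vectors p. cuspval (?F v) * cuspval (?G v))) at_top"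
    unfolding W_def by (intro tendsto_sum tendsto_mult tendsto_cuspval_comp2 p f g adm)
  ultimately have "h 0 = (\<Sum>v\<in>row_vectors p. cuspval (?F v) * cuspval (?G v))"
    by (rule tendsto_unique[OF trivial_limit_at_top_linorder])
  thus ?thesis using h0 by simp
qed

section \<open>The quasi-periodic function of a lattice\<close>

text \<open>Minus the logarithmic derivative \<open>w d/dw\<close> of the product of
  \<open>1 - w q^m\<close> over \<open>m >= 1\<close>, one of the infinite products of the Jacobi
  theta function.\<close>

definition lam :: "complex \<Rightarrow> complex \<Rightarrow> complex" where
  "lam w q = (\<Sum>m. w * q ^ Suc m / (1 - w * q ^ Suc m))"

lemma norm_geom_frac_le:
  fixes x :: complex
  assumes "norm x \<le> c" "c < 1"
  shows "norm (x / (1 - x)) \<le> norm x / (1 - c)"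
proof -
  have "1 - c \<le> norm (1 - x)" using norm_triangle_ineq2[of 1 x] assms by simp
  thus ?thesis unfolding norm_divide using assms by (intro divide_left_mono mult_pos_pos) auto
qed

text \<open>Once \<open>W * \<rho> ^ Suc m < 1/2\<close> the denominators have modulus at least 1/2,
  whence the factor 2. Early terms are exempt because their denominators may be small.\<close>

lemma lam_term_uniform:
  assumes W: "W \<ge> 0" and \<rho>: "0 \<le> \<rho>" "\<rho> < 1"
  shows "eventually (\<lambda>m. \<forall>w q :: complex. norm w \<le> W \<longrightarrow> norm q \<le> \<rho> \<longrightarrow>
    norm (w * q ^ Suc m / (1 - w * q ^ Suc m)) \<le> 2 * W * \<rho> ^ Suc m) sequentially"
proof -
  have "(\<lambda>m. W * \<rho> ^ Suc m) \<longlonglongrightarrow> W * 0"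
    by (intro tendsto_intros LIMSEQ_Suc LIMSEQ_power_zero) (use \<rho> in auto)
  hence "eventually (\<lambda>m. W * \<rho> ^ Suc m < 1/2) sequentially" by (intro order_tendstoD) auto
  thus ?thesis
  proof eventually_elim
    case (elim m)
    show ?case
    proof (intro allI impI)
      fix w q :: complex assume wq: "norm w \<le> W" "norm q \<le> \<rho>"
      have le: "norm (w * q ^ Suc m) \<le> W * \<rho> ^ Suc m"
        unfolding norm_mult norm_power using wq W by (intro mult_mono power_mono) auto
      hence "norm (w * q ^ Suc m / (1 - w * q ^ Suc m)) \<le> norm (w * q ^ Suc m) / (1 - 1/2)"
        using elim by (intro norm_geom_frac_le) auto
      also have "\<dots> = 2 * norm (w * q ^ Suc m)" by simp
      also have "\<dots> \<le> 2 * (W * \<rho> ^ Suc m)" using le by (intro mult_left_mono) auto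
      finally show "norm (w * q ^ Suc m / (1 - w * q ^ Suc m)) \<le> 2 * W * \<rho> ^ Suc m" by (simp only: mult.assoc)
    qed
  qed
qed

lemma summable_const_power_Suc: "0 \<le> \<rho> \<Longrightarrow> \<rho> < 1 \<Longrightarrow> summable (\<lambda>m. c * \<rho> ^ Suc m :: real)"
  by (intro summable_mult) (simp add: summable_Suc_iff)

lemma lam_summable:
  assumes "norm q < 1"
  shows "summable (\<lambda>m. w * q ^ Suc m / (1 - w * q ^ Suc m) :: complex)"
  by (rule summable_comparison_test_ev[OF _ summable_const_power_Suc[of "norm q" "2 * norm w"]])
     (use lam_term_uniform[of "norm w" "norm q"] assms in \<open>auto elim!: eventually_mono\<close>)

lemma lam_holomorphic:
  assumes S: "open S" and w: "w holomorphic_on S" and q: "q holomorphic_on S"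
    and q1: "\<And>x. x \<in> S \<Longrightarrow> norm (q x) < 1"
    and nz: "\<And>x m. x \<in> S \<Longrightarrow> w x * q x ^ Suc m \<noteq> 1"
  shows "(\<lambda>x. lam (w x) (q x)) holomorphic_on S"
proof (rule holomorphic_uniform_sequence[OF S])
  let ?t = "\<lambda>m x. w x * q x ^ Suc m / (1 - w x * q x ^ Suc m)"
  show "(\<lambda>x. \<Sum>m<n. ?t m x) holomorphic_on S" for n
    using nz by (intro holomorphic_intros w q) (metis eq_iff_diff_eq_0)
  fix x assume "x \<in> S"
  then obtain d where d: "d > 0" "cball x d \<subseteq> S" using S open_contains_cball by blast
  have cw: "continuous_on (cball x d) w" and cq: "continuous_on (cball x d) q"
    using w q d by (auto intro!: holomorphic_on_imp_continuous_on elim: holomorphic_on_subset)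
  have "bounded (w ` cball x d)" by (intro compact_imp_bounded compact_continuous_image cw) auto
  then obtain W where W: "\<And>y. y \<in> cball x d \<Longrightarrow> norm (w y) \<le> W" unfolding bounded_iff by blast
  obtain y0 where y0: "y0 \<in> cball x d" "\<And>y. y \<in> cball x d \<Longrightarrow> norm (q y) \<le> norm (q y0)"
    using continuous_attains_sup[of "cball x d" "\<lambda>y. norm (q y)"] cq d(1)
    by (force intro: continuous_on_norm)
  have W0: "W \<ge> 0" using W[OF y0(1)] norm_ge_zero order_trans by blast
  have r: "norm (q y0) < 1" using y0 d q1 by blast
  have "uniform_limit (cball x d) (\<lambda>n y. \<Sum>m<n. ?t m y) (\<lambda>y. \<Sum>m. ?t m y) sequentially"
  proof (rule Weierstrass_m_test_ev)
    show "\<forall>\<^sub>F m in sequentially. \<forall>y\<in>cball x d. norm (?t m y) \<le> 2 * W * norm (q y0) ^ Suc m"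
      using lam_term_uniform[OF W0 norm_ge_zero r]
      by eventually_elim (use W y0(2) in blast)
  qed (rule summable_const_power_Suc[OF norm_ge_zero r])
  thus "\<exists>d>0. cball x d \<subseteq> S \<and> uniform_limit (cball x d) (\<lambda>n y. \<Sum>m<n. ?t m y) (\<lambda>x. lam (w x) (q x)) sequentially"
    unfolding lam_def using d by blast
qed

text \<open>Peeling off the first term is the source of the jump of \<open>kap\<close> under
  \<open>z + \<tau>\<close>.\<close>

lemma lam_shift:
  assumes "norm q < 1"
  shows "lam w q = w * q / (1 - w * q) + lam (w * q) q"
proof -
  have "lam w q = w * q ^ Suc 0 / (1 - w * q ^ Suc 0) + (\<Sum>m. w * q ^ Suc (Suc m) / (1 - w * q ^ Suc (Suc m)))"
    unfolding lam_def using suminf_split_head[OF lam_summable[OF assms, of w]] by simp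
  thus ?thesis by (simp add: lam_def mult.assoc)
qed

lemma norm_lam_le:
  assumes "norm q \<le> 1/2" "norm (w * q) \<le> c" "c < 1"
  shows "norm (lam w q) \<le> 2 * c / (1 - c)"
proof -
  have c0: "c \<ge> 0" using assms(2) norm_ge_zero order_trans by blast
  have t: "norm (w * q ^ Suc m / (1 - w * q ^ Suc m)) \<le> c / (1 - c) * (1/2) ^ m" for m
  proof -
    have "norm (w * q ^ Suc m) = norm (w * q) * norm q ^ m" by (simp add: norm_mult norm_power)
    also have "\<dots> \<le> c * (1/2) ^ m" using assms c0 by (intro mult_mono power_mono) auto
    finally have 1: "norm (w * q ^ Suc m) \<le> c * (1/2) ^ m" .
    also have "\<dots> \<le> c" using c0 by (simp add: mult_left_le power_le_one)
    finally have "norm (w * q ^ Suc m / (1 - w * q ^ Suc m)) \<le> norm (w * q ^ Suc m) / (1 - c)"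
      using assms(3) by (intro norm_geom_frac_le) auto
    also have "\<dots> \<le> c * (1/2) ^ m / (1 - c)" using 1 assms(3) by (intro divide_right_mono) auto
    finally show ?thesis by simp
  qed
  have s: "summable (\<lambda>m. c / (1 - c) * (1/2) ^ m)" by (intro summable_mult summable_geometric) auto
  have "norm (lam w q) \<le> (\<Sum>m. c / (1 - c) * (1/2) ^ m)"
    unfolding lam_def by (rule norm_suminf_le[OF t s])
  also have "\<dots> = 2 * c / (1 - c)" by (subst suminf_mult) (auto simp: suminf_geometric)
  finally show ?thesis .
qed

text \<open>Up to the factor \<open>2 \<pi> \<i>\<close> this is the Weierstrass zeta function of \<open>\<int> \<tau> + \<int>\<close> minus the multiple of
  \<open>z\<close> that makes it \<open>1\<close>-periodic.\<close>

definition kap :: "complex \<Rightarrow> complex \<Rightarrow> complex" where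
  "kap z \<tau> = (qvar z + 1) / (2 * (qvar z - 1)) - lam (qvar z) (qvar \<tau>) + lam (1 / qvar z) (qvar \<tau>)"

section \<open>The period lattice and the translation behaviour of \<open>kap\<close>\<close>

definition Lat :: "complex \<Rightarrow> complex set" where
  "Lat \<tau> = {of_int m * \<tau> + of_int n | m n. True}"

lemma Lat_iff: "z \<in> Lat \<tau> \<longleftrightarrow> (\<exists>m n. z = of_int m * \<tau> + of_int n)"
  by (auto simp: Lat_def)

lemma Lat_memI: "of_int m * \<tau> + of_int n \<in> Lat \<tau>"
  unfolding Lat_iff by blast

lemma Lat_add:
  assumes "a \<in> Lat \<tau>" "b \<in> Lat \<tau>"
  shows "a + b \<in> Lat \<tau>"
proof -
  obtain m n m' n' where "a = of_int m * \<tau> + of_int n" "b = of_int m' * \<tau> + of_int n'"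
    using assms unfolding Lat_iff by blast
  hence "a + b = of_int (m + m') * \<tau> + of_int (n + n')" by (simp add: algebra_simps)
  thus ?thesis by (simp only: Lat_memI)
qed

lemma Lat_uminus:
  assumes "a \<in> Lat \<tau>"
  shows "- a \<in> Lat \<tau>"
proof -
  obtain m n where "a = of_int m * \<tau> + of_int n" using assms unfolding Lat_iff by blast
  hence "- a = of_int (- m) * \<tau> + of_int (- n)" by (simp add: algebra_simps)
  thus ?thesis by (simp only: Lat_memI)
qed

lemma Lat_multiples: "of_int m * \<tau> \<in> Lat \<tau>" "of_int n \<in> Lat \<tau>" "of_nat k * \<tau> \<in> Lat \<tau>" "of_nat k \<in> Lat \<tau>"
  using Lat_memI[of m \<tau> 0] Lat_memI[of 0 \<tau> n] Lat_memI[of "int k" \<tau> 0] Lat_memI[of 0 \<tau> "int k"] by simp_all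

lemma Lat_0 [simp]: "0 \<in> Lat \<tau>"
  using Lat_multiples(4)[of 0] by simp

lemma Lat_uminus_iff [simp]: "- a \<in> Lat \<tau> \<longleftrightarrow> a \<in> Lat \<tau>"
  using Lat_uminus[of a] Lat_uminus[of "- a"] by auto

lemma Lat_add_iff: "b \<in> Lat \<tau> \<Longrightarrow> a + b \<in> Lat \<tau> \<longleftrightarrow> a \<in> Lat \<tau>"
  using Lat_add[of a \<tau> b] Lat_add[of "a + b" \<tau> "- b"] by auto

lemma qvar_mult_power: "qvar z * qvar \<tau> ^ m = qvar (z + of_nat m * \<tau>)"
  by (induction m) (simp_all add: qvar_add algebra_simps)

lemma qvar_eq_1_iff: "qvar z = 1 \<longleftrightarrow> (\<exists>n. z = of_int n)"
  using qvar_eq_iff[of z 0] by (simp add: qvar_def)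

lemma qvar_uminus: "qvar (- z) = 1 / qvar z"
  by (simp add: qvar_def exp_minus inverse_eq_divide)

lemma qvar_lattice_ne_1:
  assumes "z \<notin> Lat \<tau>"
  shows "qvar z * qvar \<tau> ^ m \<noteq> 1" "1 / qvar z * qvar \<tau> ^ m \<noteq> 1" "qvar z \<noteq> 1"
proof -
  have *: "qvar z * qvar \<tau> ^ m \<noteq> 1" if "z \<notin> Lat \<tau>" for z m
  proof
    assume "qvar z * qvar \<tau> ^ m = 1"
    then obtain n where "z + of_nat m * \<tau> = of_int n" by (auto simp: qvar_mult_power qvar_eq_1_iff)
    hence "z = of_int (- int m) * \<tau> + of_int n" by (simp add: algebra_simps)
    thus False using that unfolding Lat_iff by blast
  qed
  show "qvar z * qvar \<tau> ^ m \<noteq> 1" "1 / qvar z * qvar \<tau> ^ m \<noteq> 1"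
    using *[OF assms] *[of "- z"] assms by (simp_all only: Lat_uminus_iff qvar_uminus not_False_eq_True)
  show "qvar z \<noteq> 1" using *[OF assms, of 0] by simp
qed

lemma kap_holomorphic:
  assumes "open S" "f holomorphic_on S" "g holomorphic_on S"
    and "\<And>x. x \<in> S \<Longrightarrow> Im (g x) > 0" and "\<And>x. x \<in> S \<Longrightarrow> f x \<notin> Lat (g x)"
  shows "(\<lambda>x. kap (f x) (g x)) holomorphic_on S"
proof -
  have 1: "(\<lambda>x. lam (qvar (f x)) (qvar (g x))) holomorphic_on S"
    by (rule lam_holomorphic) (use assms qvar_lattice_ne_1 norm_qvar_less_1 in \<open>auto intro!: holomorphic_intros simp del: power_Suc\<close>)
  have 2: "(\<lambda>x. lam (1 / qvar (f x)) (qvar (g x))) holomorphic_on S"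
  proof (rule lam_holomorphic)
    show "1 / qvar (f x) * qvar (g x) ^ Suc m \<noteq> 1" if "x \<in> S" for x m
      by (rule qvar_lattice_ne_1(2)[OF assms(5)[OF that]])
  qed (use assms norm_qvar_less_1 in \<open>auto intro!: holomorphic_intros\<close>)
  show ?thesis unfolding kap_def
    by (intro holomorphic_intros 1 2) (use assms qvar_lattice_ne_1(3) in auto)
qed

text \<open>Lattice points are included: the two \<open>lam\<close> terms are simply exchanged, and
  at \<open>qvar z = 1\<close> the rational term is 0 as a division by zero. In this form it meets
  the oddness hypothesis of \<open>elliptic_odd_zero\<close>, which is required at every
  \<open>z\<close>.\<close>

lemma kap_odd: "kap (- z) \<tau> = - kap z \<tau>"
proof -
  have "(1 / u + 1) / (2 * (1 / u - 1)) = - ((u + 1) / (2 * (u - 1)))" if "u \<noteq> 0" for u :: complex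
    using that by (cases "u = 1") (auto simp: field_simps)
  thus ?thesis by (simp add: kap_def qvar_uminus)
qed

lemma kap_add_1: "kap (z + 1) \<tau> = kap z \<tau>"
  using qvar_of_int[of 1] by (simp add: kap_def qvar_add)

lemma kap_add_tau:
  assumes t: "Im \<tau> > 0" and z: "z \<notin> Lat \<tau>"
  shows "kap (z + \<tau>) \<tau> = kap z \<tau> - 1"
proof -
  define u q where "u = qvar z" and "q = qvar \<tau>"
  have q: "norm q < 1" "q \<noteq> 0" and u: "u \<noteq> 0" "u \<noteq> 1" "u * q \<noteq> 1"
    using norm_qvar_less_1[OF t] qvar_lattice_ne_1(3)[OF z] qvar_lattice_ne_1(1)[OF z, of 1] by (auto simp: u_def q_def)
  have 1: "lam u q = u * q / (1 - u * q) + lam (u * q) q" by (rule lam_shift[OF q(1)])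
  have "lam (1 / (u * q)) q = 1 / (u * q) * q / (1 - 1 / (u * q) * q) + lam (1 / (u * q) * q) q"
    by (rule lam_shift[OF q(1)])
  also have "1 / (u * q) * q = 1 / u" using q by simp
  finally have 2: "lam (1 / (u * q)) q = (1 / u) / (1 - 1 / u) + lam (1 / u) q" .
  \<comment> \<open>The jump comes in two halves: the rational term at \<open>u q\<close> together
    with the first piece leaves \<open>- 1/2\<close>, and the second piece is the rational term at
    \<open>u\<close> minus \<open>1/2\<close>.\<close>
  have alg: "(u * q + 1) / (2 * (u * q - 1)) + u * q / (1 - u * q) + (1 / u) / (1 - 1 / u) = (u + 1) / (2 * (u - 1)) - 1"
  proof -
    have "(x + 1) / (2 * (x - 1)) + x / (1 - x) = - 1 / 2" if "x \<noteq> 1" for x :: complex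
    proof -
      have "x - 1 \<noteq> 0" "1 - x \<noteq> 0" using that by auto
      thus ?thesis by (simp add: divide_simps) (simp add: algebra_simps)
    qed
    moreover have "(1 / u) / (1 - 1 / u) = (u + 1) / (2 * (u - 1)) - 1 / 2"
    proof -
      have "u - 1 \<noteq> 0" "1 - 1 / u \<noteq> 0" using u by auto
      thus ?thesis using u by (simp add: divide_simps)
    qed
    ultimately show ?thesis using u by simp
  qed
  have "kap (z + \<tau>) \<tau> = (u * q + 1) / (2 * (u * q - 1)) - lam (u * q) q + lam (1 / (u * q)) q"
    by (simp add: kap_def qvar_add u_def q_def)
  also have "\<dots> = ((u * q + 1) / (2 * (u * q - 1)) + u * q / (1 - u * q) + (1 / u) / (1 - 1 / u)) - lam u q + lam (1 / u) q"
    unfolding 1 2 by (simp only: algebra_simps)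
  also have "\<dots> = kap z \<tau> - 1" unfolding alg by (simp add: kap_def u_def q_def)
  finally show ?thesis .
qed

lemma kap_add_int: "kap (z + of_int n) \<tau> = kap z \<tau>"
  by (simp add: kap_def qvar_add)

lemma kap_add_lattice:
  assumes t: "Im \<tau> > 0" and z: "z \<notin> Lat \<tau>"
  shows "kap (z + of_int m * \<tau> + of_int n) \<tau> = kap z \<tau> - of_int m"
proof -
  have nat: "kap (z + of_nat m * \<tau>) \<tau> = kap z \<tau> - of_nat m" if "z \<notin> Lat \<tau>" for z m
  proof (induction m)
    case (Suc m)
    have "z + of_nat m * \<tau> \<notin> Lat \<tau>" using that by (simp add: Lat_add_iff Lat_multiples)
    from kap_add_tau[OF t this] Suc show ?case by (simp add: distrib_right add.assoc[symmetric] add.commute[of \<tau>])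
  qed simp
  have "kap (z + of_int m * \<tau>) \<tau> = kap z \<tau> - of_int m"
  proof (cases "m \<ge> 0")
    case True
    thus ?thesis using nat[OF z, of "nat m"] by simp
  next
    case False
    define k where "k = nat (- m)"
    have m: "of_int m = - (of_nat k :: complex)" using False by (simp add: k_def)
    have "z + of_int m * \<tau> \<notin> Lat \<tau>" using z by (simp add: Lat_add_iff Lat_multiples)
    from nat[OF this, of k] show ?thesis by (simp add: m)
  qed
  thus ?thesis by (simp add: kap_add_int)
qed

text \<open>In the strip \<open>|Im z| < Im \<tau>\<close> both \<open>lam\<close> terms are
  holomorphic, so only the rational term has a pole at 0, where \<open>qvar z - 1\<close> behaves
  like \<open>2 pi i z\<close>.\<close>

lemma kap_residue:
  assumes t: "Im \<tau> > 0"
  shows "((\<lambda>z. z * kap z \<tau>) \<longlongrightarrow> 1 / (2 * of_real pi * \<i>)) (at 0)"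
proof -
  let ?c = "2 * of_real pi * \<i> :: complex"
  define S where "S = ball (0::complex) (Im \<tau>)"
  have S: "open S" "0 \<in> S" using t by (auto simp: S_def)
  have less: "norm (qvar x * qvar \<tau> ^ Suc m) < 1" if "\<bar>Im x\<bar> < Im \<tau>" for x m
  proof -
    have "Im x + (1 + real m) * Im \<tau> > 0" using that t mult_nonneg_nonneg[of "real m" "Im \<tau>"]
      unfolding distrib_right mult_1_left by linarith
    thus ?thesis unfolding qvar_mult_power by (intro norm_qvar_less_1) simp
  qed
  have ImS: "\<bar>Im x\<bar> < Im \<tau>" if "x \<in> S" for x
    using that abs_Im_le_cmod[of x] by (simp add: S_def)
  have ne: "qvar x * qvar \<tau> ^ Suc m \<noteq> 1" "1 / qvar x * qvar \<tau> ^ Suc m \<noteq> 1" if "x \<in> S" for x m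
    using less[OF ImS[OF that], of m] less[of "- x" m] ImS[OF that] by (auto simp: qvar_uminus simp del: power_Suc)
  have "(\<lambda>x. lam (qvar x) (qvar \<tau>)) holomorphic_on S"
    by (rule lam_holomorphic[OF S(1)]) (use ne norm_qvar_less_1[OF t] in \<open>auto intro!: holomorphic_intros simp del: power_Suc\<close>)
  moreover have "(\<lambda>x. lam (1 / qvar x) (qvar \<tau>)) holomorphic_on S"
    by (rule lam_holomorphic[OF S(1)]) (use ne norm_qvar_less_1[OF t] in \<open>auto intro!: holomorphic_intros simp del: power_Suc\<close>)
  ultimately have "(\<lambda>x. lam (1 / qvar x) (qvar \<tau>) - lam (qvar x) (qvar \<tau>)) holomorphic_on S"
    by (intro holomorphic_intros)
  hence "isCont (\<lambda>x. lam (1 / qvar x) (qvar \<tau>) - lam (qvar x) (qvar \<tau>)) 0"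
    using S by (meson continuous_on_eq_continuous_at holomorphic_on_imp_continuous_on)
  hence "((\<lambda>x. x * (lam (1 / qvar x) (qvar \<tau>) - lam (qvar x) (qvar \<tau>))) \<longlongrightarrow> 0 * (lam (1 / qvar 0) (qvar \<tau>) - lam (qvar 0) (qvar \<tau>))) (at 0)"
    by (intro tendsto_mult tendsto_ident_at) (simp add: isCont_def)
  moreover have "((\<lambda>z. z * ((qvar z + 1) / (2 * (qvar z - 1)))) \<longlongrightarrow> 1 / ?c) (at 0)"
  proof -
    have "(qvar has_field_derivative ?c) (at 0)"
      unfolding qvar_def[abs_def] by (auto intro!: derivative_eq_intros)
    hence d: "((\<lambda>z. (qvar z - 1) / z) \<longlongrightarrow> ?c) (at 0)"
      unfolding has_field_derivative_iff by (simp add: qvar_def)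
    have "isCont qvar 0" unfolding qvar_def[abs_def] by (intro continuous_intros)
    hence q: "(qvar \<longlongrightarrow> 1) (at 0)" by (simp add: isCont_def qvar_def)
    have "((\<lambda>z. ((qvar z + 1) / 2) / ((qvar z - 1) / z)) \<longlongrightarrow> ((1 + 1) / 2) / ?c) (at 0)"
      by (intro tendsto_intros q d) auto
    moreover have "((1 + 1) / 2) / ?c = 1 / ?c" by simp
    ultimately have "((\<lambda>z. ((qvar z + 1) / 2) / ((qvar z - 1) / z)) \<longlongrightarrow> 1 / ?c) (at 0)" by metis
    thus ?thesis by (rule Lim_transform_eventually) (auto simp: eventually_at intro!: exI[of _ 1])
  qed
  ultimately have "((\<lambda>z. z * ((qvar z + 1) / (2 * (qvar z - 1))) + z * (lam (1 / qvar z) (qvar \<tau>) - lam (qvar z) (qvar \<tau>))) \<longlongrightarrow> 1 / ?c + 0) (at 0)"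
    by (intro tendsto_add) simp_all
  thus ?thesis by (simp add: kap_def algebra_simps)
qed

lemma Lat_near_0:
  assumes t: "Im \<tau> > 0" and z: "z \<in> Lat \<tau>" and n: "norm z < min 1 (Im \<tau>)"
  shows "z = 0"
proof -
  obtain m n where mn: "z = of_int m * \<tau> + of_int n" using z by (auto simp: Lat_iff)
  have "\<bar>Im z\<bar> < Im \<tau>" using n abs_Im_le_cmod[of z] by simp
  hence "\<bar>real_of_int m\<bar> * Im \<tau> < 1 * Im \<tau>" using t by (simp add: mn abs_mult)
  hence "m = 0" using t by (simp only: mult_less_cancel_right) auto
  hence "z = of_int n" by (simp add: mn)
  moreover have "\<bar>real_of_int n\<bar> < 1" using n by (simp add: \<open>z = of_int n\<close>)
  hence "n = 0" by linarith
  ultimately show ?thesis by simp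
qed

lemma closed_Lat: "Im \<tau> > 0 \<Longrightarrow> closed (Lat \<tau>)"
proof (rule discrete_imp_closed[of "min 1 (Im \<tau>)"])
  assume t: "Im \<tau> > 0"
  thus "0 < min 1 (Im \<tau>)" by simp
  show "\<forall>x\<in>Lat \<tau>. \<forall>y\<in>Lat \<tau>. dist y x < min 1 (Im \<tau>) \<longrightarrow> y = x"
  proof (intro ballI impI)
    fix x y assume xy: "x \<in> Lat \<tau>" "y \<in> Lat \<tau>" "dist y x < min 1 (Im \<tau>)"
    have "y + - x = 0" by (rule Lat_near_0[OF t Lat_add[OF xy(2) Lat_uminus[OF xy(1)]]])
      (use xy(3) in \<open>simp add: dist_norm\<close>)
    thus "y = x" by simp
  qed
qed

text \<open>The limit condition removes the singularity at 0, and the periods carry this to every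
  lattice point. The resulting entire doubly periodic function is constant by Liouville, and oddness
  makes the constant 0.\<close>

lemma elliptic_odd_zero:
  assumes t: "Im \<tau> > 0" and hol: "D holomorphic_on - Lat \<tau>"
    and per: "\<And>z. z \<notin> Lat \<tau> \<Longrightarrow> D (z + 1) = D z" "\<And>z. z \<notin> Lat \<tau> \<Longrightarrow> D (z + \<tau>) = D z"
    and lim: "((\<lambda>z. z * D z) \<longlongrightarrow> 0) (at 0)"
    and odd: "\<And>z. D (- z) = - D z" and z: "z \<notin> Lat \<tau>"
  shows "D z = 0"
proof -
  define \<delta> where "\<delta> = min 1 (Im \<tau>)"
  have \<delta>: "\<delta> > 0" using t by (simp add: \<delta>_def)
  have near: "z \<notin> Lat \<tau>" if "z \<in> ball 0 \<delta> - {0}" for z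
    using Lat_near_0[OF t] that by (auto simp: \<delta>_def)
  have h1: "D holomorphic_on (ball 0 \<delta> - {0})" by (rule holomorphic_on_subset[OF hol]) (use near in blast)
  have "\<exists>g. g holomorphic_on ball 0 \<delta> \<and> (\<forall>z\<in>ball 0 \<delta> - {0}. g z = D z)"
    by (subst holomorphic_on_extend_lim[OF h1]) (use \<delta> lim in \<open>auto simp: interior_open\<close>)
  then obtain g where g: "g holomorphic_on ball 0 \<delta>" "\<And>z. z \<in> ball 0 \<delta> - {0} \<Longrightarrow> g z = D z" by blast
  have perN: "D (z + of_nat n * l) = D z"
    if "l = 1 \<or> l = \<tau>" "z \<notin> Lat \<tau>" for z n l
  proof (induction n)
    case (Suc n)
    have "of_nat n * l \<in> Lat \<tau>" using that(1) Lat_multiples by auto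
    hence "z + of_nat n * l \<notin> Lat \<tau>" using that by (simp add: Lat_add_iff)
    hence "D (z + of_nat n * l + l) = D (z + of_nat n * l)" using per that(1) by blast
    moreover have "z + of_nat (Suc n) * l = z + of_nat n * l + l" by (simp add: distrib_right)
    ultimately show ?case using Suc by metis
  qed simp
  have perZ: "D (z + of_int n * l) = D z"
    if "l = 1 \<or> l = \<tau>" "z \<notin> Lat \<tau>" for z n l
  proof (cases "n \<ge> 0")
    case True
    thus ?thesis using perN[OF that, of "nat n"] by simp
  next
    case False
    have "of_int n * l \<in> Lat \<tau>" using that(1) Lat_multiples by auto
    hence "z + of_int n * l \<notin> Lat \<tau>" using that by (simp add: Lat_add_iff)
    from perN[OF that(1) this, of "nat (- n)"] show ?thesis using False by simp
  qed
  have perL: "D (z + l) = D z" if l: "l \<in> Lat \<tau>" and z: "z \<notin> Lat \<tau>" for z l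
  proof -
    obtain m n where l: "l = of_int m * \<tau> + of_int n" using l by (auto simp: Lat_iff)
    have "z + of_int m * \<tau> \<notin> Lat \<tau>" using z by (simp add: Lat_add_iff Lat_multiples)
    from perZ[of 1, OF _ this, of n] perZ[of \<tau>, OF _ z, of m] show ?thesis by (simp add: l algebra_simps)
  qed
  define E where "E = (\<lambda>z. if z \<in> Lat \<tau> then g 0 else D z)"
  have perE: "E (z + l) = E z" if "l \<in> Lat \<tau>" for z l
    using that perL[OF that] by (simp add: E_def Lat_add_iff)
  have "E holomorphic_on UNIV"
  proof (rule holomorphic_on_local)
    fix w :: complex
    show "\<exists>U. open U \<and> w \<in> U \<and> E holomorphic_on U"
    proof (cases "w \<in> Lat \<tau>")
      case False
      have "E holomorphic_on - Lat \<tau>" by (rule holomorphic_transform[OF hol]) (simp add: E_def)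
      thus ?thesis using False closed_Lat[OF t] by (intro exI[of _ "- Lat \<tau>"]) (auto simp: open_Compl)
    next
      case True
      have "(g \<circ> (\<lambda>x. x - w)) holomorphic_on ball w \<delta>"
        by (rule holomorphic_on_compose_gen[OF _ g(1)]) (auto intro!: holomorphic_intros simp: dist_norm norm_minus_commute)
      hence "E holomorphic_on ball w \<delta>"
      proof (rule holomorphic_transform)
        fix x assume x: "x \<in> ball w \<delta>"
        have "E x = E (x - w)" using perE[OF True, of "x - w"] by simp
        also have "\<dots> = g (x - w)"
        proof (cases "x = w")
          case False
          hence "x - w \<in> ball 0 \<delta> - {0}" using x by (simp add: dist_norm norm_minus_commute)
          thus ?thesis using near g(2) by (simp add: E_def)
        qed (simp add: E_def)
        finally show "(g \<circ> (\<lambda>x. x - w)) x = E x" by simp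
      qed
      thus ?thesis using \<delta> by (intro exI[of _ "ball w \<delta>"]) auto
    qed
  qed
  moreover have "bounded (range E)"
  proof -
    have "compact (E ` cball 0 (1 + Im \<tau>))"
      by (intro compact_continuous_image holomorphic_on_imp_continuous_on holomorphic_on_subset[OF calculation]) auto
    \<comment> \<open>Every \<open>w\<close> is moved into the box \<open>|Re| <= 1\<close>,
      \<open>|Im| <= Im \<tau>\<close> by subtracting first a multiple of \<open>\<tau>\<close>,
      read off from the imaginary part, and then an integer.\<close>
    moreover have "range E \<subseteq> E ` cball 0 (1 + Im \<tau>)"
    proof safe
      fix w :: complex
      define m where "m = \<lfloor>Im w / Im \<tau>\<rfloor>"
      define w1 where "w1 = w - of_int m * \<tau>"
      define n where "n = \<lfloor>Re w1\<rfloor>"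
      define w2 where "w2 = w1 - of_int n"
      have "Im w2 = Im w - of_int m * Im \<tau>" by (simp add: w2_def w1_def)
      moreover have "of_int m * Im \<tau> \<le> Im w" "Im w \<le> (of_int m + 1) * Im \<tau>"
        unfolding pos_le_divide_eq[OF t, symmetric] pos_divide_le_eq[OF t, symmetric] m_def by linarith+
      ultimately have "\<bar>Im w2\<bar> \<le> Im \<tau>" by (simp add: algebra_simps)
      moreover have "\<bar>Re w2\<bar> \<le> 1" unfolding w2_def n_def by simp linarith
      ultimately have "w2 \<in> cball 0 (1 + Im \<tau>)" using cmod_le[of w2] by simp
      moreover have "w = w2 + (of_int m * \<tau> + of_int n)" by (simp add: w2_def w1_def)
      moreover have "of_int m * \<tau> + of_int n \<in> Lat \<tau>" by (auto simp: Lat_iff)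
      ultimately show "E w \<in> E ` cball 0 (1 + Im \<tau>)" using perE by (metis imageI)
    qed
    ultimately show ?thesis using bounded_subset compact_imp_bounded by blast
  qed
  ultimately have "E constant_on UNIV" by (rule Liouville_theorem)
  hence "E z = E (- z)" unfolding constant_on_def by (metis UNIV_I)
  hence "D z = - D z" using z odd by (simp add: E_def)
  thus ?thesis by simp
qed

lemma Lat_moeb:
  assumes "\<gamma> \<in> SL2Z" "Im \<tau> > 0"
  shows "z / jfac \<gamma> \<tau> \<in> Lat (moeb \<gamma> \<tau>) \<longleftrightarrow> z \<in> Lat \<tau>"
proof -
  let ?j = "jfac \<gamma> \<tau>"
  let ?a = "of_int (\<gamma>$1$1) :: complex" and ?b = "of_int (\<gamma>$1$2) :: complex"
    and ?c = "of_int (\<gamma>$2$1) :: complex" and ?d = "of_int (\<gamma>$2$2) :: complex"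
  have j: "?j \<noteq> 0" by (rule jfac_nonzero[OF assms])
  have det: "?a * ?d - ?b * ?c = 1" by (rule SL2Z_det_of_int[OF assms(1)])
  have e: "of_int m * moeb \<gamma> \<tau> + of_int n = (of_int (m * \<gamma>$1$1 + n * \<gamma>$2$1) * \<tau> + of_int (m * \<gamma>$1$2 + n * \<gamma>$2$2)) / ?j" for m n
    using j unfolding moeb_def by (simp add: field_simps) (simp add: jfac_def algebra_simps)
  show ?thesis
  proof
    assume "z / ?j \<in> Lat (moeb \<gamma> \<tau>)"
    thus "z \<in> Lat \<tau>" using j by (auto simp: Lat_iff e simp del: of_int_add of_int_mult)
  next
    assume "z \<in> Lat \<tau>"
    then obtain m n where z: "z = of_int m * \<tau> + of_int n" by (auto simp: Lat_iff)
    define m' n' where "m' = m * \<gamma>$2$2 - n * \<gamma>$2$1" and "n' = n * \<gamma>$1$1 - m * \<gamma>$1$2"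
    have det': "\<gamma>$1$1 * \<gamma>$2$2 = 1 + \<gamma>$1$2 * \<gamma>$2$1" using assms(1) by (simp add: SL2Z_iff)
    have "m' * \<gamma>$1$1 + n' * \<gamma>$2$1 = m * (\<gamma>$1$1 * \<gamma>$2$2) - m * (\<gamma>$1$2 * \<gamma>$2$1)"
         "m' * \<gamma>$1$2 + n' * \<gamma>$2$2 = n * (\<gamma>$1$1 * \<gamma>$2$2) - n * (\<gamma>$1$2 * \<gamma>$2$1)"
      by (simp_all only: m'_def n'_def algebra_simps)
    hence "m' * \<gamma>$1$1 + n' * \<gamma>$2$1 = m" "m' * \<gamma>$1$2 + n' * \<gamma>$2$2 = n" by (simp_all add: det' algebra_simps)
    hence "z / ?j = of_int m' * moeb \<gamma> \<tau> + of_int n'" unfolding e z by simp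
    thus "z / ?j \<in> Lat (moeb \<gamma> \<tau>)" unfolding Lat_iff by blast
  qed
qed

theorem kap_moeb:
  assumes g: "\<gamma> \<in> SL2Z" and t: "Im \<tau> > 0" and z: "z \<notin> Lat \<tau>"
  shows "kap (z / jfac \<gamma> \<tau>) (moeb \<gamma> \<tau>) = jfac \<gamma> \<tau> * kap z \<tau> + of_int (\<gamma>$2$1) * z"
proof -
  define j where "j = jfac \<gamma> \<tau>"
  define \<tau>' where "\<tau>' = moeb \<gamma> \<tau>"
  define a b c d where "a = (of_int (\<gamma>$1$1) :: complex)" and "b = (of_int (\<gamma>$1$2) :: complex)"
    and "c = (of_int (\<gamma>$2$1) :: complex)" and "d = (of_int (\<gamma>$2$2) :: complex)"
  have t': "Im \<tau>' > 0" unfolding \<tau>'_def by (rule Im_moeb_pos[OF g t])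
  have j: "j \<noteq> 0" unfolding j_def by (rule jfac_nonzero[OF g t])
  have jd: "j = c * \<tau> + d" by (simp add: j_def jfac_def c_def d_def)
  have det: "a * d - b * c = 1" unfolding a_def b_def c_def d_def by (rule SL2Z_det_of_int[OF g])
  have tj: "\<tau>' * j = a * \<tau> + b" using j by (simp add: \<tau>'_def moeb_def j_def a_def b_def)
  have nL: "z / j \<notin> Lat \<tau>'" if "z \<notin> Lat \<tau>" for z using Lat_moeb[OF g t] that by (simp add: j_def \<tau>'_def)
  \<comment> \<open>Scaling by \<open>j\<close> identifies the lattices of \<open>\<tau>'\<close>
    and \<open>\<tau>\<close>, so the two \<open>kap\<close> terms have equal residues, which
    cancel; the linear term absorbs the difference of their quasi-periods.\<close>
  define D where "D = (\<lambda>z. kap (z / j) \<tau>' / j - kap z \<tau> - c * z / j)"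
  have "D z = 0"
  proof (rule elliptic_odd_zero[OF t _ _ _ _ _ z])
    show "D holomorphic_on - Lat \<tau>"
      unfolding D_def using j t t' closed_Lat[OF t] nL
      by (intro holomorphic_intros kap_holomorphic) (auto simp: open_Compl)
    show "D (z + 1) = D z" if "z \<notin> Lat \<tau>" for z
    proof -
      \<comment> \<open>The old periods in the basis of the new lattice:
        \<open>1 / j = - c \<tau>' + a\<close>, and below \<open>\<tau> / j = d \<tau>' - b\<close>.
        Only the coefficient of \<open>\<tau>'\<close> produces a jump of
        \<open>kap\<close>.\<close>
      have "a * j - c * (\<tau>' * j) = 1" unfolding tj unfolding jd using det by (simp add: algebra_simps)
      hence "1 = (of_int (- \<gamma>$2$1) * \<tau>' + of_int (\<gamma>$1$1)) * j" by (simp add: a_def c_def algebra_simps)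
      hence "(z + 1) / j = z / j + of_int (- \<gamma>$2$1) * \<tau>' + of_int (\<gamma>$1$1)"
        using j by (simp add: add_divide_distrib nonzero_divide_eq_eq)
      hence "kap ((z + 1) / j) \<tau>' = kap (z / j) \<tau>' + c"
        using kap_add_lattice[OF t' nL[OF that], of "- \<gamma>$2$1" "\<gamma>$1$1"] by (simp add: c_def)
      thus ?thesis using kap_add_1[of z \<tau>] j by (simp add: D_def field_simps)
    qed
    show "D (z + \<tau>) = D z" if "z \<notin> Lat \<tau>" for z
    proof -
      have "d * (\<tau>' * j) - b * j = \<tau> * (a * d - b * c)" unfolding tj unfolding jd by (simp add: algebra_simps)
      hence "\<tau> = (of_int (\<gamma>$2$2) * \<tau>' + of_int (- \<gamma>$1$2)) * j" unfolding det by (simp add: d_def b_def algebra_simps)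
      hence "\<tau> / j = of_int (\<gamma>$2$2) * \<tau>' + of_int (- \<gamma>$1$2)"
        using j by (simp add: nonzero_divide_eq_eq)
      hence "(z + \<tau>) / j = z / j + of_int (\<gamma>$2$2) * \<tau>' + of_int (- \<gamma>$1$2)"
        by (simp add: add_divide_distrib)
      hence k: "kap ((z + \<tau>) / j) \<tau>' = kap (z / j) \<tau>' - d"
        using kap_add_lattice[OF t' nL[OF that], of "\<gamma>$2$2" "- \<gamma>$1$2"] by (simp add: d_def)
      have "D (z + \<tau>) = D z + (1 - (d + c * \<tau>) / j)"
        unfolding D_def k kap_add_tau[OF t that] by (simp add: add_divide_distrib diff_divide_distrib algebra_simps)
      also have "d + c * \<tau> = j" by (simp add: jd)
      finally show ?thesis using j by simp
    qed
    show "D (- z) = - D z" for z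
    proof -
      have "kap (- z / j) \<tau>' = - kap (z / j) \<tau>'" using kap_odd[of "z / j"] by simp
      thus ?thesis by (simp add: D_def kap_odd)
    qed
    show "((\<lambda>z. z * D z) \<longlongrightarrow> 0) (at 0)"
    proof -
      have "filterlim (\<lambda>z. z / j) (at 0) (at 0)"
      proof (rule filterlim_atI)
        show "((\<lambda>z. z / j) \<longlongrightarrow> 0) (at 0)" by (auto intro!: tendsto_eq_intros simp: j)
        show "\<forall>\<^sub>F x in at 0. x / j \<noteq> 0" using j by (auto simp: eventually_at intro!: exI[of _ 1])
      qed
      from filterlim_compose[OF kap_residue[OF t'] this]
      have 1: "((\<lambda>z. z / j * kap (z / j) \<tau>') \<longlongrightarrow> 1 / (2 * of_real pi * \<i>)) (at 0)" .
      have "((\<lambda>z. z / j * kap (z / j) \<tau>' - z * kap z \<tau> - z * (c * z / j)) \<longlongrightarrow>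
         1 / (2 * of_real pi * \<i>) - 1 / (2 * of_real pi * \<i>) - 0 * (c * 0 / j)) (at 0)"
        by (intro tendsto_intros 1 kap_residue[OF t]) (simp_all add: j)
      thus ?thesis by (simp add: D_def algebra_simps)
    qed
  qed
  hence "kap (z / j) \<tau>' = j * (kap z \<tau> + c * z / j)" using j by (simp add: D_def field_simps)
  thus ?thesis using j by (simp add: distrib_left j_def \<tau>'_def c_def)
qed

section \<open>Values of Dirichlet series at zero\<close>

text \<open>Iterated forward differences of \<open>x \<mapsto> x\<^sup>-\<^sup>s\<close> gain a power of \<open>x\<close> each, so that \<open>J\<close> Abel summations
  continue a Dirichlet series with periodic coefficients of mean zero to \<open>Re s > 1 - J\<close>.\<close>

fun powr_diff :: "nat \<Rightarrow> complex \<Rightarrow> complex \<Rightarrow> complex" where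
  "powr_diff 0 s x = x powr (- s)"
| "powr_diff (Suc J) s x = powr_diff J s x - powr_diff J s (x + 1)"

lemma powr_diff_deriv:
  "Re x > 0 \<Longrightarrow> (powr_diff J s has_field_derivative - s * powr_diff J (s + 1) x) (at x)"
proof (induction J arbitrary: x)
  case 0
  have "x \<notin> \<real>\<^sub>\<le>\<^sub>0" using 0 by (auto simp: complex_nonpos_Reals_iff)
  hence "((\<lambda>x. x powr (- s)) has_field_derivative - s * x powr (- s - 1)) (at x)"
    by (rule has_field_derivative_powr)
  moreover have "powr_diff 0 s = (\<lambda>x. x powr (- s))" by (rule ext) simp
  ultimately show ?case by simp
next
  case (Suc J)
  have "((\<lambda>x. powr_diff J s (x + 1)) has_field_derivative (- s * powr_diff J (s + 1) (x + 1)) * (1 + 0)) (at x)"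
    by (rule DERIV_chain2[OF Suc.IH]) (use Suc.prems in \<open>auto intro!: derivative_eq_intros\<close>)
  from DERIV_diff[OF Suc.IH[OF Suc.prems] this]
  have "((\<lambda>x. powr_diff J s x - powr_diff J s (x + 1)) has_field_derivative - s * powr_diff (Suc J) (s + 1) x) (at x)"
    by (simp add: algebra_simps)
  moreover have "powr_diff (Suc J) s = (\<lambda>x. powr_diff J s x - powr_diff J s (x + 1))" by (rule ext) simp
  ultimately show ?case by simp
qed

text \<open>Mean value estimate on \<open>[x, x + 1]\<close>: the derivative of the
  \<open>J\<close>-th difference is \<open>- s\<close> times that difference at
  \<open>s + 1\<close>. So the induction has to vary \<open>s\<close>, and its factors build up
  \<open>pochhammer s J\<close>.\<close>

lemma norm_powr_diff_le:
  assumes "x > 0" "Re s + real J \<ge> 0"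
  shows "norm (powr_diff J s (of_real x)) \<le> norm (pochhammer s J) * x powr (- (Re s + real J))"
  using assms
proof (induction J arbitrary: s x)
  case 0
  thus ?case by (simp add: norm_powr_real_powr)
next
  case (Suc J)
  let ?B = "norm (pochhammer s (Suc J)) * x powr (- (Re s + real (Suc J)))"
  have "norm (powr_diff J s (of_real x) - powr_diff J s (of_real (x + 1))) \<le> ?B * norm (complex_of_real x - of_real (x + 1))"
  proof (rule field_differentiable_bound[where S = "closed_segment (of_real x) (of_real (x + 1))" and f' = "\<lambda>z. - s * powr_diff J (s + 1) z"])
    fix z :: complex assume "z \<in> closed_segment (of_real x) (of_real (x + 1))"
    moreover have "closed_segment (of_real x) (of_real (x + 1)) = complex_of_real ` {x..x + 1}"
      unfolding closed_segment_of_real closed_segment_eq_real_ivl by simp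
    ultimately obtain y where y: "z = of_real y" "x \<le> y" "y \<le> x + 1" by auto
    show "(powr_diff J s has_field_derivative - s * powr_diff J (s + 1) z) (at z within closed_segment (of_real x) (of_real (x + 1)))"
      by (rule has_field_derivative_at_within[OF powr_diff_deriv]) (use y Suc.prems in simp)
    have "norm (powr_diff J (s + 1) z) \<le> norm (pochhammer (s + 1) J) * y powr (- (Re (s + 1) + real J))"
      unfolding y(1) by (rule Suc.IH) (use y Suc.prems in auto)
    also have "y powr (- (Re (s + 1) + real J)) \<le> x powr (- (Re (s + 1) + real J))"
      using y Suc.prems by (intro powr_mono2') auto
    finally have "norm (powr_diff J (s + 1) z) \<le> norm (pochhammer (s + 1) J) * x powr (- (Re (s + 1) + real J))"
      by (simp add: mult_left_mono)
    hence "norm s * norm (powr_diff J (s + 1) z) \<le> norm s * (norm (pochhammer (s + 1) J) * x powr (- (Re (s + 1) + real J)))"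
      by (intro mult_left_mono) auto
    thus "norm (- s * powr_diff J (s + 1) z) \<le> ?B"
      by (simp add: norm_mult pochhammer_rec mult.assoc add_ac)
  qed auto
  thus ?case by (simp add: norm_minus_commute)
qed

lemma powr_diff_holomorphic: "Re x > 0 \<Longrightarrow> (\<lambda>s. powr_diff J s x) holomorphic_on A"
proof (induction J arbitrary: x)
  case 0
  hence "x \<noteq> 0" by auto
  hence "(\<lambda>s. powr_diff 0 s x) = (\<lambda>s. exp (- s * Ln x))" by (simp add: powr_def)
  thus ?case by (simp only:) (intro holomorphic_intros)
next
  case (Suc J)
  show ?case unfolding powr_diff.simps by (intro holomorphic_intros Suc.IH) (use Suc.prems in auto)
qed

section \<open>Continuation by repeated Abel summation\<close>

context
  fixes c :: "nat \<Rightarrow> complex" and p :: nat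
  assumes p: "p > 0" and per: "\<And>n. c (n + p) = c n" and mean0: "(\<Sum>k<p. c k) = 0"
begin

text \<open>Partial sums, recentred to mean zero over a period; this is what keeps the partial sums
  of the next round periodic, hence bounded.\<close>

fun iter_sum :: "nat \<Rightarrow> nat \<Rightarrow> complex" where
  "iter_sum 0 n = c n"
| "iter_sum (Suc J) n = (\<Sum>k<Suc n. iter_sum J k) - (\<Sum>m<p. \<Sum>k<Suc m. iter_sum J k) / of_nat p"

definition iter_mean :: "nat \<Rightarrow> complex" where
  "iter_mean J = (\<Sum>m<p. \<Sum>k<Suc m. iter_sum J k) / of_nat p"

lemma iter_sum_Suc: "iter_sum (Suc J) n = (\<Sum>k<Suc n. iter_sum J k) - iter_mean J"
  by (simp add: iter_mean_def)

lemma sum_shift_periodic: "(\<Sum>k<n + p. f k) = (\<Sum>k<p. f k) + (\<Sum>k<n. f (k + p))" for f :: "nat \<Rightarrow> complex"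
  using sum.nat_group[of f p 1] by (induction n) (simp_all add: add_ac)

lemma iter_sum_props: "(\<forall>n. iter_sum J (n + p) = iter_sum J n) \<and> (\<Sum>k<p. iter_sum J k) = 0"
proof (induction J)
  case 0
  thus ?case using per mean0 by simp
next
  case (Suc J)
  have "iter_sum (Suc J) (n + p) = iter_sum (Suc J) n" for n
    unfolding iter_sum_Suc using sum_shift_periodic[of "iter_sum J" "Suc n"] Suc by simp
  moreover have "(\<Sum>k<p. iter_sum (Suc J) k) = 0"
    unfolding iter_sum_Suc sum_subtractf using p by (simp add: iter_mean_def)
  ultimately show ?case by blast
qed

lemma iter_sum_bounded: "\<exists>B. \<forall>n. norm (iter_sum J n) \<le> B"
proof (intro exI allI)
  fix n
  have "iter_sum J (m + k * p) = iter_sum J m" for m k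
  proof (induction k)
    case (Suc k)
    thus ?case using iter_sum_props[of J] by (metis add.assoc add.commute mult_Suc)
  qed simp
  from this[of "n mod p" "n div p"] have "iter_sum J n = iter_sum J (n mod p)" by simp
  thus "norm (iter_sum J n) \<le> Max ((\<lambda>m. norm (iter_sum J m)) ` {..<p})"
    using p by (simp add: Max_ge_iff)
qed

text \<open>Boundary terms of the first \<open>J\<close> Abel summations plus what is left of the
  series. Each summation moves the half plane of convergence one unit to the left.\<close>

definition L_approx :: "nat \<Rightarrow> complex \<Rightarrow> complex" where
  "L_approx J s = (\<Sum>i<J. iter_mean i * powr_diff i s 1) + (\<Sum>n. iter_sum J n * powr_diff J s (of_nat (Suc n)))"

lemma L_approx_term_bound:
  assumes B: "\<And>n. norm (iter_sum J n) \<le> B" and P: "norm (pochhammer s J) \<le> P"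
    and r: "r \<le> Re s" "r + real J > 1"
  shows "norm (iter_sum J n * powr_diff J s (of_nat (Suc n))) \<le> B * (P * real (Suc n) powr (- (r + real J)))"
proof -
  have B0: "B \<ge> 0" and P0: "P \<ge> 0" using B[of 0] P norm_ge_zero order_trans by blast+
  have "norm (powr_diff J s (of_real (real (Suc n)))) \<le> norm (pochhammer s J) * real (Suc n) powr (- (Re s + real J))"
    by (rule norm_powr_diff_le) (use r in auto)
  also have "\<dots> \<le> P * real (Suc n) powr (- (r + real J))"
    using r by (intro mult_mono P powr_mono) (auto simp: P0)
  finally show ?thesis unfolding norm_mult using B[of n] B0 by (intro mult_mono) auto
qed

lemma summable_Suc_powr: "e > 1 \<Longrightarrow> summable (\<lambda>n. real (Suc n) powr (- e))"
  using summable_Suc_iff[of "\<lambda>n. real n powr (- e)"] by (simp add: summable_real_powr_iff)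

lemma L_approx_summable:
  assumes "Re s + real J > 1"
  shows "summable (\<lambda>n. iter_sum J n * powr_diff J s (of_nat (Suc n)))"
proof -
  obtain B where B: "\<And>n. norm (iter_sum J n) \<le> B" using iter_sum_bounded by blast
  show ?thesis
    by (rule summable_comparison_test'[where N = 0, OF _ L_approx_term_bound[OF B order_refl order_refl assms]])
       (intro summable_mult summable_Suc_powr assms)
qed

lemma L_approx_holomorphic: "L_approx J holomorphic_on {s. Re s > 1 - real J}"
proof -
  let ?S = "{s. Re s > 1 - real J}"
  have op: "open ?S" by (rule open_halfspace_Re_gt)
  let ?t = "\<lambda>n s. iter_sum J n * powr_diff J s (of_nat (Suc n))"
  obtain B where B: "\<And>n. norm (iter_sum J n) \<le> B" using iter_sum_bounded by blast
  have "(\<lambda>s. \<Sum>n. ?t n s) holomorphic_on ?S"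
  proof (rule holomorphic_uniform_sequence[OF op])
    show "(\<lambda>s. \<Sum>n<N. ?t n s) holomorphic_on ?S" for N
      by (intro holomorphic_intros powr_diff_holomorphic) auto
    fix x assume "x \<in> ?S"
    then obtain d where d: "d > 0" "cball x d \<subseteq> ?S" using op open_contains_cball by blast
    have "continuous_on (cball x d) (\<lambda>s. pochhammer s J)"
      unfolding pochhammer_prod by (intro continuous_intros)
    hence "bounded ((\<lambda>s. pochhammer s J) ` cball x d)"
      by (intro compact_imp_bounded compact_continuous_image) auto
    then obtain P where P: "\<And>s. s \<in> cball x d \<Longrightarrow> norm (pochhammer s J) \<le> P" unfolding bounded_iff by blast
    have "x - of_real d \<in> cball x d" using d by (simp add: dist_norm)
    hence "x - of_real d \<in> ?S" using d by blast
    hence r1: "Re x - d + real J > 1" by simp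
    have r2: "Re x - d \<le> Re s" if "s \<in> cball x d" for s
      using that abs_Re_le_cmod[of "x - s"] by (simp add: dist_norm)
    have "uniform_limit (cball x d) (\<lambda>N s. \<Sum>n<N. ?t n s) (\<lambda>s. \<Sum>n. ?t n s) sequentially"
    proof (rule Weierstrass_m_test)
      show "norm (?t n s) \<le> B * (P * real (Suc n) powr (- (Re x - d + real J)))" if "s \<in> cball x d" for n s
        by (rule L_approx_term_bound[OF B P[OF that] r2[OF that] r1])
    qed (intro summable_mult summable_Suc_powr r1)
    thus "\<exists>d>0. cball x d \<subseteq> ?S \<and> uniform_limit (cball x d) (\<lambda>N s. \<Sum>n<N. ?t n s) (\<lambda>s. \<Sum>n. ?t n s) sequentially"
      using d by blast
  qed
  thus ?thesis unfolding L_approx_def[abs_def] by (intro holomorphic_intros powr_diff_holomorphic) auto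
qed

lemma abel_summation:
  "(\<Sum>n<N. iter_sum J n * f n) = iter_mean J * f 0 + (\<Sum>n<N. iter_sum (Suc J) n * (f n - f (Suc n)))
     + ((\<Sum>k<N. iter_sum J k) - iter_mean J) * f N"
  by (induction N) (simp_all add: iter_sum_Suc algebra_simps del: iter_sum.simps)

lemma L_approx_Suc:
  assumes s: "Re s + real J > 1"
  shows "L_approx (Suc J) s = L_approx J s"
proof -
  let ?f = "\<lambda>n. powr_diff J s (of_nat (Suc n))"
  have e: "iter_sum (Suc J) n * (?f n - ?f (Suc n)) = iter_sum (Suc J) n * powr_diff (Suc J) s (of_nat (Suc n))" for n
    by (simp add: add_ac del: iter_sum.simps)
  have "summable (\<lambda>n. iter_sum (Suc J) n * (?f n - ?f (Suc n)))"
    unfolding e by (rule L_approx_summable) (use s in simp)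
  hence l1: "(\<lambda>N. \<Sum>n<N. iter_sum (Suc J) n * (?f n - ?f (Suc n))) \<longlonglongrightarrow> (\<Sum>n. iter_sum (Suc J) n * (?f n - ?f (Suc n)))"
    by (rule summable_LIMSEQ)
  have l2: "(\<lambda>N. \<Sum>n<N. iter_sum J n * ?f n) \<longlonglongrightarrow> (\<Sum>n. iter_sum J n * ?f n)"
    by (rule summable_LIMSEQ[OF L_approx_summable[OF s]])
  obtain B where B: "\<And>n. norm (iter_sum (Suc J) n) \<le> B" using iter_sum_bounded by blast
  \<comment> \<open>After a shift of \<open>N\<close> by one the bracket is
    \<open>iter_sum (Suc J) N\<close>, which is bounded, while \<open>?f\<close> tends to 0 by
    \<open>norm_powr_diff_le\<close>.\<close>
  have "(\<lambda>N. ((\<Sum>k<N. iter_sum J k) - iter_mean J) * ?f N) \<longlonglongrightarrow> 0"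
  proof (rule LIMSEQ_offset[where k = 1], rule Lim_null_comparison)
    show "(\<lambda>N. B * (norm (pochhammer s J) * real (Suc (Suc N)) powr (- (Re s + real J)))) \<longlonglongrightarrow> 0"
      by (intro tendsto_mult_right_zero summable_LIMSEQ_zero[OF summable_Suc_powr[OF s], THEN LIMSEQ_Suc])
    have "norm (((\<Sum>k<N + 1. iter_sum J k) - iter_mean J) * ?f (N + 1))
         \<le> B * (norm (pochhammer s J) * real (Suc (Suc N)) powr (- (Re s + real J)))" for N
    proof -
      have "norm (powr_diff J s (of_real (real (Suc (Suc N))))) \<le> norm (pochhammer s J) * real (Suc (Suc N)) powr (- (Re s + real J))"
        by (rule norm_powr_diff_le) (use s in auto)
      thus ?thesis unfolding norm_mult using B[of N] order_trans[OF norm_ge_zero B]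
        by (intro mult_mono) (simp_all add: iter_sum_Suc del: iter_sum.simps)
    qed
    thus "\<forall>\<^sub>F N in sequentially. norm (((\<Sum>k<N + 1. iter_sum J k) - iter_mean J) * ?f (N + 1))
         \<le> B * (norm (pochhammer s J) * real (Suc (Suc N)) powr (- (Re s + real J)))"
      by simp
  qed
  from tendsto_add[OF tendsto_add[OF tendsto_const[of "iter_mean J * ?f 0"] l1] this]
  have "(\<lambda>N. \<Sum>n<N. iter_sum J n * ?f n) \<longlonglongrightarrow> iter_mean J * ?f 0 + (\<Sum>n. iter_sum (Suc J) n * (?f n - ?f (Suc n))) + 0"
    unfolding abel_summation[of J ?f, symmetric] .
  from LIMSEQ_unique[OF l2 this] show ?thesis unfolding L_approx_def e by simp
qed

lemma L_approx_eq:
  assumes "Re s + real J > 1" "J \<le> K"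
  shows "L_approx K s = L_approx J s"
  using assms(2)
proof (induction K rule: dec_induct)
  case (step K)
  thus ?case using L_approx_Suc[of s K] assms(1) by simp
qed simp

text \<open>The order is chosen so that \<open>Re s + J >= 2\<close>, inside the region where
  \<open>L_approx_eq\<close> makes all larger orders agree.\<close>

definition L_entire :: "complex \<Rightarrow> complex" where
  "L_entire s = L_approx (nat \<lceil>2 - Re s\<rceil>) s"

lemma L_entire_eq:
  assumes "Re s + real J > 1"
  shows "L_entire s = L_approx J s"
proof -
  define K where "K = nat \<lceil>2 - Re s\<rceil>"
  have K: "Re s + real K > 1" unfolding K_def by linarith
  have "L_approx K s = L_approx (max J K) s" "L_approx J s = L_approx (max J K) s"
    using L_approx_eq[OF K, of "max J K"] L_approx_eq[OF assms, of "max J K"] by simp_all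
  thus ?thesis by (simp add: L_entire_def K_def)
qed

lemma L_entire_holomorphic: "L_entire holomorphic_on A"
proof (rule holomorphic_on_local)
  fix x :: complex
  define J where "J = nat \<lceil>2 - Re x\<rceil>"
  have J: "Re x + real J > 1" unfolding J_def by linarith
  have "L_entire holomorphic_on {s. Re s > 1 - real J}"
    by (rule holomorphic_transform[OF L_approx_holomorphic], rule L_entire_eq[symmetric]) simp
  thus "\<exists>U. open U \<and> x \<in> U \<and> L_entire holomorphic_on U"
    using J by (intro exI[of _ "{s. Re s > 1 - real J}"]) (auto simp: open_halfspace_Re_gt)
qed

lemma L_entire_sums:
  assumes "Re s > 1"
  shows "(\<lambda>n. c n / of_nat (Suc n) powr s) sums L_entire s"
proof -
  have s: "Re s + real 0 > 1" using assms by simp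
  have "L_entire s = (\<Sum>n. c n * (of_nat (Suc n) powr (- s)))"
    by (simp add: L_entire_eq[OF s] L_approx_def)
  moreover have "summable (\<lambda>n. c n * (of_nat (Suc n) powr (- s)))"
    using L_approx_summable[OF s] by simp
  ultimately have "(\<lambda>n. c n * (of_nat (Suc n) powr (- s))) sums L_entire s"
    by (simp add: sums_iff)
  thus ?thesis by (simp add: powr_minus field_simps)
qed

text \<open>At \<open>s = 0\<close> the function \<open>x powr (- s)\<close> is constant, so all
  differences of positive order vanish and only the first boundary term survives. Order 2 is the
  least whose half plane contains 0.\<close>

lemma L_entire_0: "L_entire 0 = (\<Sum>m<p. \<Sum>k<Suc m. c k) / of_nat p"
proof -
  have z: "powr_diff J 0 (of_nat (Suc n)) = (if J = 0 then 1 else 0)" for J n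
  proof (induction J arbitrary: n)
    case (Suc J)
    show ?case using Suc[of n] Suc[of "Suc n"] by (simp add: add_ac)
  qed (simp add: powr_def del: of_nat_Suc)
  have "L_entire 0 = L_approx 2 0" by (rule L_entire_eq) simp
  also have "\<dots> = iter_mean 0" using z[of _ 0] z[of 2] by (simp add: L_approx_def numeral_2_eq_2 del: iter_sum.simps powr_diff.simps)
  finally show ?thesis by (simp add: iter_mean_def)
qed

end

lemma dirichlet_L_0:
  assumes p: "p > 0" and per: "\<And>n. \<psi> (n + int p) = \<psi> n" and mean0: "(\<Sum>k=1..p. \<psi> (int k)) = 0"
  shows "dirichlet_L \<psi> 0 = - (\<Sum>k=1..p. of_nat k * \<psi> (int k)) / of_nat p"
proof -
  define c where "c = (\<lambda>n. \<psi> (int (Suc n)))"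
  have per': "c (n + p) = c n" for n using per[of "int (Suc n)"] by (simp add: c_def add_ac)
  have sum_eq: "(\<Sum>k=1..p. f k) = (\<Sum>k<p. f (Suc k))" for f :: "nat \<Rightarrow> complex"
    by (rule sum.reindex_bij_witness[of _ Suc "\<lambda>k. k - 1"]) auto
  have mean0': "(\<Sum>k<p. c k) = 0" using mean0 unfolding sum_eq by (simp add: c_def)
  note L = L_entire_holomorphic[OF p per' mean0'] L_entire_sums[OF p per' mean0'] L_entire_0[OF p per' mean0']
  \<comment> \<open>Summation by parts turns the mean of the partial sums into a first moment, which
    is the first generalized Bernoulli number up to sign.\<close>
  have "(\<Sum>m<n. \<Sum>k<Suc m. c k) = of_nat (Suc n) * (\<Sum>k<n. c k) - (\<Sum>k<n. of_nat (Suc k) * c k)" for n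
    by (induction n) (simp_all add: algebra_simps)
  hence e: "L_entire c p 0 = - (\<Sum>k=1..p. of_nat k * \<psi> (int k)) / of_nat p"
    unfolding L(3) sum_eq using mean0' by (simp add: c_def)
  \<comment> \<open>\<open>dirichlet_L\<close> admits every continuation to the plane without 1;
    this set is connected, so the identity theorem singles out the value at 0, and the entire
    function supplies it.\<close>
  have uniq: "F 0 = G 0" if "F holomorphic_on - {1}" "G holomorphic_on - {1}"
    "\<And>w. Re w > 1 \<Longrightarrow> F w = G w" for F G :: "complex \<Rightarrow> complex"
  proof (rule analytic_continuation_open[of "{w. Re w > 1}" "- {1}" F G])
    show "{w. Re w > 1} \<noteq> {}" by (auto intro!: exI[of _ 2])
    show "connected (- {1 :: complex})" by (rule connected_punctured_universe) simp
  qed (use that in \<open>auto simp: open_halfspace_Re_gt open_Compl\<close>)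
  have "dirichlet_L \<psi> 0 = L_entire c p 0"
    unfolding dirichlet_L_def
  proof (rule the_equality)
    show "\<exists>F. F holomorphic_on - {1} \<and>
        (\<forall>w. Re w > 1 \<longrightarrow> (\<lambda>n. \<psi> (int (Suc n)) / of_nat (Suc n) powr w) sums F w) \<and> L_entire c p 0 = F 0"
      using L(1,2) by (intro exI[of _ "L_entire c p"]) (auto simp: c_def)
    fix z assume "\<exists>F. F holomorphic_on - {1} \<and>
        (\<forall>w. Re w > 1 \<longrightarrow> (\<lambda>n. \<psi> (int (Suc n)) / of_nat (Suc n) powr w) sums F w) \<and> z = F 0"
    then obtain F where F: "F holomorphic_on - {1}"
      "\<And>w. Re w > 1 \<Longrightarrow> (\<lambda>n. \<psi> (int (Suc n)) / of_nat (Suc n) powr w) sums F w" "z = F 0" by blast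
    have "F 0 = L_entire c p 0"
    proof (rule uniq[OF F(1) L(1)])
      fix w :: complex assume w: "Re w > 1"
      have "(\<lambda>n. c n / of_nat (Suc n) powr w) sums F w" using F(2)[OF w] by (simp only: c_def)
      thus "F w = L_entire c p w" using L(2)[OF w] by (rule sums_unique2)
    qed
    thus "z = L_entire c p 0" using F(3) by simp
  qed
  thus ?thesis using e by simp
qed

section \<open>Division values as modular forms\<close>

lemma has_sum_geometric_Suc:
  fixes x :: "'a :: {real_normed_field, banach}"
  assumes "norm x < 1"
  shows "((\<lambda>n. x ^ Suc n) has_sum x / (1 - x)) UNIV"
proof (rule norm_summable_imp_has_sum)
  show "summable (\<lambda>n. norm (x ^ Suc n))" using assms by (simp add: norm_mult norm_power summable_mult)
  show "(\<lambda>n. x ^ Suc n) sums (x / (1 - x))" using sums_mult[OF geometric_sums[OF assms], of x] by simp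
qed

lemma power_Suc_less_1: "0 \<le> a \<Longrightarrow> a < 1 \<Longrightarrow> a ^ Suc m < (1 :: real)"
  using mult_left_le[of "a ^ m" a] power_le_one[of a m] by simp

text \<open>Summability over pairs is what licenses summing by rows, by columns, or along the
  products \<open>(m + 1) (n + 1)\<close>.\<close>

lemma lambert_summable:
  fixes q :: complex
  assumes q: "norm q < 1" and c: "\<And>n. norm (c n) \<le> B"
  shows "(\<lambda>(m, n). c m * (q ^ Suc m) ^ Suc n) summable_on (UNIV :: (nat \<times> nat) set)"
proof (rule abs_summable_summable)
  have pw: "norm q ^ Suc m < 1" for m by (rule power_Suc_less_1[OF norm_ge_zero q])
  have nonneg: "0 \<le> norm q ^ Suc m / (1 - norm q ^ Suc m)" for m
    using pw[of m] by (intro divide_nonneg_nonneg) auto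
  have B: "B \<ge> 0" using c[of 0] norm_ge_zero order_trans by blast
  have 1: "((\<lambda>n. (norm q ^ Suc m) ^ Suc n) has_sum norm q ^ Suc m / (1 - norm q ^ Suc m)) UNIV" for m
    by (rule has_sum_geometric_Suc) (use pw[of m] in simp)
  have le: "norm q ^ Suc m / (1 - norm q ^ Suc m) \<le> norm q ^ Suc m / (1 - norm q)" for m
  proof (intro divide_left_mono mult_pos_pos)
    have "norm q ^ Suc m \<le> norm q" using q by (simp add: mult_left_le power_le_one)
    thus "1 - norm q \<le> 1 - norm q ^ Suc m" by simp
  qed (use q pw[of m] in auto)
  have "summable (\<lambda>m. norm q ^ Suc m / (1 - norm q))"
    using q by (intro summable_divide) (simp add: summable_mult)
  hence "summable (\<lambda>m. norm q ^ Suc m / (1 - norm q ^ Suc m))"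
    by (rule summable_comparison_test'[where N = 0]) (simp only: real_norm_def abs_of_nonneg[OF nonneg] le)
  hence "(\<lambda>m. norm q ^ Suc m / (1 - norm q ^ Suc m)) summable_on UNIV"
    by (subst summable_on_UNIV_nonneg_real_iff[OF nonneg])
  hence "(\<lambda>(m, n). (norm q ^ Suc m) ^ Suc n) summable_on (UNIV \<times> UNIV)"
    by (intro summable_on_SigmaI[where g = "\<lambda>m. norm q ^ Suc m / (1 - norm q ^ Suc m)"]) (use 1 in auto)
  hence "(\<lambda>x. B * (case x of (m, n) \<Rightarrow> (norm q ^ Suc m) ^ Suc n)) summable_on (UNIV :: (nat \<times> nat) set)"
    by (intro summable_on_cmult_right) simp
  thus "(\<lambda>x. norm (case x of (m, n) \<Rightarrow> c m * (q ^ Suc m) ^ Suc n)) summable_on (UNIV :: (nat \<times> nat) set)"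
    by (rule summable_on_comparison_test) (auto simp: norm_mult norm_power intro!: mult_right_mono c)
qed

lemma lambert_rows:
  fixes q :: complex
  assumes q: "norm q < 1" and c: "\<And>n. norm (c n) \<le> B"
  defines "S \<equiv> infsum (\<lambda>(m, n). c m * (q ^ Suc m) ^ Suc n) UNIV"
  shows "(\<lambda>m. c m * (q ^ Suc m / (1 - q ^ Suc m))) sums S"
proof -
  have S: "((\<lambda>(m, n). c m * (q ^ Suc m) ^ Suc n) has_sum S) (UNIV \<times> UNIV)"
    unfolding S_def using has_sum_infsum[OF lambert_summable[OF q c]] by simp
  have "((\<lambda>m. c m * (q ^ Suc m / (1 - q ^ Suc m))) has_sum S) UNIV"
  proof (rule has_sum_SigmaD[OF S])
    fix m
    have "norm q ^ Suc m < 1" by (rule power_Suc_less_1[OF norm_ge_zero q])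
    hence "norm (q ^ Suc m) < 1" by (simp only: norm_power)
    from has_sum_cmult_right[OF has_sum_geometric_Suc[OF this], of "c m"]
    show "((\<lambda>n. case (m, n) of (m, n) \<Rightarrow> c m * (q ^ Suc m) ^ Suc n) has_sum c m * (q ^ Suc m / (1 - q ^ Suc m))) UNIV"
      by (simp only: prod.case)
  qed
  thus ?thesis by (rule has_sum_imp_sums)
qed

text \<open>Both sides sum \<open>w^m q^(m n)\<close> over \<open>m, n >= 1\<close>, in the two
  orders; \<open>|w| = 1\<close> keeps the coefficients bounded.\<close>

lemma lam_eq_lambert:
  assumes q: "norm q < 1" and w: "norm w = 1"
  shows "(\<lambda>m. w ^ Suc m * (q ^ Suc m / (1 - q ^ Suc m))) sums lam w q"
proof -
  define f where "f = (\<lambda>(m, n). w ^ Suc m * (q ^ Suc m) ^ Suc n)"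
  have c: "norm (w ^ Suc m) \<le> 1" for m using w by (simp only: norm_power power_one order_refl)
  have S: "(f has_sum infsum f UNIV) (UNIV \<times> UNIV)"
    unfolding f_def using has_sum_infsum[OF lambert_summable[OF q c]] by simp
  hence S': "((\<lambda>(n, m). f (m, n)) has_sum infsum f UNIV) (UNIV \<times> UNIV)" by (subst (asm) has_sum_swap)
  have "((\<lambda>n. w * q ^ Suc n / (1 - w * q ^ Suc n)) has_sum infsum f UNIV) UNIV"
  proof (rule has_sum_SigmaD[OF S'])
    fix n
    have "norm q ^ Suc n < 1" by (rule power_Suc_less_1[OF norm_ge_zero q])
    hence "norm (w * q ^ Suc n) < 1" using w by (simp only: norm_power norm_mult mult_1_left)
    from has_sum_geometric_Suc[OF this]
    show "((\<lambda>m. case (n, m) of (n, m) \<Rightarrow> f (m, n)) has_sum w * q ^ Suc n / (1 - w * q ^ Suc n)) UNIV"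
      by (simp only: prod.case f_def power_mult_distrib power_mult[symmetric] mult.commute[of "Suc n"])
  qed
  from has_sum_imp_sums[OF this] have "lam w q = infsum f UNIV" unfolding lam_def by (rule sums_unique[symmetric])
  thus ?thesis using lambert_rows[OF q c] by (simp only: f_def)
qed

text \<open>The pairs with product \<open>N\<close> are collected. The sequence \<open>c\<close> is
  indexed from 0, with \<open>c 0\<close> belonging to the divisor 1, hence
  \<open>c (d - 1)\<close>.\<close>

lemma lambert_q_expansion:
  fixes q :: complex and c :: "nat \<Rightarrow> complex"
  assumes q: "norm q < 1" and c: "\<And>n. norm (c n) \<le> B"
  shows "(\<lambda>N. (if N = 0 then 0 else \<Sum>d | d dvd N. c (d - 1)) * q ^ N) sums
           (\<Sum>m. c m * (q ^ Suc m / (1 - q ^ Suc m)))"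
proof -
  define f where "f = (\<lambda>(m, n). c m * (q ^ Suc m) ^ Suc n)"
  define D where "D = (\<lambda>N :: nat. if N = 0 then {} else {d. d dvd N})"
  have S: "(f has_sum infsum f UNIV) UNIV"
    unfolding f_def by (rule has_sum_infsum[OF lambert_summable[OF q c]])
  have sumS: "(\<Sum>m. c m * (q ^ Suc m / (1 - q ^ Suc m))) = infsum f UNIV"
    using lambert_rows[OF q c] unfolding f_def by (simp only: sums_iff)
  have bij: "bij_betw (\<lambda>(N, d). (d - 1, N div d - 1)) (SIGMA N:UNIV. D N) (UNIV :: (nat \<times> nat) set)"
    by (rule bij_betw_byWitness[where f' = "\<lambda>(m, n). (Suc m * Suc n, Suc m)"])
       (auto simp: D_def split: if_splits simp del: mult_Suc mult_Suc_right elim!: dvdE)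
  have "((\<lambda>x. f (case x of (N, d) \<Rightarrow> (d - 1, N div d - 1))) has_sum infsum f UNIV) (SIGMA N:UNIV. D N)"
    using S by (subst has_sum_reindex_bij_betw[OF bij])
  also have "?this \<longleftrightarrow> ((\<lambda>(N, d). c (d - 1) * q ^ N) has_sum infsum f UNIV) (SIGMA N:UNIV. D N)"
  proof (intro has_sum_cong)
    fix x assume "x \<in> (SIGMA N:UNIV. D N)"
    then obtain N d where x: "x = (N, d)" "N \<noteq> 0" "d dvd N" by (auto simp: D_def split: if_splits)
    then obtain e where e: "N = d * e" by (elim dvdE)
    have "d > 0" "e > 0" using x(2) e by auto
    thus "f (case x of (N, d) \<Rightarrow> (d - 1, N div d - 1)) = (case x of (N, d) \<Rightarrow> c (d - 1) * q ^ N)"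
      by (simp add: x(1) f_def e power_mult del: power_Suc)
  qed
  finally have "((\<lambda>(N, d). c (d - 1) * q ^ N) has_sum infsum f UNIV) (SIGMA N:UNIV. D N)" .
  hence "((\<lambda>N. (if N = 0 then 0 else \<Sum>d | d dvd N. c (d - 1)) * q ^ N) has_sum infsum f UNIV) UNIV"
  proof (rule has_sum_SigmaD)
    fix N :: nat
    show "((\<lambda>d. case (N, d) of (N, d) \<Rightarrow> c (d - 1) * q ^ N) has_sum (if N = 0 then 0 else \<Sum>d | d dvd N. c (d - 1)) * q ^ N) (D N)"
      by (rule has_sum_finiteI) (auto simp: D_def sum_distrib_right)
  qed
  thus ?thesis unfolding sumS by (rule has_sum_imp_sums)
qed

text \<open>\<open>kap\<close> drops by \<open>m\<close> under translation by
  \<open>m \<tau>\<close>. The summand \<open>c / p\<close> compensates for this, so for admissible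
  vectors the value depends only on \<open>c\<close> and \<open>d\<close> mod
  \<open>p\<close>.\<close>

definition eis :: "nat \<Rightarrow> int \<Rightarrow> int \<Rightarrow> complex \<Rightarrow> complex" where
  "eis p c d \<tau> = (if Im \<tau> > 0 then kap ((of_int c * \<tau> + of_int d) / of_nat p) \<tau> + of_int c / of_nat p else 0)"

lemma Lat_coords:
  assumes "Im \<tau> > 0" "of_int a * \<tau> + of_int b = of_int c * \<tau> + of_int d"
  shows "a = c" "b = d"
proof -
  have "of_int a * Im \<tau> = of_int c * Im \<tau>" using arg_cong[OF assms(2), of Im] by simp
  thus ac: "a = c" using assms(1) by simp
  show "b = d" using assms(2) ac by simp
qed

lemma not_Lat_admissible:
  assumes p: "p > 0" and adm: "admissible p c d" and t: "Im \<tau> > 0"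
  shows "(of_int c * \<tau> + of_int d) / of_nat p \<notin> Lat \<tau>"
proof
  assume "(of_int c * \<tau> + of_int d) / of_nat p \<in> Lat \<tau>"
  then obtain m n where "(of_int c * \<tau> + of_int d) / of_nat p = of_int m * \<tau> + of_int n" by (auto simp: Lat_iff)
  hence "of_int c * \<tau> + of_int d = of_int (int p * m) * \<tau> + of_int (int p * n)" using p by (simp add: field_simps)
  from Lat_coords[OF t this] show False using adm by (simp add: admissible_def)
qed

lemma eis_cong:
  assumes p: "p > 0" and adm: "admissible p c d" and c: "[c' = c] (mod int p)" and d: "[d' = d] (mod int p)"
  shows "eis p c' d' = eis p c d"
proof
  fix \<tau>
  obtain m n where m: "c' = c + int p * m" and n: "d' = d + int p * n"
    using c d unfolding cong_iff_lin by (metis add.commute cong_iff_lin cong_sym)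
  show "eis p c' d' \<tau> = eis p c d \<tau>"
  proof (cases "Im \<tau> > 0")
    case True
    have "(of_int c' * \<tau> + of_int d') / of_nat p = (of_int c * \<tau> + of_int d) / of_nat p + of_int m * \<tau> + of_int n"
      using p by (simp add: m n field_simps)
    hence "kap ((of_int c' * \<tau> + of_int d') / of_nat p) \<tau> = kap ((of_int c * \<tau> + of_int d) / of_nat p) \<tau> - of_int m"
      using kap_add_lattice[OF True not_Lat_admissible[OF p adm True]] by simp
    moreover have "of_int c' / of_nat p = of_int c / of_nat p + (of_int m :: complex)" using p by (simp add: m add_divide_distrib)
    ultimately show ?thesis using True by (simp only: eis_def if_True) simp
  qed (simp add: eis_def)
qed

lemma eis_slash:
  assumes p: "p > 0" and adm: "admissible p c d" and g: "\<gamma> \<in> SL2Z"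
  shows "slash 1 (eis p c d) \<gamma> = eis p (c * \<gamma>$1$1 + d * \<gamma>$2$1) (c * \<gamma>$1$2 + d * \<gamma>$2$2)"
proof
  fix \<tau>
  show "slash 1 (eis p c d) \<gamma> \<tau> = eis p (c * \<gamma>$1$1 + d * \<gamma>$2$1) (c * \<gamma>$1$2 + d * \<gamma>$2$2) \<tau>"
  proof (cases "Im \<tau> > 0")
    case t: True
    define \<alpha> \<beta> where "\<alpha> = c * \<gamma>$1$1 + d * \<gamma>$2$1" and "\<beta> = c * \<gamma>$1$2 + d * \<gamma>$2$2"
    define z where "z = (of_int \<alpha> * \<tau> + of_int \<beta>) / of_nat p"
    let ?j = "jfac \<gamma> \<tau>"
    have j: "?j \<noteq> 0" by (rule jfac_nonzero[OF g t])
    have adm': "admissible p \<alpha> \<beta>" unfolding \<alpha>_def \<beta>_def by (rule admissible_mult[OF g adm])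
    have zL: "z \<notin> Lat \<tau>" unfolding z_def by (rule not_Lat_admissible[OF p adm' t])
    have zz: "(of_int c * moeb \<gamma> \<tau> + of_int d) / of_nat p = z / ?j"
    proof -
      have "of_int c * moeb \<gamma> \<tau> + of_int d = (of_int \<alpha> * \<tau> + of_int \<beta>) / ?j"
        using j unfolding moeb_def \<alpha>_def \<beta>_def by (simp add: field_simps) (simp add: jfac_def algebra_simps)
      thus ?thesis by (simp add: z_def)
    qed
    have "\<alpha> * \<gamma>$2$2 - \<beta> * \<gamma>$2$1 = c * (\<gamma>$1$1 * \<gamma>$2$2 - \<gamma>$1$2 * \<gamma>$2$1)"
      unfolding \<alpha>_def \<beta>_def by (simp only: algebra_simps)
    hence "\<alpha> * \<gamma>$2$2 = \<beta> * \<gamma>$2$1 + c" using g by (simp add: SL2Z_iff)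
    hence k: "of_int \<alpha> * of_int (\<gamma>$2$2) = of_int \<beta> * of_int (\<gamma>$2$1) + (of_int c :: complex)"
      by (metis of_int_add of_int_mult)
    \<comment> \<open>The inhomogeneous term of \<open>kap_moeb\<close> and the summand
      \<open>c / p\<close> combine, through the determinant, to \<open>j\<close> times the summand
      belonging to the transformed vector.\<close>
    have "of_int (\<gamma>$2$1) * z + of_int c / of_nat p = (of_int (\<gamma>$2$1) * of_int \<alpha> * \<tau> + (of_int \<beta> * of_int (\<gamma>$2$1) + of_int c)) / of_nat p"
      by (simp add: z_def add_divide_distrib algebra_simps)
    also have "\<dots> = ?j * (of_int \<alpha> / of_nat p)" unfolding k[symmetric] by (simp add: jfac_def algebra_simps add_divide_distrib)
    finally have s: "of_int (\<gamma>$2$1) * z + of_int c / of_nat p = ?j * (of_int \<alpha> / of_nat p)" .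
    have "eis p c d (moeb \<gamma> \<tau>) = ?j * kap z \<tau> + of_int (\<gamma>$2$1) * z + of_int c / of_nat p"
      by (simp add: eis_def Im_moeb_pos[OF g t] zz kap_moeb[OF g t zL])
    also have "\<dots> = ?j * kap z \<tau> + ?j * (of_int \<alpha> / of_nat p)" using s by (simp only: add.assoc)
    also have "\<dots> = ?j * eis p \<alpha> \<beta> \<tau>" using t by (simp add: eis_def z_def distrib_left)
    finally show ?thesis using j by (simp add: slash_eq[OF t] power_int_minus \<alpha>_def \<beta>_def)
  qed (simp add: slash_outside eis_def)
qed

lemma eis_holomorphic:
  assumes p: "p > 0" and adm: "admissible p c d"
  shows "eis p c d holomorphic_on upper_half_plane"
proof -
  have "(\<lambda>\<tau>. kap ((of_int c * \<tau> + of_int d) / of_nat p) \<tau> + of_int c / of_nat p) holomorphic_on upper_half_plane"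
    using p not_Lat_admissible[OF p adm]
    by (intro holomorphic_intros kap_holomorphic open_uhp) (auto simp: uhp_iff)
  thus ?thesis by (rule holomorphic_transform) (simp add: eis_def uhp_iff)
qed

lemma eis_bounded:
  assumes p: "p > 0" and adm: "admissible p c d"
  shows "bounded_at_i_infinity (eis p c d)"
proof -
  \<comment> \<open>With \<open>0 <= c' < p\<close> the ratio \<open>\<theta>\<close> lies in
    \<open>[0, 1)\<close>, so \<open>|u| <= 1\<close> and \<open>|q / u| <= r < 1\<close>, as the
    two \<open>lam\<close> bounds require. For \<open>\<theta> = 0\<close> the rational term does
    not depend on \<open>\<tau>\<close>, whence the case distinction in \<open>M\<close>.\<close>
  define c' where "c' = c mod int p"
  have c': "0 \<le> c'" "c' < int p" using p by (simp_all add: c'_def)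
  have adm': "admissible p c' d" using adm by (simp add: c'_def admissible_def dvd_mod_iff)
  have e: "eis p c d = eis p c' d" by (rule eis_cong[OF p adm']) (simp_all add: c'_def cong_def)
  define \<theta> where "\<theta> = real_of_int c' / real p"
  have \<theta>: "0 \<le> \<theta>" "\<theta> < 1" using c' p by (auto simp: \<theta>_def)
  define r where "r = exp (- 2 * pi * (1 - \<theta>))"
  have r: "r < 1" using \<theta> by (simp add: r_def)
  define M where "M = (if c' = 0 then norm ((qvar (of_int d / of_nat p) + 1) / (2 * (qvar (of_int d / of_nat p) - 1)))
     else 1 / (1 - exp (- 2 * pi * \<theta>)))"
  have bound: "norm (eis p c' d \<tau>) \<le> M + 2 + 2 * r / (1 - r) + norm (of_int c' / of_nat p :: complex)" if t: "Im \<tau> > 1" for \<tau>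
  proof -
    define u where "u = qvar ((of_int c' * \<tau> + of_int d) / of_nat p)"
    define q where "q = qvar \<tau>"
    have Imz: "Im ((of_int c' * \<tau> + of_int d) / of_nat p) = \<theta> * Im \<tau>" by (simp add: \<theta>_def)
    have nu: "norm u = exp (- 2 * pi * \<theta> * Im \<tau>)" unfolding u_def norm_qvar Imz by (simp only: mult.assoc)
    have nq: "norm q = exp (- 2 * pi * Im \<tau>)" by (simp add: q_def norm_qvar)
    have "exp (- 2 * pi * Im \<tau>) \<le> exp (- 1 :: real)" using t pi_gt3 mult_mono[of 1 "2 * pi" 1 "Im \<tau>"] by simp
    also have "\<dots> \<le> 1 / 2" using exp_ge_add_one_self[of 1] by (simp add: exp_minus field_simps)
    finally have q2: "norm q \<le> 1/2" by (simp add: nq)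
    have u1: "norm u \<le> 1" using \<theta> t by (simp add: nu)
    have "norm (u * q) \<le> 1 * (1/2)" unfolding norm_mult using u1 q2 by (intro mult_mono) auto
    hence 1: "norm (lam u q) \<le> 2" using norm_lam_le[OF q2, of u "1/2"] by simp
    have "norm (1 / u * q) = exp (- 2 * pi * (1 - \<theta>) * Im \<tau>)"
      by (simp add: norm_mult norm_divide nu nq exp_minus exp_diff[symmetric] field_simps exp_add[symmetric])
    also have "\<dots> \<le> r" using t \<theta> mult_left_mono[of 1 "Im \<tau>" "2 * pi * (1 - \<theta>)"] by (simp add: r_def)
    finally have 2: "norm (lam (1 / u) q) \<le> 2 * r / (1 - r)" by (intro norm_lam_le[OF q2 _ r])
    have 3: "norm ((u + 1) / (2 * (u - 1))) \<le> M"
    proof (cases "c' = 0")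
      case True
      thus ?thesis by (simp add: M_def u_def)
    next
      case False
      hence \<theta>0: "\<theta> > 0" using c' p by (simp add: \<theta>_def)
      have "norm u \<le> exp (- 2 * pi * \<theta>)" using t \<theta>0 mult_left_mono[of 1 "Im \<tau>" "2 * pi * \<theta>"] by (simp add: nu)
      hence "1 - exp (- 2 * pi * \<theta>) \<le> norm (u - 1)" using norm_triangle_ineq2[of 1 u] by (simp add: norm_minus_commute)
      moreover have "1 - exp (- 2 * pi * \<theta>) > 0" using \<theta>0 by simp
      moreover have "norm (u + 1) \<le> 2" using norm_triangle_ineq[of u 1] u1 by simp
      ultimately have "norm (u + 1) / norm (u - 1) \<le> 2 / (1 - exp (- 2 * pi * \<theta>))" by (intro frac_le) auto
      moreover have "norm ((u + 1) / (2 * (u - 1))) = norm (u + 1) / norm (u - 1) / 2"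
        by (simp only: norm_divide norm_mult norm_numeral divide_divide_eq_left mult.commute)
      moreover have "M = 2 / (1 - exp (- 2 * pi * \<theta>)) / 2" 
      proof -
        have "1 / x = 2 / x / 2" for x :: real by simp
        thus ?thesis using False unfolding M_def by presburger
      qed
      ultimately show ?thesis by (metis divide_right_mono zero_le_numeral)
    qed
    have "eis p c' d \<tau> = (u + 1) / (2 * (u - 1)) - lam u q + lam (1 / u) q + of_int c' / of_nat p"
      using t by (simp add: eis_def kap_def u_def q_def)
    also have "norm \<dots> \<le> norm ((u + 1) / (2 * (u - 1))) + norm (lam u q) + norm (lam (1 / u) q) + norm (of_int c' / of_nat p :: complex)"
      by (intro order_trans[OF norm_triangle_ineq] add_mono order_trans[OF norm_triangle_ineq4] order_refl)
    finally show ?thesis using 1 2 3 by linarith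
  qed
  thus ?thesis unfolding e bounded_at_i_infinity_def by blast
qed

lemma eis_modular:
  assumes p: "p > 0" and adm: "admissible p 0 d"
  shows "eis p 0 d \<in> modular_forms 1 (Gamma1 p)"
  unfolding modular_forms_def
proof (intro CollectI conjI allI ballI impI)
  show "eis p 0 d \<tau> = 0" if "\<tau> \<notin> upper_half_plane" for \<tau> using that by (simp add: eis_def uhp_iff)
  show "eis p 0 d holomorphic_on upper_half_plane" by (rule eis_holomorphic[OF p adm])
  show "slash 1 (eis p 0 d) \<gamma> = eis p 0 d" if "\<gamma> \<in> Gamma1 p" for \<gamma>
  proof -
    have g: "\<gamma> \<in> SL2Z" "[\<gamma>$2$1 = 0] (mod int p)" "[\<gamma>$2$2 = 1] (mod int p)" using that by (auto simp: Gamma1_def)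
    have "[d * \<gamma>$2$1 = d * 0] (mod int p)" "[d * \<gamma>$2$2 = d * 1] (mod int p)"
      by (intro cong_mult cong_refl g)+
    hence "eis p (d * \<gamma>$2$1) (d * \<gamma>$2$2) = eis p 0 d" by (intro eis_cong[OF p adm]) simp_all
    thus ?thesis using eis_slash[OF p adm g(1)] by simp
  qed
  show "bounded_at_i_infinity (slash 1 (eis p 0 d) \<gamma>)" if "\<gamma> \<in> SL2Z" for \<gamma>
    unfolding eis_slash[OF p adm that] by (rule eis_bounded[OF p admissible_mult[OF that adm]])
qed

lemma modular_forms_subspace: "cfun.subspace (modular_forms k G)"
proof (rule cfun.subspaceI)
  show "0 \<in> modular_forms k G"
    by (auto simp: modular_forms_def slash_def fun_eq_iff bounded_at_i_infinity_def zero_fun_def intro: holomorphic_on_const)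
  show "f + g \<in> modular_forms k G" if f: "f \<in> modular_forms k G" and g: "g \<in> modular_forms k G" for f g
  proof -
    have e: "f + g = (\<lambda>\<tau>. f \<tau> + g \<tau>)" by (rule ext) (simp add: plus_fun_def)
    have "bounded_at_i_infinity (\<lambda>\<tau>. slash k f \<gamma> \<tau> + slash k g \<gamma> \<tau>)" if sl: "\<gamma> \<in> SL2Z" for \<gamma>
    proof -
      obtain B Y B' Y' where "\<And>\<tau>. Im \<tau> > Y \<Longrightarrow> norm (slash k f \<gamma> \<tau>) \<le> B" "\<And>\<tau>. Im \<tau> > Y' \<Longrightarrow> norm (slash k g \<gamma> \<tau>) \<le> B'"
        using f g sl unfolding modular_forms_def bounded_at_i_infinity_def by blast
      hence "\<forall>\<tau>. Im \<tau> > max Y Y' \<longrightarrow> norm (slash k f \<gamma> \<tau> + slash k g \<gamma> \<tau>) \<le> B + B'"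
        by (auto intro!: order_trans[OF norm_triangle_ineq] add_mono)
      thus ?thesis unfolding bounded_at_i_infinity_def by blast
    qed
    thus ?thesis using f g unfolding e by (auto simp: modular_forms_def slash_add intro: holomorphic_on_add)
  qed
  show "cscale c f \<in> modular_forms k G" if f: "f \<in> modular_forms k G" for c f
  proof -
    have "bounded_at_i_infinity (\<lambda>\<tau>. c * slash k f \<gamma> \<tau>)" if sl: "\<gamma> \<in> SL2Z" for \<gamma>
    proof -
      obtain B Y where "\<And>\<tau>. Im \<tau> > Y \<Longrightarrow> norm (slash k f \<gamma> \<tau>) \<le> B"
        using f sl unfolding modular_forms_def bounded_at_i_infinity_def by blast
      hence "\<forall>\<tau>. Im \<tau> > Y \<longrightarrow> norm (c * slash k f \<gamma> \<tau>) \<le> norm c * B"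
        by (auto simp: norm_mult intro!: mult_left_mono)
      thus ?thesis unfolding bounded_at_i_infinity_def by blast
    qed
    thus ?thesis using f unfolding cscale_def by (auto simp: modular_forms_def slash_cmult intro!: holomorphic_intros)
  qed
qed

section \<open>Finite Fourier transforms of division values\<close>

definition odd_periodic :: "nat \<Rightarrow> (int \<Rightarrow> complex) \<Rightarrow> bool" where
  "odd_periodic p \<phi> \<longleftrightarrow> (\<forall>m n. [m = n] (mod int p) \<longrightarrow> \<phi> m = \<phi> n) \<and> (\<forall>n. \<phi> (- n) = - \<phi> n)"

lemma odd_periodicD:
  assumes "odd_periodic p \<phi>"
  shows "[m = n] (mod int p) \<Longrightarrow> \<phi> m = \<phi> n" "\<phi> (- n) = - \<phi> n"
  using assms unfolding odd_periodic_def by blast+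

lemma odd_periodic_0: "odd_periodic p \<phi> \<Longrightarrow> [n = 0] (mod int p) \<Longrightarrow> \<phi> n = 0"
  using odd_periodicD(1)[of p \<phi> n 0] odd_periodicD(2)[of p \<phi> 0] by simp

text \<open>Multiplication by a unit permutes the residues mod \<open>p\<close>; the unit
  \<open>- 1\<close> gives the symmetry arguments for odd functions.\<close>

lemma sum_dilate:
  fixes h :: "int \<Rightarrow> complex"
  assumes p: "p > 0" and h: "\<And>m n. [m = n] (mod int p) \<Longrightarrow> h m = h n" and k: "coprime k (int p)"
  shows "(\<Sum>a<p. h (int a * k)) = (\<Sum>a<p. h (int a))"
proof -
  define f where "f = (\<lambda>a. nat ((int a * k) mod int p))"
  have f: "int (f a) = (int a * k) mod int p" for a using p by (simp add: f_def)
  have inj: "inj_on f {..<p}"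
  proof (rule inj_onI)
    fix a b assume ab: "a \<in> {..<p}" "b \<in> {..<p}" "f a = f b"
    hence "[int a * k = int b * k] (mod int p)" unfolding cong_def by (metis f)
    hence "[int a = int b] (mod int p)" using k by (metis cong_mult_rcancel)
    thus "a = b" using ab by (simp add: cong_def)
  qed
  have "f ` {..<p} \<subseteq> {..<p}" using f p by (auto simp: f_def nat_less_iff)
  hence "bij_betw f {..<p} {..<p}" using inj by (simp add: bij_betw_def card_subset_eq card_image)
  hence "(\<Sum>a<p. h (int a)) = (\<Sum>a<p. h (int (f a)))" by (rule sum.reindex_bij_betw[symmetric])
  also have "\<dots> = (\<Sum>a<p. h (int a * k))" by (intro sum.cong refl h) (simp add: f cong_def)
  finally show ?thesis ..
qed

section \<open>Additive characters and Fourier inversion mod p\<close>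

definition add_char :: "nat \<Rightarrow> int \<Rightarrow> complex" where
  "add_char p x = qvar (of_int x / of_nat p)"

lemma add_char_add: "add_char p (x + y) = add_char p x * add_char p y"
  by (simp add: add_char_def qvar_add add_divide_distrib)

lemma add_char_0 [simp]: "add_char p 0 = 1"
  by (simp add: add_char_def qvar_def)

lemma add_char_power: "add_char p x ^ n = add_char p (int n * x)"
  by (induction n) (simp_all add: add_char_add distrib_right)

lemma add_char_eq_1_iff: "p > 0 \<Longrightarrow> add_char p x = 1 \<longleftrightarrow> int p dvd x"
proof -
  assume p: "p > 0"
  have "add_char p x = 1 \<longleftrightarrow> (\<exists>n. of_int x = (of_int (int p * n) :: complex))"
    using p by (simp add: add_char_def qvar_eq_1_iff field_simps)
  thus ?thesis unfolding of_int_eq_iff dvd_def .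
qed

lemma add_char_cong: "p > 0 \<Longrightarrow> [x = y] (mod int p) \<Longrightarrow> add_char p x = add_char p y"
proof -
  assume p: "p > 0" and "[x = y] (mod int p)"
  hence "int p dvd (x - y)" by (simp add: cong_iff_dvd_diff)
  hence "add_char p (x - y) = 1" using p by (simp add: add_char_eq_1_iff)
  thus ?thesis using add_char_add[of p "x - y" y] by simp
qed

lemma norm_add_char: "norm (add_char p x) = 1"
  by (simp add: add_char_def norm_qvar)

lemma sum_add_char:
  assumes p: "p > 0"
  shows "(\<Sum>d<p. add_char p (int d * x)) = (if int p dvd x then of_nat p else 0)"
proof (cases "int p dvd x")
  case True
  hence "add_char p (int d * x) = 1" for d using p by (simp add: add_char_eq_1_iff)
  thus ?thesis using True by simp
next
  case False
  hence "add_char p x \<noteq> 1" using p by (simp add: add_char_eq_1_iff)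
  hence "(\<Sum>d<p. add_char p x ^ d) = (add_char p x ^ p - 1) / (add_char p x - 1)"
    by (rule geometric_sum)
  also have "add_char p x ^ p = 1" using p by (simp add: add_char_power add_char_eq_1_iff)
  finally show ?thesis using False by (simp add: add_char_power)
qed

definition fourier :: "nat \<Rightarrow> (int \<Rightarrow> complex) \<Rightarrow> int \<Rightarrow> complex" where
  "fourier p \<phi> d = (\<Sum>a<p. \<phi> (int a) * add_char p (- (int a * d))) / of_nat p"

lemma fourier_cong:
  assumes "p > 0" "[d = d'] (mod int p)"
  shows "fourier p \<phi> d = fourier p \<phi> d'"
proof -
  have "add_char p (- (int a * d)) = add_char p (- (int a * d'))" for a
    using assms(2) by (intro add_char_cong[OF assms(1)]) (simp add: cong_minus_minus_iff cong_mult)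
  thus ?thesis by (simp add: fourier_def)
qed

lemma fourier_dilate:
  assumes p: "p > 0" and \<phi>: "\<And>m n. [m = n] (mod int p) \<Longrightarrow> \<phi> m = \<phi> n" and k: "coprime k (int p)"
  shows "fourier p (\<lambda>n. \<phi> (n * k)) (d * k) = fourier p \<phi> (d :: int)"
proof -
  have "(\<Sum>a<p. \<phi> (int a * k) * add_char p (- (int a * k * d))) = (\<Sum>a<p. \<phi> (int a) * add_char p (- (int a * d)))"
  proof (rule sum_dilate[OF p _ k, where h = "\<lambda>x. \<phi> x * add_char p (- (x * d))"])
    fix m n assume "[m = n] (mod int p)"
    moreover from this have "add_char p (- (m * d)) = add_char p (- (n * d))"
      by (intro add_char_cong[OF p]) (simp add: cong_minus_minus_iff cong_mult)
    ultimately show "\<phi> m * add_char p (- (m * d)) = \<phi> n * add_char p (- (n * d))" using \<phi> by simp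
  qed
  thus ?thesis by (simp add: fourier_def mult.assoc mult.commute[of d])
qed

lemma fourier_uminus:
  assumes p: "p > 0" and \<phi>: "odd_periodic p \<phi>"
  shows "fourier p \<phi> (- d) = - fourier p \<phi> d"
proof -
  have "fourier p (\<lambda>n. \<phi> (n * - 1)) (d * - 1) = fourier p \<phi> d"
    by (rule fourier_dilate[OF p odd_periodicD(1)[OF \<phi>]]) simp_all
  moreover have "fourier p (\<lambda>n. \<phi> (n * - 1)) (d * - 1) = - fourier p \<phi> (- d)"
    by (simp add: fourier_def sum_negf odd_periodicD(2)[OF \<phi>])
  ultimately have "- fourier p \<phi> (- d) = fourier p \<phi> d" by (simp only:)
  thus ?thesis by (simp flip: \<open>- fourier p \<phi> (- d) = fourier p \<phi> d\<close>)
qed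

lemma fourier_0:
  assumes p: "p > 0" and \<phi>: "odd_periodic p \<phi>" and "[d = 0] (mod int p)"
  shows "fourier p \<phi> d = 0"
  using fourier_uminus[OF p \<phi>, of 0] fourier_cong[OF p assms(3)] by simp

lemma fourier_inversion:
  assumes p: "p > 0" and \<phi>: "\<And>m n. [m = n] (mod int p) \<Longrightarrow> \<phi> m = \<phi> n"
  shows "(\<Sum>d<p. fourier p \<phi> (int d) * add_char p (int d * n)) = \<phi> n"
proof -
  define n0 where "n0 = nat (n mod int p)"
  have n0: "int n0 = n mod int p" "n0 < p" using p by (simp_all add: n0_def nat_less_iff)
  have dv: "int p dvd n - int a \<longleftrightarrow> a = n0" if "a < p" for a
  proof -
    have "int p dvd n - int a \<longleftrightarrow> int a = n mod int p"
      using that by (simp add: mod_eq_dvd_iff[symmetric] eq_commute)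
    thus ?thesis using n0(1) by linarith
  qed
  have "(\<Sum>d<p. fourier p \<phi> (int d) * add_char p (int d * n)) =
     (\<Sum>d<p. \<Sum>a<p. \<phi> (int a) / of_nat p * add_char p (int d * (n - int a)))"
    unfolding fourier_def sum_divide_distrib sum_distrib_right
  proof (intro sum.cong refl)
    fix d a
    have "add_char p (int d * (n - int a)) = add_char p (- (int a * int d)) * add_char p (int d * n)"
      unfolding add_char_add[symmetric] by (simp add: algebra_simps)
    thus "\<phi> (int a) * add_char p (- (int a * int d)) / of_nat p * add_char p (int d * n) =
      \<phi> (int a) / of_nat p * add_char p (int d * (n - int a))" by simp
  qed
  also have "\<dots> = (\<Sum>a<p. \<phi> (int a) / of_nat p * (\<Sum>d<p. add_char p (int d * (n - int a))))"
    by (subst sum.swap) (simp add: sum_distrib_left)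
  also have "\<dots> = (\<Sum>a<p. if a = n0 then \<phi> (int a) else 0)"
    unfolding sum_add_char[OF p] using p by (intro sum.cong refl) (auto simp: dv)
  also have "\<dots> = \<phi> (int n0)" using n0(2) by simp
  also have "\<dots> = \<phi> n" by (rule \<phi>) (simp add: n0(1) cong_def)
  finally show ?thesis .
qed

lemma sum_index_geometric:
  fixes w :: complex
  assumes "w ^ n = 1" "w \<noteq> 1"
  shows "(\<Sum>a<n. of_nat a * w ^ a) = of_nat n / (w - 1)"
proof -
  have "(w - 1) * (\<Sum>a<n. of_nat a * w ^ a) = of_nat n * w ^ n - w * (\<Sum>a<n. w ^ a)" for n
    by (induction n) (simp_all add: algebra_simps)
  moreover have "(\<Sum>a<n. w ^ a) = 0" using geometric_sum[OF assms(2), of n] assms(1) by simp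
  ultimately have "(w - 1) * (\<Sum>a<n. of_nat a * w ^ a) = of_nat n" using assms(1) by simp
  thus ?thesis using assms(2) by (simp add: field_simps)
qed

text \<open>Half of the L-value at 0, written as a first moment; it turns out to be the constant
  term of \<open>eis_comb\<close>.\<close>

definition eis_const :: "nat \<Rightarrow> (int \<Rightarrow> complex) \<Rightarrow> complex" where
  "eis_const p \<phi> = - (\<Sum>a<p. of_nat a * \<phi> (int a)) / (2 * of_nat p)"

text \<open>At \<open>d = 0\<close> the value of \<open>eis\<close> is junk; for odd \<open>\<phi>\<close> its coefficient vanishes.\<close>

definition eis_comb :: "nat \<Rightarrow> (int \<Rightarrow> complex) \<Rightarrow> complex \<Rightarrow> complex" where
  "eis_comb p \<phi> \<tau> = - (1 / 2) * (\<Sum>d<p. fourier p \<phi> (int d) * eis p 0 (int d) \<tau>)"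

text \<open>Inserting Fourier inversion into the first moment leaves geometric sums equal to
  \<open>p / (w - 1)\<close>, that is, \<open>p\<close> times the rational part of
  \<open>kap\<close> minus \<open>p / 2\<close>. The subtracted halves add up to a multiple of
  \<open>\<phi> 0 = 0\<close>.\<close>

lemma eis_comb_const:
  assumes p: "p > 0" and \<phi>: "odd_periodic p \<phi>"
  shows "- (1 / 2) * (\<Sum>d<p. fourier p \<phi> (int d) * ((add_char p (int d) + 1) / (2 * (add_char p (int d) - 1)))) = eis_const p \<phi>"
proof -
  let ?b = "\<lambda>d. fourier p \<phi> (int d)" and ?w = "\<lambda>d. add_char p (int d)"
  note inv = fourier_inversion[where \<phi> = \<phi>, OF p odd_periodicD(1)[OF \<phi>]]
  have b0: "fourier p \<phi> 0 = 0" using fourier_0[OF p \<phi>, of 0] by simp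
  have sb: "(\<Sum>d<p. ?b d) = 0"
    using inv[of 0] odd_periodic_0[OF \<phi>, of 0] by simp
  have "(\<Sum>a<p. of_nat a * \<phi> (int a)) = (\<Sum>a<p. \<Sum>d<p. of_nat a * (?b d * add_char p (int d * int a)))"
    by (simp add: inv sum_distrib_left[symmetric])
  also have "\<dots> = (\<Sum>d<p. ?b d * (\<Sum>a<p. of_nat a * ?w d ^ a))"
    by (subst sum.swap) (simp add: sum_distrib_left add_char_power mult_ac)
  also have "\<dots> = (\<Sum>d<p. ?b d * (of_nat p / (?w d - 1)))"
  proof (intro sum.cong refl)
    fix d assume d: "d \<in> {..<p}"
    show "?b d * (\<Sum>a<p. of_nat a * ?w d ^ a) = ?b d * (of_nat p / (?w d - 1))"
    proof (cases "d = 0")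
      case False
      hence "?w d \<noteq> 1" using d p by (auto simp: add_char_eq_1_iff dest!: dvd_imp_le)
      moreover have "?w d ^ p = 1" using p by (simp add: add_char_power add_char_eq_1_iff)
      ultimately show ?thesis by (simp add: sum_index_geometric)
    qed (simp add: b0)
  qed
  also have "\<dots> = (\<Sum>d<p. of_nat p * (?b d * ((?w d + 1) / (2 * (?w d - 1))) - ?b d / 2))"
  proof (intro sum.cong refl)
    fix d assume d: "d \<in> {..<p}"
    show "?b d * (of_nat p / (?w d - 1)) = of_nat p * (?b d * ((?w d + 1) / (2 * (?w d - 1))) - ?b d / 2)"
    proof (cases "d = 0")
      case False
      hence "?w d \<noteq> 1" using d p by (auto simp: add_char_eq_1_iff dest!: dvd_imp_le)
      hence nz: "?w d - 1 \<noteq> 0" by simp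
      have "1 / x = (x + 2) / (2 * x) - 1 / 2" if "x \<noteq> 0" for x :: complex using that by (simp add: field_simps)
      from this[OF nz] have e: "1 / (?w d - 1) = (?w d + 1) / (2 * (?w d - 1)) - 1 / 2" by simp
      have "?b d * (of_nat p / (?w d - 1)) = of_nat p * (?b d * (1 / (?w d - 1)))" by simp
      thus ?thesis unfolding e by (simp add: right_diff_distrib)
    qed (simp add: b0)
  qed
  also have "\<dots> = of_nat p * (\<Sum>d<p. ?b d * ((?w d + 1) / (2 * (?w d - 1))))"
    unfolding sum_distrib_left[symmetric] sum_subtractf sum_divide_distrib[symmetric] sb by simp
  finally show ?thesis using p unfolding eis_const_def by simp
qed

text \<open>Passing from \<open>d\<close> to \<open>- d\<close> exchanges the two \<open>lam\<close>
  terms. As the transform is odd, they contribute equally, which the factor \<open>- 1/2\<close> of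
  \<open>eis_comb\<close> cancels; Fourier inversion then restores \<open>\<phi>\<close> inside the
  series.\<close>

theorem eis_comb_expansion:
  assumes p: "p > 0" and \<phi>: "odd_periodic p \<phi>" and t: "Im \<tau> > 0"
  shows "eis_comb p \<phi> \<tau> = eis_const p \<phi> + (\<Sum>n. \<phi> (int (Suc n)) * (qvar \<tau> ^ Suc n / (1 - qvar \<tau> ^ Suc n)))"
proof -
  let ?b = "\<lambda>d. fourier p \<phi> d" and ?w = "\<lambda>d. add_char p d"
  note inv = fourier_inversion[where \<phi> = \<phi>, OF p odd_periodicD(1)[OF \<phi>]]
  define q where "q = qvar \<tau>"
  have q: "norm q < 1" unfolding q_def by (rule norm_qvar_less_1[OF t])
  have e: "eis p 0 (int d) \<tau> = (?w (int d) + 1) / (2 * (?w (int d) - 1)) - lam (?w (int d)) q + lam (?w (int d * - 1)) q" for d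
    using t by (simp add: eis_def kap_def add_char_def q_def qvar_uminus)
  have "(\<Sum>d<p. ?b (int d * - 1) * lam (?w (int d * - 1)) q) = (\<Sum>d<p. ?b (int d) * lam (?w (int d)) q)"
    by (rule sum_dilate[OF p, where h = "\<lambda>d. ?b d * lam (?w d) q"])
       (simp_all add: fourier_cong[OF p, of _ _ \<phi>] add_char_cong[OF p] cong: fourier_cong)
  hence neg: "(\<Sum>d<p. ?b (int d) * lam (?w (int d * - 1)) q) = - (\<Sum>d<p. ?b (int d) * lam (?w (int d)) q)"
    using fourier_uminus[OF p \<phi>] by (simp add: sum_negf minus_equation_iff)
  have "(\<lambda>m. \<Sum>d<p. ?b (int d) * (?w (int d) ^ Suc m * (q ^ Suc m / (1 - q ^ Suc m)))) sums (\<Sum>d<p. ?b (int d) * lam (?w (int d)) q)"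
    by (intro sums_sum sums_mult lam_eq_lambert q norm_add_char)
  also have "(\<lambda>m. \<Sum>d<p. ?b (int d) * (?w (int d) ^ Suc m * (q ^ Suc m / (1 - q ^ Suc m)))) =
      (\<lambda>m. \<phi> (int (Suc m)) * (q ^ Suc m / (1 - q ^ Suc m)))"
  proof
    fix m
    have "(\<Sum>d<p. ?b (int d) * (?w (int d) ^ Suc m * (q ^ Suc m / (1 - q ^ Suc m)))) =
       (\<Sum>d<p. ?b (int d) * ?w (int d * int (Suc m))) * (q ^ Suc m / (1 - q ^ Suc m))"
      unfolding add_char_power sum_distrib_right by (intro sum.cong refl) (simp only: mult_ac)
    thus "(\<Sum>d<p. ?b (int d) * (?w (int d) ^ Suc m * (q ^ Suc m / (1 - q ^ Suc m)))) = \<phi> (int (Suc m)) * (q ^ Suc m / (1 - q ^ Suc m))"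
      by (simp only: inv[of "int (Suc m)"])
  qed
  finally have L: "(\<Sum>n. \<phi> (int (Suc n)) * (q ^ Suc n / (1 - q ^ Suc n))) = (\<Sum>d<p. ?b (int d) * lam (?w (int d)) q)"
    by (rule sums_unique[symmetric])
  have "eis_comb p \<phi> \<tau> = - (1 / 2) * ((\<Sum>d<p. ?b (int d) * ((?w (int d) + 1) / (2 * (?w (int d) - 1))))
      - (\<Sum>d<p. ?b (int d) * lam (?w (int d)) q) + (\<Sum>d<p. ?b (int d) * lam (?w (int d * - 1)) q))"
    unfolding eis_comb_def e by (simp only: distrib_left right_diff_distrib sum.distrib sum_subtractf)
  also have "\<dots> = - (1 / 2) * (\<Sum>d<p. ?b (int d) * ((?w (int d) + 1) / (2 * (?w (int d) - 1))))
      + (\<Sum>d<p. ?b (int d) * lam (?w (int d)) q)"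
    unfolding neg by (simp add: algebra_simps)
  finally show ?thesis unfolding eis_comb_const[OF p \<phi>] L[symmetric] by (simp only: q_def)
qed

lemma eis_comb_outside: "\<not> Im \<tau> > 0 \<Longrightarrow> eis_comb p \<phi> \<tau> = 0"
  by (simp add: eis_comb_def eis_def)

lemma sum_fun_apply: "(\<Sum>i\<in>I. f i) x = (\<Sum>i\<in>I. f i x :: complex)"
  by (induction I rule: infinite_finite_induct) auto

lemma eis_comb_sum:
  "eis_comb p (\<lambda>n. \<Sum>i\<in>I. c i * \<phi> i n) \<tau> = (\<Sum>i\<in>I. c i * eis_comb p (\<phi> i) \<tau>)"
proof -
  have f: "fourier p (\<lambda>n. \<Sum>i\<in>I. c i * \<phi> i n) d = (\<Sum>i\<in>I. c i * fourier p (\<phi> i) d)" for d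
    unfolding fourier_def sum_distrib_right sum_divide_distrib sum_distrib_left
    by (subst sum.swap) (simp add: mult_ac)
  show ?thesis unfolding eis_comb_def f sum_distrib_right sum_distrib_left
    by (subst sum.swap) (simp add: mult_ac)
qed

lemma admissible_0_iff: "admissible p 0 d \<longleftrightarrow> \<not> int p dvd d"
  by (simp add: admissible_def)

text \<open>The matrix sends the division point with index \<open>d\<close> to that with index
  \<open>d a\<close>; resummation over \<open>d a\<close> moves the dilation from the points to
  \<open>\<phi>\<close>.\<close>

theorem eis_comb_slash:
  assumes p: "p > 0" and \<phi>: "odd_periodic p \<phi>" and g: "\<gamma> \<in> SL2Z"
    and g21: "[\<gamma>$2$1 = 0] (mod int p)" and g22: "[\<gamma>$2$2 = a] (mod int p)" and a: "coprime a (int p)"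
  shows "slash 1 (eis_comb p \<phi>) \<gamma> = eis_comb p (\<lambda>n. \<phi> (n * a))"
proof
  fix \<tau>
  have \<phi>a: "odd_periodic p (\<lambda>n. \<phi> (n * a))"
    unfolding odd_periodic_def
  proof (intro conjI allI impI)
    show "\<phi> (m * a) = \<phi> (n * a)" if "[m = n] (mod int p)" for m n
      by (rule odd_periodicD(1)[OF \<phi> cong_mult[OF that cong_refl]])
    show "\<phi> (- n * a) = - \<phi> (n * a)" for n
      using odd_periodicD(2)[OF \<phi>, of "n * a"] by simp
  qed
  have fd: "fourier p (\<lambda>n. \<phi> (n * a)) (d * a) = fourier p \<phi> d" for d
    by (rule fourier_dilate[OF p odd_periodicD(1)[OF \<phi>] a])
  have t1: "fourier p \<phi> (int d) * slash 1 (eis p 0 (int d)) \<gamma> \<tau> =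
      fourier p (\<lambda>n. \<phi> (n * a)) (int d * a) * eis p 0 (int d * a) \<tau>" for d
  proof (cases "int p dvd int d")
    case True
    thus ?thesis using fourier_0[OF p \<phi>, of "int d"] by (simp add: fd cong_0_iff)
  next
    case False
    hence adm: "admissible p 0 (int d)" by (simp add: admissible_0_iff)
    have "\<not> int p dvd int d * a" using False a by (simp add: coprime_commute coprime_dvd_mult_left_iff)
    hence "admissible p 0 (int d * a)" by (simp add: admissible_0_iff)
    moreover have "[int d * \<gamma>$2$1 = int d * 0] (mod int p)" "[int d * \<gamma>$2$2 = int d * a] (mod int p)"
      by (intro cong_mult cong_refl g21 g22)+
    ultimately have "eis p (int d * \<gamma>$2$1) (int d * \<gamma>$2$2) = eis p 0 (int d * a)"
      by (intro eis_cong[OF p]) simp_all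
    thus ?thesis using eis_slash[OF p adm g] by (simp add: fd)
  qed
  have "slash 1 (eis_comb p \<phi>) \<gamma> \<tau> = - (1 / 2) * (\<Sum>d<p. fourier p \<phi> (int d) * slash 1 (eis p 0 (int d)) \<gamma> \<tau>)"
  proof (cases "Im \<tau> > 0")
    case True
    show ?thesis unfolding slash_eq[OF True] eis_comb_def sum_distrib_left by (simp only: mult_ac)
  qed (simp add: slash_outside)
  also have "(\<Sum>d<p. fourier p \<phi> (int d) * slash 1 (eis p 0 (int d)) \<gamma> \<tau>) =
      (\<Sum>d<p. fourier p (\<lambda>n. \<phi> (n * a)) (int d) * eis p 0 (int d) \<tau>)"
    unfolding t1
  proof (rule sum_dilate[OF p _ a, where h = "\<lambda>d. fourier p (\<lambda>n. \<phi> (n * a)) d * eis p 0 d \<tau>"])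
    fix m n assume mn: "[m = n] (mod int p)"
    show "fourier p (\<lambda>n. \<phi> (n * a)) m * eis p 0 m \<tau> = fourier p (\<lambda>n. \<phi> (n * a)) n * eis p 0 n \<tau>"
    proof (cases "int p dvd n")
      case True
      hence "[n = 0] (mod int p)" "[m = 0] (mod int p)" using mn by (simp_all add: cong_0_iff cong_dvd_iff)
      thus ?thesis using fourier_0[OF p \<phi>a] by simp
    next
      case False
      hence "eis p 0 m = eis p 0 n" using mn by (intro eis_cong[OF p]) (simp_all add: admissible_0_iff)
      thus ?thesis using fourier_cong[OF p mn] by simp
    qed
  qed
  finally show "slash 1 (eis_comb p \<phi>) \<gamma> \<tau> = eis_comb p (\<lambda>n. \<phi> (n * a)) \<tau>" by (simp only: eis_comb_def[of p "\<lambda>n. \<phi> (n * a)"])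
qed

theorem eis_comb_modular:
  assumes p: "p > 0" and \<phi>: "odd_periodic p \<phi>"
  shows "eis_comb p \<phi> \<in> modular_forms 1 (Gamma1 p)"
proof -
  let ?M = "modular_forms 1 (Gamma1 p)"
  have "cscale (fourier p \<phi> (int d)) (eis p 0 (int d)) \<in> ?M" for d
  proof (cases "int p dvd int d")
    case True
    hence "cscale (fourier p \<phi> (int d)) (eis p 0 (int d)) = 0"
      using fourier_0[OF p \<phi>, of "int d"] by (simp add: cong_0_iff cscale_def zero_fun_def)
    thus ?thesis using cfun.subspace_0[OF modular_forms_subspace] by (simp only:)
  next
    case False
    thus ?thesis using eis_modular[OF p] by (intro cfun.subspace_scale[OF modular_forms_subspace]) (simp add: admissible_0_iff)
  qed
  hence "cscale (- (1 / 2)) (\<Sum>d<p. cscale (fourier p \<phi> (int d)) (eis p 0 (int d))) \<in> ?M"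
    by (rule cfun.subspace_scale[OF modular_forms_subspace cfun.subspace_sum[OF modular_forms_subspace]])
  moreover have "cscale (- (1 / 2)) (\<Sum>d<p. cscale (fourier p \<phi> (int d)) (eis p 0 (int d))) = eis_comb p \<phi>"
    by (rule ext) (simp add: cscale_def sum_fun_apply eis_comb_def)
  ultimately show ?thesis by simp
qed

section \<open>Odd characters modulo a prime\<close>

lemma dirichlet_characterD:
  assumes "dirichlet_character p \<psi>"
  shows "\<psi> (m * n) = \<psi> m * \<psi> n" "[m = n] (mod int p) \<Longrightarrow> \<psi> m = \<psi> n" "\<psi> n \<noteq> 0 \<longleftrightarrow> coprime n (int p)" "\<psi> 1 = 1"
proof -
  show mult: "\<psi> (m * n) = \<psi> m * \<psi> n" for m n using assms unfolding dirichlet_character_def by blast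
  show "[m = n] (mod int p) \<Longrightarrow> \<psi> m = \<psi> n" using assms unfolding dirichlet_character_def by blast
  show nz: "\<psi> n \<noteq> 0 \<longleftrightarrow> coprime n (int p)" for n using assms unfolding dirichlet_character_def by blast
  show "\<psi> 1 = 1" using mult[of 1 1] nz[of 1] by simp
qed

lemma dirichlet_character_power: "dirichlet_character p \<psi> \<Longrightarrow> \<psi> (n ^ k) = \<psi> n ^ k"
  by (induction k) (simp_all add: dirichlet_characterD)

text \<open>The only proper divisor of a prime is 1, and a character mod 1 takes the same value at 1
  and at \<open>- 1\<close>, so oddness forces primitivity.\<close>

lemma odd_primitive_characters_iff:
  assumes p: "prime p"
  shows "\<psi> \<in> odd_primitive_characters p \<longleftrightarrow> dirichlet_character p \<psi> \<and> \<psi> (- 1) = - 1"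
proof
  assume "dirichlet_character p \<psi> \<and> \<psi> (- 1) = - 1"
  hence \<psi>: "dirichlet_character p \<psi>" "\<psi> (- 1) = - 1" by blast+
  have "\<not> (\<exists>\<phi>. dirichlet_character d \<phi> \<and> (\<forall>n. coprime n (int p) \<longrightarrow> \<psi> n = \<phi> n))" if d: "d dvd p" "d < p" for d
  proof
    assume "\<exists>\<phi>. dirichlet_character d \<phi> \<and> (\<forall>n. coprime n (int p) \<longrightarrow> \<psi> n = \<phi> n)"
    then obtain \<phi> where \<phi>: "dirichlet_character d \<phi>" "\<And>n. coprime n (int p) \<Longrightarrow> \<psi> n = \<phi> n" by blast
    have "d = 1" using d p by (auto simp: prime_nat_iff)
    hence "\<phi> (- 1) = \<phi> 1" by (intro dirichlet_characterD(2)[OF \<phi>(1)]) (simp add: cong_def)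
    hence "\<psi> (- 1) = \<psi> 1" using \<phi>(2)[of "- 1"] \<phi>(2)[of 1] by simp
    thus False using \<psi>(2) dirichlet_characterD(4)[OF \<psi>(1)] by simp
  qed
  thus "\<psi> \<in> odd_primitive_characters p" using \<psi>
    unfolding odd_primitive_characters_def primitive_character_def by blast
qed (simp add: odd_primitive_characters_def primitive_character_def)

lemma odd_character_odd_periodic:
  assumes p: "prime p" and \<psi>: "\<psi> \<in> odd_primitive_characters p"
  shows "odd_periodic p \<psi>"
  unfolding odd_periodic_def
proof (intro conjI allI impI)
  have d: "dirichlet_character p \<psi>" "\<psi> (- 1) = - 1" using \<psi> odd_primitive_characters_iff[OF p] by blast+
  show "[m = n] (mod int p) \<Longrightarrow> \<psi> m = \<psi> n" for m n by (rule dirichlet_characterD(2)[OF d(1)])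
  show "\<psi> (- n) = - \<psi> n" for n using dirichlet_characterD(1)[OF d(1), of "- 1" n] d(2) by simp
qed

locale primitive_root =
  fixes p g m :: nat
  assumes p: "prime p" and pm: "p = 2 * m + 1" and g: "residue_primroot p g"
begin

lemma m_pos: "m > 0" using p pm prime_gt_1_nat[OF p] by linarith

lemma coprime_g: "coprime p g" using g by (simp add: residue_primroot_def)

lemma g_pow_cong_iff: "[int g ^ i = int g ^ j] (mod int p) \<longleftrightarrow> [i = j] (mod 2 * m)"
proof -
  have o: "ord p g = 2 * m" using g p pm by (simp add: residue_primroot_def totient_prime)
  have "[int g ^ i = int g ^ j] (mod int p) \<longleftrightarrow> [g ^ i = g ^ j] (mod p)"
    by (metis cong_int_iff of_nat_power)
  thus ?thesis using order_divides_expdiff[OF coprime_g] o by simp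
qed

lemma g_generates:
  assumes "coprime n (int p)"
  obtains i where "i < 2 * m" "[n = int g ^ i] (mod int p)"
proof -
  have p1: "p > 1" by (rule prime_gt_1_nat[OF p])
  define r where "r = nat (n mod int p)"
  have r: "int r = n mod int p" using p1 by (simp add: r_def)
  have "coprime (int r) (int p)" unfolding r using assms p1 by (simp add: coprime_mod_left_iff)
  hence "coprime r p" by simp
  moreover have "r < p" using r p1 by (simp add: r_def nat_less_iff)
  ultimately have "r \<in> totatives p" using p1 by (auto simp: totatives_def intro!: Nat.gr0I)
  then obtain i where i: "i < totient p" "r = g ^ i mod p"
    using residue_primroot_is_generator[OF p1 g] unfolding bij_betw_def by auto
  have "int r = int g ^ i mod int p" by (simp add: i zmod_int)
  hence "[n = int g ^ i] (mod int p)" using r by (simp add: cong_def)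
  thus ?thesis using that i(1) p pm by (simp add: totient_prime)
qed

lemma g_pow_m: "[int g ^ m = - 1] (mod int p)"
proof -
  have "[int g ^ (2 * m) = int g ^ 0] (mod int p)" by (simp only: g_pow_cong_iff) (simp add: cong_def)
  hence "int p dvd (int g ^ m)\<^sup>2 - 1" by (simp add: cong_iff_dvd_diff power_mult[symmetric] mult.commute)
  also have "(int g ^ m)\<^sup>2 - 1 = (int g ^ m - 1) * (int g ^ m + 1)" by (simp add: power2_eq_square algebra_simps)
  finally have "int p dvd int g ^ m - 1 \<or> int p dvd int g ^ m + 1"
    using p by (simp add: prime_dvd_mult_iff)
  moreover have "\<not> int p dvd int g ^ m - 1"
  proof
    assume "int p dvd int g ^ m - 1"
    hence "[int g ^ m = int g ^ 0] (mod int p)" by (simp add: cong_iff_dvd_diff)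
    hence "[m = 0] (mod 2 * m)" by (simp only: g_pow_cong_iff)
    thus False using m_pos by (simp add: cong_def)
  qed
  ultimately show ?thesis by (simp add: cong_iff_dvd_diff)
qed

definition "roots = {w :: complex. w ^ m = - 1}"

lemma roots_power_cong:
  assumes "w \<in> roots" "[i = j] (mod 2 * m)"
  shows "w ^ i = w ^ j"
proof -
  have 1: "w ^ (2 * m) = 1" using assms(1) by (simp add: roots_def power_mult mult.commute[of 2])
  have "w ^ i = w ^ (i mod (2 * m))" for i
    using 1 by (metis mod_mult_div_eq mult.right_neutral power_add power_mult power_one)
  thus ?thesis using assms(2) unfolding cong_def by metis
qed

text \<open>A character mod \<open>p\<close> is determined by its value at the primitive root, and
  \<open>g^m = - 1\<close> mod \<open>p\<close> turns oddness into \<open>w^m = - 1\<close>.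
  Conversely, \<open>w\<close> to the discrete logarithm is well defined because
  \<open>w^(2 m) = 1\<close>.\<close>

lemma eval_bij: "bij_betw (\<lambda>\<psi>. \<psi> (int g)) (odd_primitive_characters p) roots"
proof (rule bij_betw_imageI)
  show "inj_on (\<lambda>\<psi>. \<psi> (int g)) (odd_primitive_characters p)"
  proof (rule inj_onI, rule ext)
    fix \<psi> \<psi>' n assume *: "\<psi> \<in> odd_primitive_characters p" "\<psi>' \<in> odd_primitive_characters p" "\<psi> (int g) = \<psi>' (int g)"
    hence d: "dirichlet_character p \<psi>" "dirichlet_character p \<psi>'" using odd_primitive_characters_iff[OF p] by blast+
    show "\<psi> n = \<psi>' n"
    proof (cases "coprime n (int p)")
      case True
      then obtain i where "[n = int g ^ i] (mod int p)" using g_generates by blast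
      hence "\<psi> n = \<psi> (int g) ^ i" "\<psi>' n = \<psi>' (int g) ^ i"
        using dirichlet_characterD(2)[OF d(1)] dirichlet_characterD(2)[OF d(2)]
          dirichlet_character_power[OF d(1)] dirichlet_character_power[OF d(2)] by metis+
      thus ?thesis using *(3) by simp
    next
      case False
      thus ?thesis using dirichlet_characterD(3)[OF d(1)] dirichlet_characterD(3)[OF d(2)] by metis
    qed
  qed
  show "(\<lambda>\<psi>. \<psi> (int g)) ` odd_primitive_characters p = roots"
  proof (intro equalityI subsetI)
    fix w assume "w \<in> (\<lambda>\<psi>. \<psi> (int g)) ` odd_primitive_characters p"
    then obtain \<psi> where w: "w = \<psi> (int g)" and "\<psi> \<in> odd_primitive_characters p" by blast
    hence d: "dirichlet_character p \<psi>" "\<psi> (- 1) = - 1" using odd_primitive_characters_iff[OF p] by blast+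
    have "w ^ m = \<psi> (- 1)" unfolding w dirichlet_character_power[OF d(1), symmetric]
      by (rule dirichlet_characterD(2)[OF d(1) g_pow_m])
    thus "w \<in> roots" using d by (simp add: roots_def)
  next
    fix w assume w: "w \<in> roots"
    define ind where "ind n = (SOME i. [n = int g ^ i] (mod int p))" for n
    have ind: "[n = int g ^ ind n] (mod int p)" if "coprime n (int p)" for n
      unfolding ind_def using g_generates[OF that] by (metis (mono_tags, lifting) someI_ex)
    have cop_pow: "coprime (int g ^ i) (int p)" for i
      using coprime_g by (simp add: coprime_commute)
    have ind_eq: "w ^ ind n = w ^ i" if "[n = int g ^ i] (mod int p)" for n i
    proof (rule roots_power_cong[OF w])
      have "coprime n (int p)" using cong_imp_coprime[OF cong_sym[OF that]] cop_pow by (simp add: coprime_commute)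
      from ind[OF this] that have "[int g ^ ind n = int g ^ i] (mod int p)" by (meson cong_sym cong_trans)
      thus "[ind n = i] (mod 2 * m)" by (simp only: g_pow_cong_iff)
    qed
    define \<psi> where "\<psi> n = (if coprime n (int p) then w ^ ind n else 0)" for n
    have "w \<noteq> 0" using w m_pos by (auto simp: roots_def power_0_left)
    have "dirichlet_character p \<psi>"
      unfolding dirichlet_character_def
    proof (intro conjI allI impI)
      fix a b
      show "\<psi> (a * b) = \<psi> a * \<psi> b"
      proof (cases "coprime a (int p) \<and> coprime b (int p)")
        case True
        have "[a * b = int g ^ (ind a + ind b)] (mod int p)"
          unfolding power_add using ind True by (intro cong_mult) auto
        from ind_eq[OF this] show ?thesis using True by (simp add: \<psi>_def power_add)
      qed (auto simp: \<psi>_def)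
    next
      fix a b assume ab: "[a = b] (mod int p)"
      show "\<psi> a = \<psi> b"
      proof (cases "coprime b (int p)")
        case True
        have "coprime a (int p)" using cong_imp_coprime[OF cong_sym[OF ab]] True by (simp add: coprime_commute)
        thus ?thesis using ind_eq[OF cong_trans[OF ab ind[OF True]]] True by (simp add: \<psi>_def)
      next
        case False
        hence "\<not> coprime a (int p)" using cong_imp_coprime[OF ab] by (auto simp: coprime_commute)
        thus ?thesis using False by (simp add: \<psi>_def)
      qed
    next
      fix n show "\<psi> n \<noteq> 0 \<longleftrightarrow> coprime n (int p)" using \<open>w \<noteq> 0\<close> by (simp add: \<psi>_def)
    qed
    moreover have "\<psi> (- 1) = - 1" using ind_eq[OF cong_sym[OF g_pow_m]] w by (simp add: \<psi>_def roots_def)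
    moreover have "\<psi> (int g) = w" using ind_eq[of "int g" 1] coprime_g by (simp add: \<psi>_def coprime_commute)
    ultimately show "w \<in> (\<lambda>\<psi>. \<psi> (int g)) ` odd_primitive_characters p"
      using odd_primitive_characters_iff[OF p] by blast
  qed
qed

lemma card_roots: "finite roots" "card roots = m"
  using card_nth_roots[of "- 1 :: complex" m] m_pos finite_nth_roots[of m "- 1"] by (simp_all add: roots_def)

lemma sum_roots:
  assumes "k < 2 * m"
  shows "(\<Sum>w\<in>roots. w ^ k) = of_nat m * (if k = 0 then 1 else if k = m then - 1 else 0)"
proof -
  consider "k = 0" | "k = m" "k \<noteq> 0" | "k \<noteq> 0" "k \<noteq> m" by blast
  thus ?thesis
  proof cases
    case 2
    have "(\<Sum>w\<in>roots. w ^ k) = (\<Sum>w\<in>roots. - 1)" by (intro sum.cong) (auto simp: roots_def 2)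
    thus ?thesis using 2 by (simp add: card_roots)
  next
    case 3
    \<comment> \<open>Multiplication by a primitive \<open>m\<close>-th root of unity permutes
      \<open>roots\<close> and scales the sum by \<open>\<eta> ^ k\<close>, which is not 1 as
      \<open>k\<close> is not a multiple of \<open>m\<close>.\<close>
    define \<eta> where "\<eta> = qvar (1 / of_nat m)"
    have e1: "\<eta> ^ m = 1" using qvar_mult_power[of 0 "1 / of_nat m" m] m_pos qvar_of_int[of 1]
      by (simp add: \<eta>_def qvar_def)
    have "\<eta> ^ k \<noteq> 1"
    proof
      assume "\<eta> ^ k = 1"
      hence "qvar (of_nat k / of_nat m) = 1" using qvar_mult_power[of 0 "1 / of_nat m" k] by (simp add: \<eta>_def qvar_def)
      then obtain n where "of_nat k / of_nat m = (of_int n :: complex)" by (auto simp: qvar_eq_1_iff)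
      hence "of_int (int k) = (of_int (n * int m) :: complex)" using m_pos by (simp add: field_simps)
      hence n: "int k = n * int m" by (simp only: of_int_eq_iff)
      hence "n * int m < 2 * int m" "0 < n * int m" using assms 3 by linarith+
      hence "n = 1" using m_pos by (simp add: zero_less_mult_iff)
      thus False using n 3 by simp
    qed
    moreover have "(\<Sum>w\<in>roots. w ^ k) = \<eta> ^ k * (\<Sum>w\<in>roots. w ^ k)"
    proof -
      have "\<eta> \<noteq> 0" by (simp add: \<eta>_def)
      hence "bij_betw (\<lambda>w. \<eta> * w) roots roots"
        by (intro bij_betw_byWitness[where f' = "\<lambda>w. w / \<eta>"]) (auto simp: roots_def power_mult_distrib power_divide e1)
      from sum.reindex_bij_betw[OF this, of "\<lambda>w. w ^ k"] show ?thesis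
        by (simp add: power_mult_distrib sum_distrib_left)
    qed
    ultimately have "(\<Sum>w\<in>roots. w ^ k) = 0" by simp
    thus ?thesis using 3 by simp
  qed (simp add: card_roots)
qed

end

text \<open>The odd indicator of the class of 1. Up to a factor it is the character sum over the odd
  characters, and the unit for multiplicative convolution of odd functions.\<close>

definition delta :: "nat \<Rightarrow> int \<Rightarrow> complex" where
  "delta p t = (if [t = 1] (mod int p) then 1 else if [t = - 1] (mod int p) then - 1 else 0)"

lemma odd_characters_finite_sum:
  assumes p: "prime p" "p > 2" and t: "coprime t (int p)"
  shows "finite (odd_primitive_characters p)"
    and "(\<Sum>\<psi>\<in>odd_primitive_characters p. \<psi> t) = (of_nat p - 1) / 2 * delta p t"
proof -
  obtain g where g: "residue_primroot p g" using prime_primitive_root_exists[OF prime_gt_1_nat[OF p(1)]] p(1) by auto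
  have "odd p" using p prime_odd_nat by blast
  then obtain m where m: "p = 2 * m + 1" by (elim oddE)
  interpret primitive_root p g m by unfold_locales (fact p(1), fact m, fact g)
  show fin: "finite (odd_primitive_characters p)" using bij_betw_finite[OF eval_bij] card_roots by simp
  obtain i where i: "i < 2 * m" "[t = int g ^ i] (mod int p)" using g_generates[OF t] .
  have "(\<Sum>\<psi>\<in>odd_primitive_characters p. \<psi> t) = (\<Sum>\<psi>\<in>odd_primitive_characters p. \<psi> (int g) ^ i)"
  proof (intro sum.cong refl)
    fix \<psi> assume "\<psi> \<in> odd_primitive_characters p"
    hence d: "dirichlet_character p \<psi>" using odd_primitive_characters_iff[OF p(1)] by blast
    show "\<psi> t = \<psi> (int g) ^ i"
      using dirichlet_characterD(2)[OF d i(2)] dirichlet_character_power[OF d] by simp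
  qed
  also have "\<dots> = (\<Sum>w\<in>roots. w ^ i)" by (rule sum.reindex_bij_betw[OF eval_bij])
  also have "\<dots> = of_nat m * (if i = 0 then 1 else if i = m then - 1 else 0)" by (rule sum_roots[OF i(1)])
  also have "(if i = 0 then 1 else if i = m then - 1 else 0) = delta p t"
  proof -
    have "[t = 1] (mod int p) \<longleftrightarrow> [int g ^ i = int g ^ 0] (mod int p)"
      using i(2) by (metis cong_sym cong_trans power_0)
    also have "\<dots> \<longleftrightarrow> i = 0" unfolding g_pow_cong_iff using i(1) by (simp add: cong_def)
    finally have 1: "[t = 1] (mod int p) \<longleftrightarrow> i = 0" .
    have "[t = - 1] (mod int p) \<longleftrightarrow> [int g ^ i = int g ^ m] (mod int p)"
      using i(2) g_pow_m by (meson cong_sym cong_trans)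
    also have "\<dots> \<longleftrightarrow> i = m" unfolding g_pow_cong_iff using i(1) m_pos by (simp add: cong_def)
    finally show ?thesis unfolding delta_def 1 by simp
  qed
  finally show "(\<Sum>\<psi>\<in>odd_primitive_characters p. \<psi> t) = (of_nat p - 1) / 2 * delta p t" by (simp add: m)
qed

section \<open>Inverting the partial zeta values\<close>

definition small_primes :: "nat list" where
  "small_primes = [5, 7, 11, 13, 17, 19]"

text \<open>The table lists at \<open>1, \<dots>, (p - 1)/2\<close> the odd function \<open>T\<close> mod \<open>p\<close> for which the sum of
  \<open>T(x y) (1/2 - y/p)\<close> over \<open>y\<close> is \<open>\<plusminus> 2\<close> for \<open>x \<equiv> \<plusminus> 1\<close> and \<open>0\<close> otherwise. Then \<open>T(n)\<close> is the sum of
  \<open>4 \<chi>(n) / ((p - 1) L(0,\<chi>))\<close> over the odd characters.\<close>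

definition char_table :: "nat \<Rightarrow> int list" where
  "char_table p =
    (if p = 5 then [3, 1]
     else if p = 7 then [2, 1, 1]
     else if p = 11 then [1, 1, 1, 0, 1]
     else if p = 13 then [1, 0, 1, 1, 1, 0]
     else if p = 17 then [0, 1, 1, 0, 1, 0, 1, 0]
     else if p = 19 then [0, 0, 1, 1, 1, 0, 1, 0, 0]
     else [])"

definition tab :: "nat \<Rightarrow> int \<Rightarrow> int" where
  "tab p x = (let r = nat (x mod int p) in
     if r = 0 then 0 else if 2 * r < p then char_table p ! (r - 1) else - (char_table p ! (p - r - 1)))"

text \<open>The relation that characterises the table, multiplied by \<open>2 p\<close> to stay in
  the integers: the weight \<open>1/2 - y/p\<close> becomes \<open>p - 2 y\<close>, and the value 2
  becomes \<open>4 p\<close>.\<close>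

definition tab_check :: "nat \<Rightarrow> bool" where
  "tab_check p \<longleftrightarrow> list_all (\<lambda>x. (\<Sum>y\<leftarrow>[0..<p]. tab p (int x * int y) * (int p - 2 * int y)) =
     4 * int p * (if x = 1 then 1 else if x = p - 1 then - 1 else 0)) [0..<p]"

lemma tab_check_small_primes: "list_all tab_check small_primes"
  by code_simp

text \<open>Executable integer model of the \<open>q\<close>-expansion of the translate by
  \<open>a\<close>; \<open>q_coeff_eq\<close> ties it to \<open>delta\<close> and the divisor
  sums.\<close>

definition q_coeff :: "nat \<Rightarrow> int \<Rightarrow> nat \<Rightarrow> int" where
  "q_coeff p a n = (if n = 0 then (if a mod int p = 1 then 1 else if a mod int p = int p - 1 then - 1 else 0)
     else (\<Sum>d\<leftarrow>filter (\<lambda>d. d dvd n) [1..<Suc n]. tab p (int d * a)))"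

text \<open>The search for the leading index ends at 5; the evaluation below confirms that this
  covers all the listed classes.\<close>

definition leading_check :: "nat \<Rightarrow> bool" where
  "leading_check p \<longleftrightarrow> length (chosen_classes p) = (p - 1) div 2 \<and> list_all (\<lambda>a. a mod int p \<noteq> 0 \<and>
     list_ex (\<lambda>n. q_coeff p a n = 1 \<and> list_all (\<lambda>i. q_coeff p a i = 0) [0..<n]) [0..<6]) (chosen_classes p)"

lemma leading_check_small_primes: "list_all leading_check small_primes"
  by code_simp

lemma prime_between_5_19:
  assumes "prime (p :: nat)" "5 \<le> p" "p \<le> 19"
  shows "p \<in> set small_primes"
proof -
  have n2: "\<not> 2 dvd p" and n3: "\<not> 3 dvd p" using assms by (auto simp: prime_nat_iff)
  have "list_all (\<lambda>p. 2 dvd p \<or> 3 dvd p \<or> p \<in> set small_primes) [5..<20]" by code_simp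
  hence "\<forall>p\<in>set [5..<20]. 2 dvd p \<or> 3 dvd p \<or> p \<in> set small_primes" by (simp only: list_all_iff)
  moreover have "p \<in> set [5..<20]" unfolding set_upt atLeastLessThan_iff using assms(2,3) by linarith
  ultimately show ?thesis using n2 n3 by blast
qed

section \<open>The Eisenstein series and its diamond translates\<close>

lemma small_primesD:
  assumes "p \<in> set small_primes"
  shows "prime p" "p > 2" "odd p" "p \<le> 19"
proof -
  have "prime (5::nat) \<and> prime (7::nat) \<and> prime (11::nat) \<and> prime (13::nat) \<and> prime (17::nat) \<and> prime (19::nat)" by simp
  thus "prime p" "p > 2" "odd p" "p \<le> 19" using assms by (auto simp: small_primes_def)
qed

lemma coprime_prime_iff:
  assumes "prime p"
  shows "coprime a (int p) \<longleftrightarrow> \<not> int p dvd a"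
proof -
  have pi: "prime (int p)" using assms by simp
  show ?thesis
  proof
    assume "coprime a (int p)"
    thus "\<not> int p dvd a" using pi by (meson coprime_common_divisor dvd_refl not_prime_unit)
  next
    assume "\<not> int p dvd a"
    from prime_imp_coprime[OF pi this] show "coprime a (int p)" by (simp only: coprime_commute)
  qed
qed

lemma cong_minus_1_iff:
  assumes "d < p" "p > 2"
  shows "[int d = - 1] (mod int p) \<longleftrightarrow> d = p - 1"
proof -
  have "[int d = - 1] (mod int p) \<longleftrightarrow> int p dvd int (Suc d)"
    by (simp add: cong_iff_dvd_diff add.commute)
  also have "\<dots> \<longleftrightarrow> p dvd Suc d" by (simp only: int_dvd_int_iff)
  also have "\<dots> \<longleftrightarrow> d = p - 1" using assms by (auto dest: dvd_imp_le)
  finally show ?thesis .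
qed

section \<open>The table and \<open>delta\<close> as odd functions mod p\<close>

lemma tab_cong: "[m = n] (mod int p) \<Longrightarrow> tab p m = tab p n"
  by (simp add: tab_def cong_def)

lemma tab_odd:
  assumes "odd p"
  shows "tab p (- x) = - tab p x"
proof (cases "x mod int p = 0")
  case True
  thus ?thesis by (simp add: tab_def zmod_zminus1_eq_if)
next
  case False
  have p: "p > 0" using assms odd_pos by blast
  define r where "r = nat (x mod int p)"
  have r: "x mod int p = int r" "0 < r" "r < p" using p False by (auto simp: r_def nat_less_iff intro: order.not_eq_order_implies_strict)
  have "(- x) mod int p = int (p - r)" using r False by (simp add: zmod_zminus1_eq_if of_nat_diff)
  hence "nat ((- x) mod int p) = p - r" by simp
  moreover have "2 * (p - r) < p \<longleftrightarrow> \<not> 2 * r < p" using assms r(2,3) by presburger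
  moreover have "p - (p - r) - 1 = r - 1" using r by simp
  ultimately show ?thesis using r by (simp add: tab_def)
qed

lemma tab_odd_periodic:
  assumes "odd p"
  shows "odd_periodic p (\<lambda>n. of_int (tab p (n * a)))"
  unfolding odd_periodic_def
proof (intro conjI allI impI)
  show "of_int (tab p (m * a)) = (of_int (tab p (n * a)) :: complex)" if "[m = n] (mod int p)" for m n
    using tab_cong[OF cong_mult[OF that cong_refl[of a]]] by simp
  show "of_int (tab p (- n * a)) = - (of_int (tab p (n * a)) :: complex)" for n
    using tab_odd[OF assms, of "n * a"] by simp
qed

lemma odd_periodic_sum:
  assumes p: "p > 0" and \<phi>: "odd_periodic p \<phi>"
  shows "(\<Sum>a<p. \<phi> (int a)) = 0"
proof -
  have "(\<Sum>a<p. \<phi> (int a * - 1)) = (\<Sum>a<p. \<phi> (int a))"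
    by (rule sum_dilate[OF p odd_periodicD(1)[OF \<phi>]]) simp_all
  thus ?thesis by (simp add: odd_periodicD(2)[OF \<phi>] sum_negf)
qed

lemma delta_cong: "[s = t] (mod int p) \<Longrightarrow> delta p s = delta p t"
  unfolding delta_def cong_def by simp

lemma cong_1_minus_1:
  assumes "p > 2" "[t = 1] (mod int p)"
  shows "\<not> [t = - 1] (mod int p)"
proof
  assume "[t = - 1] (mod int p)"
  hence "[1 = - 1] (mod int p)" using assms(2) by (meson cong_sym cong_trans)
  hence "int p dvd 2" by (simp add: cong_iff_dvd_diff)
  thus False using assms(1) zdvd_imp_le[of "int p" 2] by simp
qed

lemma delta_odd_periodic:
  assumes p: "p > 2"
  shows "odd_periodic p (delta p)"
  unfolding odd_periodic_def
proof (intro conjI allI impI)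
  show "delta p (- t) = - delta p t" for t
  proof -
    have "[- t = 1] (mod int p) \<longleftrightarrow> [t = - 1] (mod int p)" "[- t = - 1] (mod int p) \<longleftrightarrow> [t = 1] (mod int p)"
      using cong_minus_minus_iff[of t "- 1" "int p"] cong_minus_minus_iff[of t 1 "int p"] by simp_all
    thus ?thesis using cong_1_minus_1[OF p] by (auto simp: delta_def)
  qed
qed (rule delta_cong)

lemma delta_sum:
  assumes p: "p > 2" and z: "odd_periodic p z"
  shows "(\<Sum>d<p. z (int d) * delta p (int d)) = 2 * z 1"
proof -
  have 1: "[int d = 1] (mod int p) \<longleftrightarrow> d = 1" if "d < p" for d
    using that p by (simp add: cong_def)
  note 2 = cong_minus_1_iff[OF _ p]
  have "(\<Sum>d<p. z (int d) * delta p (int d)) = (\<Sum>d\<in>{1, p - 1}. z (int d) * delta p (int d))"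
    using p by (intro sum.mono_neutral_right) (auto simp: delta_def 1 2)
  also have "\<dots> = z 1 * delta p 1 + z (int (p - 1)) * delta p (int (p - 1))" using p by simp
  also have "delta p (int (p - 1)) = - 1" using p 1[of "p - 1"] 2[of "p - 1"] by (simp add: delta_def)
  also have "delta p 1 = 1" by (simp add: delta_def)
  also have "z (int (p - 1)) = z (- 1)"
    using p by (intro odd_periodicD(1)[OF z]) (simp add: cong_iff_dvd_diff of_nat_diff)
  finally show ?thesis using odd_periodicD(2)[OF z, of 1] by simp
qed

text \<open>The sum is supported at the classes of \<open>b\<close> and \<open>- b\<close>, which
  contribute equally by oddness.\<close>

lemma delta_sum_dilate:
  assumes p: "p > 2" and z: "odd_periodic p z" and a: "[a * b = 1] (mod int p)"
  shows "(\<Sum>d<p. z (int d) * delta p (int d * a)) = 2 * z b"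
proof -
  have cb: "coprime b (int p)" using a by (metis cong_imp_coprime cong_sym coprime_1_left coprime_mult_left_iff)
  have zb: "odd_periodic p (\<lambda>n. z (n * b))"
    unfolding odd_periodic_def
  proof (intro conjI allI impI)
    show "z (m * b) = z (n * b)" if "[m = n] (mod int p)" for m n
      by (rule odd_periodicD(1)[OF z cong_mult[OF that cong_refl]])
    show "z (- n * b) = - z (n * b)" for n using odd_periodicD(2)[OF z, of "n * b"] by simp
  qed
  have "(\<Sum>d<p. z (int d) * delta p (int d * a)) = (\<Sum>d<p. z (int d * b) * delta p (int d * b * a))"
  proof (rule sum_dilate[symmetric, where h = "\<lambda>x. z x * delta p (x * a)", OF _ _ cb])
    fix m n assume mn: "[m = n] (mod int p)"
    show "z m * delta p (m * a) = z n * delta p (n * a)"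
      using odd_periodicD(1)[OF z mn] delta_cong[OF cong_mult[OF mn cong_refl[of a]]] by simp
  qed (use p in simp)
  also have "\<dots> = (\<Sum>d<p. z (int d * b) * delta p (int d))"
  proof (intro sum.cong refl arg_cong2[where f = "(*)"] delta_cong)
    fix d
    have "[int d * (a * b) = int d * 1] (mod int p)" by (intro cong_mult cong_refl a)
    thus "[int d * b * a = int d] (mod int p)" by (simp add: mult_ac)
  qed
  also have "\<dots> = 2 * z b" using delta_sum[OF p zb] by simp
  finally show ?thesis .
qed

lemma tab_identity:
  assumes p: "p \<in> set small_primes"
  shows "(\<Sum>y<p. of_int (tab p (int y * x)) * (of_nat p - 2 * of_nat y)) = 4 * of_nat p * delta p x"
proof -
  note pD = small_primesD[OF p]
  define x0 where "x0 = nat (x mod int p)"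
  have x0: "int x0 = x mod int p" "x0 < p" using pD by (simp_all add: x0_def nat_less_iff)
  have cx: "[int x0 = x] (mod int p)" by (simp add: x0(1) cong_def)
  have "tab_check p" using tab_check_small_primes p by (simp add: list_all_iff)
  hence "(\<Sum>y\<leftarrow>[0..<p]. tab p (int x0 * int y) * (int p - 2 * int y)) =
     4 * int p * (if x0 = 1 then 1 else if x0 = p - 1 then - 1 else 0)"
    using x0(2) by (simp add: tab_check_def list_all_iff)
  also have "(\<Sum>y\<leftarrow>[0..<p]. tab p (int x0 * int y) * (int p - 2 * int y)) =
     (\<Sum>y<p. tab p (int x0 * int y) * (int p - 2 * int y))"
    by (simp add: interv_sum_list_conv_sum_set_nat atLeast0LessThan)
  also have "\<dots> = (\<Sum>y<p. tab p (int y * x) * (int p - 2 * int y))"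
    by (intro sum.cong refl arg_cong2[where f = "(*)"] tab_cong)
       (metis cong_mult cong_refl cx mult.commute)
  finally have "of_int (\<Sum>y<p. tab p (int y * x) * (int p - 2 * int y)) =
     (of_int (4 * int p * (if x0 = 1 then 1 else if x0 = p - 1 then - 1 else 0)) :: complex)" by (rule arg_cong)
  moreover have "of_int (if x0 = 1 then 1 else if x0 = p - 1 then - 1 else 0) = delta p x"
  proof -
    have "[int x0 = 1] (mod int p) \<longleftrightarrow> x0 = 1" using x0(2) pD by (simp add: cong_def)
    moreover have "[int x0 = - 1] (mod int p) \<longleftrightarrow> x0 = p - 1" by (rule cong_minus_1_iff[OF x0(2) pD(2)])
    moreover have "delta p x = delta p (int x0)" by (rule delta_cong[OF cong_sym[OF cx]])
    ultimately show ?thesis by (simp add: delta_def[of p "int x0"])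
  qed
  ultimately show ?thesis by simp
qed

text \<open>Oddness kills the part of the table relation without the factor \<open>y\<close>, and
  the rest is the first moment in \<open>eis_const\<close>. The table is normalised to make this
  constant term exactly \<open>delta\<close>.\<close>

lemma eis_const_tab:
  assumes p: "p \<in> set small_primes"
  shows "eis_const p (\<lambda>n. of_int (tab p (n * a))) = delta p a"
proof -
  note pD = small_primesD[OF p]
  let ?S = "\<Sum>y<p. of_nat y * (of_int (tab p (int y * a)) :: complex)"
  have "(\<Sum>y<p. of_int (tab p (int y * a)) * (of_nat p - 2 * of_nat y)) =
     (\<Sum>y<p. of_int (tab p (int y * a))) * of_nat p - (2 * ?S :: complex)"
    unfolding sum_distrib_right sum_distrib_left sum_subtractf[symmetric] by (intro sum.cong refl) (simp add: algebra_simps)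
  also have "(\<Sum>y<p. of_int (tab p (int y * a))) = (0 :: complex)"
    using odd_periodic_sum[OF _ tab_odd_periodic[OF pD(3)], of a] pD by simp
  finally have "4 * of_nat p * delta p a = - (2 * ?S)" unfolding tab_identity[OF p] by simp
  moreover have "- S / (2 * P) = D" if "4 * P * D = - (2 * S)" "P \<noteq> 0" for S P D :: complex
  proof -
    have "2 * (2 * P * D) = 4 * P * D" by simp
    also have "\<dots> = 2 * (- S)" unfolding that(1) by simp
    finally have "- S = 2 * P * D" by (simp only: mult_cancel_left) simp
    thus ?thesis using that(2) by simp
  qed
  ultimately show ?thesis using pD unfolding eis_const_def by simp
qed

lemma dirichlet_L_odd:
  assumes p: "prime p" and \<psi>: "\<psi> \<in> odd_primitive_characters p"
  shows "dirichlet_L \<psi> 0 = 2 * eis_const p \<psi>"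
proof -
  have p0: "p > 0" by (rule prime_gt_0_nat[OF p])
  note o = odd_character_odd_periodic[OF p \<psi>]
  have z: "\<psi> 0 = 0" "\<psi> (int p) = 0" by (rule odd_periodic_0[OF o]; simp add: cong_def)+
  have shift: "(\<Sum>k=1..n. f k) + f 0 = (\<Sum>k<n. f k) + f n" for n and f :: "nat \<Rightarrow> complex"
    by (induction n) (simp_all add: add_ac)
  have per: "\<psi> (n + int p) = \<psi> n" for n by (rule odd_periodicD(1)[OF o]) (simp add: cong_def)
  have "(\<Sum>k=1..p. \<psi> (int k)) = 0" using shift[of "\<lambda>k. \<psi> (int k)" p] z odd_periodic_sum[OF p0 o] by simp
  from dirichlet_L_0[OF p0 per this]
  have "dirichlet_L \<psi> 0 = - (\<Sum>k=1..p. of_nat k * \<psi> (int k)) / of_nat p" .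
  also have "(\<Sum>k=1..p. of_nat k * \<psi> (int k)) = (\<Sum>k<p. of_nat k * \<psi> (int k))"
    using shift[of "\<lambda>k. of_nat k * \<psi> (int k)" p] z by simp
  finally show ?thesis by (simp add: eis_const_def)
qed

lemma delta_inverse:
  assumes "[z * z' = 1] (mod int p)"
  shows "delta p z' = delta p z"
proof -
  have *: "[b = c] (mod int p)" if "[a * b = 1] (mod int p)" "[a = c] (mod int p)" "c * c = 1" for a b c
  proof -
    have "[c * (a * b) = c * 1] (mod int p)" by (intro cong_mult cong_refl that)
    moreover have "[c * a * b = c * c * b] (mod int p)" by (intro cong_mult cong_refl that)
    ultimately show ?thesis using that(3) by (metis cong_sym cong_trans mult.assoc mult_1 mult_1_right)
  qed
  have a': "[z' * z = 1] (mod int p)" using assms by (simp add: mult.commute)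
  have "[z' = 1] (mod int p) \<longleftrightarrow> [z = 1] (mod int p)" "[z' = - 1] (mod int p) \<longleftrightarrow> [z = - 1] (mod int p)"
    using *[OF assms] *[OF a'] by auto
  thus ?thesis by (simp add: delta_def)
qed

lemma sum_inverse_characters:
  assumes p: "prime p" "p > 2"
  shows "(\<Sum>\<psi>\<in>odd_primitive_characters p. inverse (\<psi> z)) = (of_nat p - 1) / 2 * delta p z"
proof (cases "coprime z (int p)")
  case True
  then obtain z' where z': "[z * z' = 1] (mod int p)" using cong_solve_coprime_int by blast
  have cz': "coprime z' (int p)" using z' by (metis cong_imp_coprime cong_sym coprime_1_left coprime_mult_left_iff)
  have "(\<Sum>\<psi>\<in>odd_primitive_characters p. inverse (\<psi> z)) = (\<Sum>\<psi>\<in>odd_primitive_characters p. \<psi> z')"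
  proof (intro sum.cong refl)
    fix \<psi> assume "\<psi> \<in> odd_primitive_characters p"
    hence d: "dirichlet_character p \<psi>" using odd_primitive_characters_iff[OF p(1)] by blast
    have "\<psi> z * \<psi> z' = 1" using dirichlet_characterD(2)[OF d z'] dirichlet_characterD(1,4)[OF d] by simp
    thus "inverse (\<psi> z) = \<psi> z'" by (rule inverse_unique)
  qed
  also have "\<dots> = (of_nat p - 1) / 2 * delta p z'" by (rule odd_characters_finite_sum(2)[OF p cz'])
  finally show ?thesis by (simp add: delta_inverse[OF z'])
next
  case False
  have "(\<Sum>\<psi>\<in>odd_primitive_characters p. inverse (\<psi> z)) = 0"
  proof (intro sum.neutral ballI)
    fix \<psi> assume "\<psi> \<in> odd_primitive_characters p"
    hence d: "dirichlet_character p \<psi>" using odd_primitive_characters_iff[OF p(1)] by blast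
    show "inverse (\<psi> z) = 0" using dirichlet_characterD(3)[OF d, of z] False by simp
  qed
  moreover have "delta p z = 0"
    using False cong_imp_coprime[of 1 z "int p"] cong_imp_coprime[of "- 1" z "int p"]
    by (auto simp: delta_def cong_sym_eq)
  ultimately show ?thesis by simp
qed

text \<open>Multiplicative Fourier coefficient of the table at \<open>\<psi>\<close>; it will be
  identified as \<open>4 / L(0, \<psi>)\<close>.\<close>

definition tab_transform :: "nat \<Rightarrow> (int \<Rightarrow> complex) \<Rightarrow> complex" where
  "tab_transform p \<psi> = (\<Sum>z<p. of_int (tab p (int z)) * inverse (\<psi> (int z)))"

lemma tab_transform_dilate:
  assumes p: "p > 0" and d: "dirichlet_character p \<psi>" and y: "coprime y (int p)"
  shows "tab_transform p \<psi> = (\<Sum>z<p. of_int (tab p (int z * y)) * inverse (\<psi> (int z * y)))"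
  unfolding tab_transform_def
proof (rule sum_dilate[OF p _ y, symmetric, where h = "\<lambda>z. of_int (tab p z) * inverse (\<psi> z)"])
  fix m n assume "[m = n] (mod int p)"
  thus "of_int (tab p m) * inverse (\<psi> m) = of_int (tab p n) * inverse (\<psi> n)"
    using tab_cong dirichlet_characterD(2)[OF d] by metis
qed

text \<open>The sum of \<open>tab p (x y) (p - 2 y) / \<psi> x\<close> over \<open>x\<close> and
  \<open>y\<close> is evaluated twice. Summing over \<open>y\<close> first gives \<open>8 p\<close>
  by the table relation; substituting \<open>x y\<close> for \<open>x\<close> factors it into the
  transform of the table and a first moment of \<open>\<psi>\<close>.\<close>

lemma tab_transform_L:
  assumes p: "p \<in> set small_primes" and \<psi>: "\<psi> \<in> odd_primitive_characters p"
  shows "tab_transform p \<psi> * dirichlet_L \<psi> 0 = 4"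
proof -
  note pD = small_primesD[OF p]
  have p0: "p > 0" using pD by simp
  have d: "dirichlet_character p \<psi>" "\<psi> (- 1) = - 1" using odd_primitive_characters_iff[OF pD(1)] \<psi> by blast+
  note o = odd_character_odd_periodic[OF pD(1) \<psi>]
  have oi: "odd_periodic p (\<lambda>z. inverse (\<psi> z))"
    unfolding odd_periodic_def
  proof (intro conjI allI impI)
    show "inverse (\<psi> m) = inverse (\<psi> n)" if "[m = n] (mod int p)" for m n using odd_periodicD(1)[OF o that] by simp
    show "inverse (\<psi> (- n)) = - inverse (\<psi> n)" for n by (simp add: odd_periodicD(2)[OF o])
  qed
  let ?w = "\<lambda>y. of_nat p - 2 * of_nat y :: complex"
  have "(\<Sum>x<p. inverse (\<psi> (int x)) * (\<Sum>y<p. of_int (tab p (int y * int x)) * ?w y))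
      = 4 * of_nat p * (\<Sum>x<p. inverse (\<psi> (int x)) * delta p (int x))"
    unfolding tab_identity[OF p] sum_distrib_left by (simp add: mult_ac)
  also have "\<dots> = 8 * of_nat p"
    unfolding delta_sum[OF pD(2) oi] using dirichlet_characterD(4)[OF d(1)] by simp
  finally have S1: "(\<Sum>x<p. inverse (\<psi> (int x)) * (\<Sum>y<p. of_int (tab p (int y * int x)) * ?w y)) = 8 * of_nat p" .
  have inner: "(\<Sum>x<p. of_int (tab p (int x * int y)) * inverse (\<psi> (int x))) = \<psi> (int y) * tab_transform p \<psi>" if "y < p" for y
  proof (cases "y = 0")
    case True
    have "tab p 0 = 0" by (simp add: tab_def)
    thus ?thesis using True odd_periodic_0[OF o, of 0] by simp
  next
    case False
    have "\<not> int p dvd int y" using that False by (simp add: nat_dvd_not_less)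
    hence cy: "coprime (int y) (int p)" using coprime_prime_iff[OF pD(1)] by blast
    hence nz: "\<psi> (int y) \<noteq> 0" using dirichlet_characterD(3)[OF d(1)] by simp
    show ?thesis unfolding tab_transform_dilate[OF p0 d(1) cy] sum_distrib_left
      using nz by (intro sum.cong refl) (simp add: dirichlet_characterD(1)[OF d(1)])
  qed
  have "(\<Sum>x<p. inverse (\<psi> (int x)) * (\<Sum>y<p. of_int (tab p (int y * int x)) * ?w y)) =
     (\<Sum>y<p. ?w y * (\<Sum>x<p. of_int (tab p (int x * int y)) * inverse (\<psi> (int x))))"
    unfolding sum_distrib_left by (subst sum.swap) (simp add: mult_ac)
  also have "\<dots> = (\<Sum>y<p. ?w y * (\<psi> (int y) * tab_transform p \<psi>))"
    by (intro sum.cong refl) (simp add: inner)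
  also have "\<dots> = tab_transform p \<psi> * (of_nat p * (\<Sum>y<p. \<psi> (int y)) - 2 * (\<Sum>y<p. of_nat y * \<psi> (int y)))"
    unfolding sum_distrib_left sum_subtractf[symmetric] by (intro sum.cong refl) (simp add: algebra_simps)
  also have "\<dots> = tab_transform p \<psi> * (2 * of_nat p * dirichlet_L \<psi> 0)"
    unfolding dirichlet_L_odd[OF pD(1) \<psi>] eis_const_def odd_periodic_sum[OF p0 o] using p0 by simp
  finally have "tab_transform p \<psi> * (2 * of_nat p * dirichlet_L \<psi> 0) = 8 * of_nat p" using S1 by simp
  hence "(2 * of_nat p) * (tab_transform p \<psi> * dirichlet_L \<psi> 0) = (2 * of_nat p) * 4" by (simp add: algebra_simps)
  thus ?thesis using p0 by (simp add: mult.commute)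
qed

text \<open>Inversion of the multiplicative transform; the odd characters suffice because the table
  is odd.\<close>

lemma sum_tab_transform:
  assumes p: "p \<in> set small_primes"
  shows "(\<Sum>\<psi>\<in>odd_primitive_characters p. tab_transform p \<psi> * \<psi> x) = (of_nat p - 1) * of_int (tab p x)"
proof (cases "coprime x (int p)")
  case True
  note pD = small_primesD[OF p]
  have "(\<Sum>\<psi>\<in>odd_primitive_characters p. tab_transform p \<psi> * \<psi> x) =
    (\<Sum>\<psi>\<in>odd_primitive_characters p. \<Sum>z<p. of_int (tab p (int z * x)) * inverse (\<psi> (int z)))"
  proof (intro sum.cong refl)
    fix \<psi> assume "\<psi> \<in> odd_primitive_characters p"
    hence d: "dirichlet_character p \<psi>" using odd_primitive_characters_iff[OF pD(1)] by blast
    have nz: "\<psi> x \<noteq> 0" using dirichlet_characterD(3)[OF d] True by simp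
    have "tab_transform p \<psi> = (\<Sum>z<p. of_int (tab p (int z * x)) * inverse (\<psi> (int z * x)))"
      by (rule tab_transform_dilate[OF _ d True]) (use pD in simp)
    hence "tab_transform p \<psi> * \<psi> x = (\<Sum>z<p. of_int (tab p (int z * x)) * inverse (\<psi> (int z * x)) * \<psi> x)"
      by (simp only: sum_distrib_right)
    also have "\<dots> = (\<Sum>z<p. of_int (tab p (int z * x)) * inverse (\<psi> (int z)))"
      by (intro sum.cong refl) (use nz in \<open>simp add: dirichlet_characterD(1)[OF d]\<close>)
    finally show "tab_transform p \<psi> * \<psi> x = (\<Sum>z<p. of_int (tab p (int z * x)) * inverse (\<psi> (int z)))" .
  qed
  also have "\<dots> = (\<Sum>z<p. of_int (tab p (int z * x)) * (\<Sum>\<psi>\<in>odd_primitive_characters p. inverse (\<psi> (int z))))"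
    unfolding sum_distrib_left by (rule sum.swap)
  also have "\<dots> = (of_nat p - 1) / 2 * (\<Sum>z<p. of_int (tab p (int z * x)) * delta p (int z))"
    unfolding sum_inverse_characters[OF pD(1,2)] sum_distrib_left by (intro sum.cong refl) (simp only: mult_ac)
  also have "\<dots> = (of_nat p - 1) * of_int (tab p x)"
    unfolding delta_sum[OF pD(2) tab_odd_periodic[OF pD(3)]] by simp
  finally show ?thesis .
next
  case False
  note pD = small_primesD[OF p]
  have "int p dvd x" using False pD(1) by (simp add: coprime_prime_iff)
  hence "tab p x = 0" by (simp add: tab_def)
  moreover have "\<psi> x = 0" if "\<psi> \<in> odd_primitive_characters p" for \<psi>
    using that False odd_primitive_characters_iff[OF pD(1)] dirichlet_characterD(3)[of p \<psi> x] by blast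
  hence "(\<Sum>\<psi>\<in>odd_primitive_characters p. tab_transform p \<psi> * \<psi> x) = 0"
    by (intro sum.neutral ballI) simp
  ultimately show ?thesis by simp
qed

text \<open>\<open>eis_comb p \<psi>\<close> enters \<open>calE p\<close> with coefficient
  \<open>4 / ((p - 1) L(0, \<psi>))\<close>, which is
  \<open>tab_transform p \<psi> / (p - 1)\<close>. As \<open>eis_comb\<close> is linear in its
  function, the sum over characters collapses to the integer table.\<close>

theorem calE_eq:
  assumes p: "p \<in> set small_primes"
  shows "calE p = eis_comb p (\<lambda>n. of_int (tab p n))"
proof
  fix \<tau>
  note pD = small_primesD[OF p]
  let ?X = "odd_primitive_characters p"
  define c where "c = (\<lambda>\<psi>. tab_transform p \<psi> / (of_nat p - 1))"
  have p1: "of_nat p - 1 \<noteq> (0 :: complex)" using pD by (simp add: of_nat_diff[symmetric])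
  have e: "2 / (of_nat p - 1) * eisenstein1 \<psi> \<tau> = c \<psi> * eis_comb p \<psi> \<tau>" if \<psi>: "\<psi> \<in> ?X" for \<psi>
  proof (cases "Im \<tau> > 0")
    case True
    have L: "tab_transform p \<psi> * dirichlet_L \<psi> 0 = 4" by (rule tab_transform_L[OF p \<psi>])
    hence L0: "dirichlet_L \<psi> 0 \<noteq> 0" by auto
    have t: "tab_transform p \<psi> = 4 / dirichlet_L \<psi> 0" using L L0 by (simp add: field_simps)
    have "eis_comb p \<psi> \<tau> = dirichlet_L \<psi> 0 / 2 + (\<Sum>n. \<psi> (int (Suc n)) * (qvar \<tau> ^ Suc n / (1 - qvar \<tau> ^ Suc n)))"
      using eis_comb_expansion[OF _ odd_character_odd_periodic[OF pD(1) \<psi>] True] pD dirichlet_L_odd[OF pD(1) \<psi>] by simp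
    moreover have "eisenstein1 \<psi> \<tau> = 1 + 2 / dirichlet_L \<psi> 0 * (\<Sum>n. \<psi> (int (Suc n)) * (qvar \<tau> ^ Suc n / (1 - qvar \<tau> ^ Suc n)))"
      using True by (simp add: eisenstein1_def uhp_iff)
    ultimately have "eisenstein1 \<psi> \<tau> = 2 / dirichlet_L \<psi> 0 * eis_comb p \<psi> \<tau>"
      using L0 by (simp only: distrib_left) simp
    thus ?thesis by (simp add: c_def t)
  qed (simp add: eisenstein1_def uhp_iff eis_comb_outside)
  have "calE p \<tau> = (\<Sum>\<psi>\<in>?X. c \<psi> * eis_comb p \<psi> \<tau>)"
    unfolding calE_def sum_distrib_left by (intro sum.cong refl e)
  also have "\<dots> = eis_comb p (\<lambda>n. \<Sum>\<psi>\<in>?X. c \<psi> * \<psi> n) \<tau>" by (rule eis_comb_sum[symmetric])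
  also have "(\<lambda>n. \<Sum>\<psi>\<in>?X. c \<psi> * \<psi> n) = (\<lambda>n. of_int (tab p n))"
  proof
    fix n
    have "(\<Sum>\<psi>\<in>?X. c \<psi> * \<psi> n) = (\<Sum>\<psi>\<in>?X. tab_transform p \<psi> * \<psi> n) / (of_nat p - 1)"
      by (simp add: c_def sum_divide_distrib)
    thus "(\<Sum>\<psi>\<in>?X. c \<psi> * \<psi> n) = of_int (tab p n)" unfolding sum_tab_transform[OF p] using p1 by simp
  qed
  finally show "calE p \<tau> = eis_comb p (\<lambda>n. of_int (tab p n)) \<tau>" .
qed

lemma calE_slash:
  assumes p: "p \<in> set small_primes" and \<gamma>: "diamond_matrix p a \<gamma>"
  shows "slash 1 (calE p) \<gamma> = eis_comb p (\<lambda>n. of_int (tab p (n * a)))"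
proof -
  note pD = small_primesD[OF p]
  have g: "\<gamma> \<in> SL2Z" "[\<gamma>$2$1 = 0] (mod int p)" "[\<gamma>$2$2 = a] (mod int p)" using \<gamma> by (auto simp: diamond_matrix_def)
  have "admissible p 0 a" by (rule admissible_row[OF pD(1) g])
  hence "coprime a (int p)" using pD(1) by (simp add: admissible_0_iff coprime_prime_iff)
  from eis_comb_slash[OF _ tab_odd_periodic[OF pD(3), of 1] g this] pD show ?thesis
    unfolding calE_eq[OF p] by simp
qed

theorem diamond_calE:
  assumes p: "p \<in> set small_primes" and a: "coprime a (int p)"
  shows "diamond 1 p a (calE p) = eis_comb p (\<lambda>n. of_int (tab p (n * a)))"
proof -
  note pD = small_primesD[OF p]
  have "admissible p 0 a" using a pD(1) by (simp add: admissible_0_iff coprime_prime_iff)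
  from lift2_exists[OF pD(1) this] have "\<exists>\<gamma>. diamond_matrix p a \<gamma>" by (simp add: diamond_matrix_def)
  hence "diamond_matrix p a (SOME \<gamma>. diamond_matrix p a \<gamma>)" by (rule someI_ex)
  from calE_slash[OF p this] show ?thesis by (simp add: diamond_def)
qed

section \<open>The q-expansions of the diamond translates\<close>

lemma odd_periodic_bounded:
  assumes p: "p > 0" and \<phi>: "odd_periodic p \<phi>"
  obtains B where "\<And>n. norm (\<phi> n) \<le> B"
proof
  fix n
  define k where "k = nat (n mod int p)"
  have "\<phi> n = \<phi> (int k)" using p by (intro odd_periodicD(1)[OF \<phi>]) (simp add: k_def cong_def)
  moreover have "k \<in> {..<p}" using p by (simp add: k_def nat_less_iff)
  ultimately show "norm (\<phi> n) \<le> Max ((\<lambda>m. norm (\<phi> (int m))) ` {..<p})" by (auto intro!: Max_ge)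
qed

lemma eis_comb_q_expansion:
  assumes p: "p > 0" and \<phi>: "odd_periodic p \<phi>"
  shows "has_q_expansion (eis_comb p \<phi>) (Abs_fps (\<lambda>n. if n = 0 then eis_const p \<phi> else \<Sum>d | d dvd n. \<phi> (int d)))"
  unfolding has_q_expansion_def
proof
  fix \<tau> assume "\<tau> \<in> upper_half_plane"
  hence t: "Im \<tau> > 0" by (simp add: uhp_iff)
  obtain B where B: "\<And>n. norm (\<phi> n) \<le> B" using odd_periodic_bounded[OF p \<phi>] by blast
  let ?q = "qvar \<tau>" and ?S = "\<Sum>n. \<phi> (int (Suc n)) * (qvar \<tau> ^ Suc n / (1 - qvar \<tau> ^ Suc n))"
  have "(\<lambda>N. (if N = 0 then 0 else \<Sum>d | d dvd N. \<phi> (int (Suc (d - 1)))) * ?q ^ N) sums ?S"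
    by (rule lambert_q_expansion[OF norm_qvar_less_1[OF t] B])
  moreover have "(\<lambda>N. if N = 0 then eis_const p \<phi> else 0) sums eis_const p \<phi>" by (rule sums_single)
  ultimately have "(\<lambda>N. (if N = 0 then eis_const p \<phi> else 0) + (if N = 0 then 0 else \<Sum>d | d dvd N. \<phi> (int (Suc (d - 1)))) * ?q ^ N)
     sums (eis_const p \<phi> + ?S)" by (intro sums_add)
  also have "(\<lambda>N. (if N = 0 then eis_const p \<phi> else 0) + (if N = 0 then 0 else \<Sum>d | d dvd N. \<phi> (int (Suc (d - 1)))) * ?q ^ N) =
     (\<lambda>N. fps_nth (Abs_fps (\<lambda>n. if n = 0 then eis_const p \<phi> else \<Sum>d | d dvd n. \<phi> (int d))) N * ?q ^ N)"
  proof
    fix N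
    have "(\<Sum>d | d dvd N. \<phi> (int (Suc (d - 1)))) = (\<Sum>d | d dvd N. \<phi> (int d))" if "N \<noteq> 0"
      using that by (intro sum.cong refl) (auto intro!: arg_cong[of _ _ \<phi>] intro: Nat.gr0I)
    thus "(if N = 0 then eis_const p \<phi> else 0) + (if N = 0 then 0 else \<Sum>d | d dvd N. \<phi> (int (Suc (d - 1)))) * ?q ^ N =
       fps_nth (Abs_fps (\<lambda>n. if n = 0 then eis_const p \<phi> else \<Sum>d | d dvd n. \<phi> (int d))) N * ?q ^ N" by simp
  qed
  finally show "(\<lambda>n. fps_nth (Abs_fps (\<lambda>n. if n = 0 then eis_const p \<phi> else \<Sum>d | d dvd n. \<phi> (int d))) n * ?q ^ n) sums eis_comb p \<phi> \<tau>"
    unfolding eis_comb_expansion[OF p \<phi> t] .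
qed

lemma q_coeff_eq:
  assumes p: "p \<in> set small_primes"
  shows "of_int (q_coeff p a n) = (if n = 0 then delta p a else \<Sum>d | d dvd n. of_int (tab p (int d * a)) :: complex)"
proof (cases "n = 0")
  case True
  note pD = small_primesD[OF p]
  have "(- 1) mod int p = int p - 1" using pD by (simp add: zmod_minus1)
  thus ?thesis using True pD by (simp add: q_coeff_def delta_def cong_def)
next
  case False
  have "(\<Sum>d\<leftarrow>filter (\<lambda>d. d dvd n) [1..<Suc n]. tab p (int d * a)) = (\<Sum>d\<in>set (filter (\<lambda>d. d dvd n) [1..<Suc n]). tab p (int d * a))"
    by (rule sum_list_distinct_conv_sum_set) simp
  also have "set (filter (\<lambda>d. d dvd n) [1..<Suc n]) = {d. d dvd n}"
    using False by (auto dest: dvd_imp_le intro: Nat.gr0I simp: Suc_le_eq)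
  finally show ?thesis using False by (simp add: q_coeff_def)
qed

theorem chosen_first_coeff:
  assumes p: "p \<in> set small_primes" and k: "k \<in> {1..(p - 1) div 2}"
  shows "first_nonzero_q_coeff_eq_1 (diamond 1 p (chosen_classes p ! (k - 1)) (calE p))"
proof -
  note pD = small_primesD[OF p]
  define a where "a = chosen_classes p ! (k - 1)"
  have lc: "leading_check p" using leading_check_small_primes p by (simp add: list_all_iff)
  hence "k - 1 < length (chosen_classes p)" using k by (auto simp: leading_check_def)
  hence "a \<in> set (chosen_classes p)" by (simp add: a_def)
  with lc have "a mod int p \<noteq> 0 \<and> (\<exists>n\<in>{0..<6}. q_coeff p a n = 1 \<and> (\<forall>i\<in>{0..<n}. q_coeff p a i = 0))"
    by (simp add: leading_check_def list_all_iff list_ex_iff)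
  then obtain n where n: "a mod int p \<noteq> 0" "q_coeff p a n = 1" "\<And>i. i < n \<Longrightarrow> q_coeff p a i = 0" by auto
  have cop: "coprime a (int p)"
    using n(1) pD(1) by (simp add: coprime_prime_iff dvd_eq_mod_eq_0)
  define F where "F = Abs_fps (\<lambda>n. of_int (q_coeff p a n) :: complex)"
  have "has_q_expansion (eis_comb p (\<lambda>n. of_int (tab p (n * a)))) F"
    using eis_comb_q_expansion[OF _ tab_odd_periodic[OF pD(3), of a]] pD
    unfolding F_def q_coeff_eq[OF p] eis_const_tab[OF p] by simp
  moreover have "subdegree F = n" by (rule subdegreeI) (use n in \<open>auto simp: F_def\<close>)
  hence "fps_nth F (subdegree F) = 1" using n(2) by (simp add: F_def)
  ultimately show ?thesis unfolding first_nonzero_q_coeff_eq_1_def a_def[symmetric] diamond_calE[OF p cop] by blast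
qed

section \<open>Cusp values and the decomposition\<close>

lemma tendsto_eis_comb:
  assumes p: "p > 0" and \<phi>: "odd_periodic p \<phi>"
  shows "((\<lambda>y::real. eis_comb p \<phi> (\<i> * of_real y)) \<longlongrightarrow> eis_const p \<phi>) at_top"
proof -
  obtain B where B: "\<And>n. norm (\<phi> n) \<le> B" using odd_periodic_bounded[OF p \<phi>] by blast
  have B0: "B \<ge> 0" using B[of 0] norm_ge_zero order_trans by blast
  have "norm (eis_comb p \<phi> (\<i> * of_real y) - eis_const p \<phi>) \<le> 4 * B * exp (- (2 * pi) * y)" if y: "y > 1" for y
  proof -
    define q where "q = qvar (\<i> * of_real y)"
    have nq: "norm q = exp (- (2 * pi) * y)" by (simp add: q_def norm_qvar)
    have "exp (- (2 * pi) * y) \<le> exp (- 1 :: real)" using y pi_gt3 mult_mono[of 1 "2 * pi" 1 y] by simp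
    also have "\<dots> \<le> 1 / 2" using exp_ge_add_one_self[of 1] by (simp add: exp_minus field_simps)
    finally have q2: "norm q \<le> 1/2" by (simp add: nq)
    have t: "norm (\<phi> (int (Suc n)) * (q ^ Suc n / (1 - q ^ Suc n))) \<le> 2 * B * norm q * (1/2) ^ n" for n
    proof -
      have 1: "norm (q ^ Suc n) \<le> norm q * (1/2) ^ n"
        unfolding power_Suc norm_mult norm_power using q2 by (intro mult_left_mono power_mono) auto
      also have "\<dots> \<le> 1/2 * 1" using q2 by (intro mult_mono power_le_one) auto
      finally have "norm (q ^ Suc n / (1 - q ^ Suc n)) \<le> norm (q ^ Suc n) / (1 - 1/2)"
        by (intro norm_geom_frac_le) auto
      also have "\<dots> \<le> 2 * (norm q * (1/2) ^ n)" using 1 by simp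
      finally have "norm (\<phi> (int (Suc n))) * norm (q ^ Suc n / (1 - q ^ Suc n)) \<le> B * (2 * (norm q * (1/2) ^ n))"
        by (intro mult_mono B B0) auto
      thus ?thesis by (simp only: norm_mult mult_ac)
    qed
    have s: "summable (\<lambda>n. 2 * B * norm q * (1/2) ^ n)" by (intro summable_mult summable_geometric) auto
    have "norm (\<Sum>n. \<phi> (int (Suc n)) * (q ^ Suc n / (1 - q ^ Suc n))) \<le> (\<Sum>n. 2 * B * norm q * (1/2) ^ n)"
      by (rule norm_suminf_le[OF t s])
    also have "\<dots> = 4 * B * norm q" by (subst suminf_mult) (auto simp: suminf_geometric)
    finally show ?thesis using eis_comb_expansion[OF p \<phi>, of "\<i> * of_real y"] y by (simp add: q_def[symmetric] nq)
  qed
  hence "\<forall>\<^sub>F y in at_top. norm (eis_comb p \<phi> (\<i> * of_real y) - eis_const p \<phi>) \<le> 4 * B * exp (- (2 * pi) * y)"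
    by (intro eventually_mono[OF eventually_gt_at_top[of 1]])
  moreover have "((\<lambda>y. 4 * B * exp (- (2 * pi) * y)) \<longlongrightarrow> 0) at_top"
    by (rule tendsto_mult_right_zero) real_asymp
  ultimately have "((\<lambda>y. eis_comb p \<phi> (\<i> * of_real y) - eis_const p \<phi>) \<longlongrightarrow> 0) at_top"
    by (rule Lim_null_comparison)
  thus ?thesis by (rule LIM_zero_cancel)
qed

text \<open>For \<open>c\<close> invertible mod \<open>p\<close> some translation carries
  \<open>(c, 0)\<close> to \<open>(c, d)\<close>. It multiplies the disc variable by a root of unity
  and so fixes the centre of the disc.\<close>

lemma cuspval_comp2_right:
  assumes p: "prime p" and f: "f \<in> modular_forms 1 (Gamma1 p)" and c: "\<not> int p dvd c"
  shows "cuspval (comp2 p 1 f c d) = cuspval (comp2 p 1 f c 0)"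
proof -
  have adm: "admissible p c d" for d using c by (simp add: admissible_def)
  have p0: "p > 0" by (rule prime_gt_0_nat[OF p])
  obtain c' where c': "[c * c' = 1] (mod int p)"
    using cong_solve_coprime_int coprime_prime_iff[OF p, of c] c by blast
  define j where "j = c' * d"
  have w: "width p c = p" using c by (simp add: width_def)
  obtain h where h: "h holomorphic_on ball 0 1"
    and F: "\<And>\<tau>. Im \<tau> > 0 \<Longrightarrow> comp2 p 1 f c 0 \<tau> = h (qvar (\<tau> / of_nat (width p c)))"
    using comp2_descent[OF p f adm] by blast
  have F: "comp2 p 1 f c 0 \<tau> = h (qvar (\<tau> / of_nat p))" if "Im \<tau> > 0" for \<tau> using F[OF that] w by simp
  have "comp2 p 1 f c d \<tau> = h (add_char p j * qvar (\<tau> / of_nat p))" if t: "Im \<tau> > 0" for \<tau>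
  proof -
    have T: "mat22 1 j 0 1 \<in> SL2Z" by (simp add: SL2Z_iff)
    have "comp2 p 1 f c 0 (moeb (mat22 1 j 0 1) \<tau>) = comp2 p 1 f c (c * j) \<tau>"
      using comp2_moeb[OF p f adm T t] by (simp add: jfac_def)
    also have "comp2 p 1 f c (c * j) = comp2 p 1 f c d"
    proof (rule comp2_cong[OF p f adm])
      have "[c * c' * d = 1 * d] (mod int p)" by (intro cong_mult cong_refl c')
      thus "[c * j = d] (mod int p)" by (simp add: j_def mult.assoc)
    qed simp
    finally have "comp2 p 1 f c d \<tau> = comp2 p 1 f c 0 (\<tau> + of_int j)" by (simp add: moeb_def jfac_def)
    also have "\<dots> = h (qvar ((\<tau> + of_int j) / of_nat p))" by (rule F) (use t in simp)
    finally show ?thesis by (simp add: add_divide_distrib qvar_add add_char_def mult.commute)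
  qed
  moreover have "(\<lambda>x. h (add_char p j * x)) holomorphic_on ball 0 1"
  proof -
    have "(h \<circ> (\<lambda>x. add_char p j * x)) holomorphic_on ball 0 1"
      by (rule holomorphic_on_compose_gen[OF _ h]) (auto intro!: holomorphic_intros simp: norm_mult norm_add_char)
    thus ?thesis by (simp add: o_def)
  qed
  ultimately have "cuspval (comp2 p 1 f c d) = h (add_char p j * 0)"
    using tendsto_descent[OF _ p0] cuspval_eqI by blast
  moreover have "cuspval (comp2 p 1 f c 0) = h 0"
    by (rule cuspval_eqI[OF tendsto_descent[OF h p0 F]])
  ultimately show ?thesis by simp
qed

text \<open>Set to 0 at multiples of \<open>p\<close>, where there is no cusp vector
  \<open>(0, d)\<close>, so that the values form an odd periodic function.\<close>

definition xval :: "nat \<Rightarrow> (complex \<Rightarrow> complex) \<Rightarrow> int \<Rightarrow> complex" where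
  "xval p f d = (if int p dvd d then 0 else cuspval (comp2 p 1 f 0 d))"

definition yval :: "nat \<Rightarrow> (complex \<Rightarrow> complex) \<Rightarrow> int \<Rightarrow> complex" where
  "yval p f c = (if int p dvd c then 0 else cuspval (comp2 p 1 f c 0))"

lemma cuspval_comp2_uminus:
  assumes "prime p" "f \<in> modular_forms 1 (Gamma1 p)" "admissible p c d"
  shows "cuspval (comp2 p 1 f (- c) (- d)) = - cuspval (comp2 p 1 f c d)"
  unfolding comp2_uminus[OF assms]
  by (rule cuspval_eqI, rule tendsto_minus, rule tendsto_cuspval_comp2[OF assms])

lemma xval_odd_periodic:
  assumes p: "prime p" and f: "f \<in> modular_forms 1 (Gamma1 p)"
  shows "odd_periodic p (xval p f)"
  unfolding odd_periodic_def
proof (intro conjI allI impI)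
  fix m n assume mn: "[m = n] (mod int p)"
  show "xval p f m = xval p f n"
  proof (cases "int p dvd n")
    case False
    hence "comp2 p 1 f 0 m = comp2 p 1 f 0 n"
      using mn by (intro comp2_cong[OF p f]) (simp_all add: admissible_0_iff)
    thus ?thesis using cong_dvd_iff[OF mn] by (simp add: xval_def)
  qed (use cong_dvd_iff[OF mn] in \<open>simp add: xval_def\<close>)
next
  show "xval p f (- n) = - xval p f n" for n
    using cuspval_comp2_uminus[OF p f, of 0 n] by (simp add: xval_def admissible_0_iff)
qed

lemma yval_odd_periodic:
  assumes p: "prime p" and f: "f \<in> modular_forms 1 (Gamma1 p)"
  shows "odd_periodic p (yval p f)"
  unfolding odd_periodic_def
proof (intro conjI allI impI)
  fix m n assume mn: "[m = n] (mod int p)"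
  show "yval p f m = yval p f n"
  proof (cases "int p dvd n")
    case False
    hence "comp2 p 1 f m 0 = comp2 p 1 f n 0"
      using mn by (intro comp2_cong[OF p f]) (simp_all add: admissible_def)
    thus ?thesis using cong_dvd_iff[OF mn] by (simp add: yval_def)
  qed (use cong_dvd_iff[OF mn] in \<open>simp add: yval_def\<close>)
next
  show "yval p f (- n) = - yval p f n" for n
    using cuspval_comp2_uminus[OF p f, of n 0] by (simp add: yval_def admissible_def)
qed

text \<open>By \<open>cuspval_comp2_right\<close> the \<open>p\<close> vectors with a given
  \<open>c\<close> prime to \<open>p\<close> share one value, whence the weight \<open>p\<close> of
  the second sum.\<close>

lemma isotropic_xy:
  assumes p: "prime p" and f: "f \<in> modular_forms 1 (Gamma1 p)" and g: "g \<in> modular_forms 1 (Gamma1 p)"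
  shows "(\<Sum>d<p. xval p f (int d) * xval p g (int d)) + of_nat p * (\<Sum>c<p. yval p f (int c) * yval p g (int c)) = 0"
proof -
  have p1: "p > 1" by (rule prime_gt_1_nat[OF p])
  let ?F = "\<lambda>v. cuspval (comp2 p 1 f (fst v) (snd v)) * cuspval (comp2 p 1 g (fst v) (snd v))"
  have sum_int: "(\<Sum>d\<in>{1..<int p}. u d) = (\<Sum>d<p. u (int d))" if "u 0 = 0" for u :: "int \<Rightarrow> complex"
  proof -
    have "(\<Sum>d<p. u (int d)) = (\<Sum>d\<in>{0..<int p}. u d)"
      by (rule sum.reindex_bij_witness[of _ nat int]) auto
    also have "\<dots> = (\<Sum>d\<in>{1..<int p}. u d)"
    proof (rule sum.mono_neutral_right)
      show "\<forall>d\<in>{0..<int p} - {1..<int p}. u d = 0"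
      proof
        fix d assume "d \<in> {0..<int p} - {1..<int p}"
        hence "d = 0" by auto
        thus "u d = 0" using that by simp
      qed
    qed auto
    finally show ?thesis by simp
  qed
  have nd: "\<not> int p dvd c" if "c \<in> {1..<int p}" for c using that by (simp add: zdvd_not_zless)
  have "(\<Sum>v\<in>{0::int} \<times> {1..<int p}. ?F v) = (\<Sum>d\<in>{1..<int p}. ?F (0, d))"
    by (rule sum.reindex_bij_witness[of _ "\<lambda>d. (0, d)" snd]) auto
  also have "\<dots> = (\<Sum>d\<in>{1..<int p}. xval p f d * xval p g d)"
    by (intro sum.cong refl) (simp add: xval_def nd)
  also have "\<dots> = (\<Sum>d<p. xval p f (int d) * xval p g (int d))" by (rule sum_int) (simp add: xval_def)
  finally have 1: "(\<Sum>v\<in>{0::int} \<times> {1..<int p}. ?F v) = (\<Sum>d<p. xval p f (int d) * xval p g (int d))" .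
  have "(\<Sum>v\<in>{1..<int p} \<times> {0..<int p}. ?F v) = (\<Sum>c\<in>{1..<int p}. \<Sum>d\<in>{0..<int p}. ?F (c, d))"
    by (subst sum.cartesian_product) (simp add: case_prod_unfold)
  also have "\<dots> = (\<Sum>c\<in>{1..<int p}. \<Sum>d\<in>{0..<int p}. yval p f c * yval p g c)"
  proof (intro sum.cong refl)
    fix c d assume c: "c \<in> {1..<int p}"
    show "?F (c, d) = yval p f c * yval p g c"
      unfolding fst_conv snd_conv cuspval_comp2_right[OF p f nd[OF c], of d] cuspval_comp2_right[OF p g nd[OF c], of d]
      using nd[OF c] by (simp add: yval_def)
  qed
  also have "\<dots> = of_nat p * (\<Sum>c\<in>{1..<int p}. yval p f c * yval p g c)" by (simp add: sum_distrib_left)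
  also have "(\<Sum>c\<in>{1..<int p}. yval p f c * yval p g c) = (\<Sum>c<p. yval p f (int c) * yval p g (int c))"
    by (rule sum_int) (simp add: yval_def)
  finally have 2: "(\<Sum>v\<in>{1..<int p} \<times> {0..<int p}. ?F v) = of_nat p * (\<Sum>c<p. yval p f (int c) * yval p g (int c))" .
  have "(\<Sum>v\<in>row_vectors p. ?F v) = (\<Sum>v\<in>{0::int} \<times> {1..<int p}. ?F v) + (\<Sum>v\<in>{1..<int p} \<times> {0..<int p}. ?F v)"
    unfolding row_vectors_def by (rule sum.union_disjoint) auto
  thus ?thesis using cuspval_isotropic[OF p f g] unfolding 1 2 by simp
qed

lemma xval_sum:
  assumes p: "prime p" and e: "\<And>k. k \<in> I \<Longrightarrow> e k \<in> modular_forms 1 (Gamma1 p)"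
  shows "xval p (\<Sum>k\<in>I. cscale (s k) (e k)) d = (\<Sum>k\<in>I. s k * xval p (e k) d)"
proof (cases "int p dvd d")
  case False
  hence adm: "admissible p 0 d" by (simp add: admissible_0_iff)
  have "comp2 p 1 (\<Sum>k\<in>I. cscale (s k) (e k)) 0 d = (\<lambda>\<tau>. \<Sum>k\<in>I. s k * comp2 p 1 (e k) 0 d \<tau>)"
    by (rule ext) (simp add: comp2_def slash_def sum_fun_apply cscale_def sum_distrib_left mult_ac)
  hence "cuspval (comp2 p 1 (\<Sum>k\<in>I. cscale (s k) (e k)) 0 d) = (\<Sum>k\<in>I. s k * cuspval (comp2 p 1 (e k) 0 d))"
    by (simp only:) (intro cuspval_eqI tendsto_sum tendsto_mult tendsto_const tendsto_cuspval_comp2[OF p e adm])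
  thus ?thesis using False by (simp add: xval_def)
qed (simp add: xval_def)

lemma xval_diff:
  assumes p: "prime p" and f: "f \<in> modular_forms 1 (Gamma1 p)" and g: "g \<in> modular_forms 1 (Gamma1 p)"
  shows "xval p (f - g) d = xval p f d - xval p g d"
proof (cases "int p dvd d")
  case False
  hence adm: "admissible p 0 d" by (simp add: admissible_0_iff)
  have "comp2 p 1 (f - g) 0 d = (\<lambda>\<tau>. comp2 p 1 f 0 d \<tau> - comp2 p 1 g 0 d \<tau>)"
    by (rule ext) (simp add: comp2_def slash_def algebra_simps)
  hence "cuspval (comp2 p 1 (f - g) 0 d) = cuspval (comp2 p 1 f 0 d) - cuspval (comp2 p 1 g 0 d)"
    by (simp only:) (intro cuspval_eqI tendsto_diff tendsto_cuspval_comp2[OF p f adm] tendsto_cuspval_comp2[OF p g adm])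
  thus ?thesis using False by (simp add: xval_def)
qed (simp add: xval_def)

section \<open>Cusp values of the diamond translates and injectivity\<close>

definition calE_diamond :: "nat \<Rightarrow> int \<Rightarrow> complex \<Rightarrow> complex" where
  "calE_diamond p b = eis_comb p (\<lambda>n. of_int (tab p (n * b)))"

lemma calE_diamond_modular:
  assumes p: "p \<in> set small_primes"
  shows "calE_diamond p b \<in> modular_forms 1 (Gamma1 p)"
  unfolding calE_diamond_def
  by (rule eis_comb_modular[OF _ tab_odd_periodic]) (use small_primesD[OF p] in simp_all)

text \<open>A matrix with bottom row \<open>(0, d)\<close> mod \<open>p\<close> acts as a diamond
  operator, so the value is the constant term belonging to the table dilated by
  \<open>d b\<close>.\<close>

lemma xval_calE_diamond:
  assumes p: "p \<in> set small_primes"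
  shows "xval p (calE_diamond p b) d = delta p (d * b)"
proof (cases "int p dvd d")
  case True
  hence "[d * b = 0] (mod int p)" by (simp add: cong_0_iff)
  thus ?thesis using True odd_periodic_0[OF delta_odd_periodic] small_primesD[OF p] by (simp add: xval_def)
next
  case False
  note pD = small_primesD[OF p]
  have p0: "p > 0" using pD by simp
  have adm: "admissible p 0 d" using False by (simp add: admissible_0_iff)
  have cop: "coprime d (int p)" using False coprime_prime_iff[OF pD(1)] by blast
  have "comp2 p 1 (calE_diamond p b) 0 d = eis_comb p (\<lambda>n. of_int (tab p (n * d * b)))"
    unfolding comp2_def calE_diamond_def
    using eis_comb_slash[OF p0 tab_odd_periodic[OF pD(3), of b] lift2[OF pD(1) adm] cop] by simp
  also have "\<dots> = eis_comb p (\<lambda>n. of_int (tab p (n * (d * b))))" by (simp only: mult.assoc)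
  finally have "cuspval (comp2 p 1 (calE_diamond p b) 0 d) = eis_const p (\<lambda>n. of_int (tab p (n * (d * b))))"
    by (simp only:) (rule cuspval_eqI[OF tendsto_eis_comb[OF p0 tab_odd_periodic[OF pD(3)]]])
  thus ?thesis using False by (simp add: xval_def eis_const_tab[OF p])
qed

text \<open>Multiplying a matrix of bottom row \<open>(0, b)\<close> by one of bottom row
  \<open>(c, 0)\<close> gives bottom row \<open>(b c, 0)\<close> mod \<open>p\<close>, so all
  translates share one function \<open>yval p (calE p)\<close>.\<close>

lemma yval_calE_diamond:
  assumes p: "p \<in> set small_primes" and b: "coprime b (int p)"
  shows "yval p (calE_diamond p b) c = yval p (calE p) (b * c)"
proof (cases "int p dvd c")
  case True
  thus ?thesis by (simp add: yval_def)
next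
  case False
  note pD = small_primesD[OF p]
  have adm: "admissible p c 0" using False by (simp add: admissible_def)
  have nb: "\<not> int p dvd b" using b coprime_prime_iff[OF pD(1)] by blast
  hence bc: "\<not> int p dvd b * c" using False pD(1) by (simp add: prime_dvd_mult_iff)
  have M: "calE p \<in> modular_forms 1 (Gamma1 p)"
    using calE_diamond_modular[OF p, of 1] by (simp add: calE_diamond_def calE_eq[OF p])
  have "admissible p 0 b" using nb by (simp add: admissible_0_iff)
  note g = lift2[OF pD(1) this] and l = lift2[OF pD(1) adm]
  have "diamond_matrix p b (lift2 p 0 b)" using g by (simp add: diamond_matrix_def)
  hence "comp2 p 1 (calE_diamond p b) c 0 = slash 1 (slash 1 (calE p) (lift2 p 0 b)) (lift2 p c 0)"
    using calE_slash[OF p] by (simp add: comp2_def calE_diamond_def)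
  also have "\<dots> = slash 1 (calE p) (lift2 p 0 b ** lift2 p c 0)" by (rule slash_slash[OF g(1) l(1)])
  also have "\<dots> = comp2 p 1 (calE p) (b * c) 0"
  proof (rule comp2_eqI[OF pD(1) M SL2Z_mult[OF g(1) l(1)], symmetric])
    have "[lift2 p 0 b $ 2 $ 1 * lift2 p c 0 $ 1 $ 1 + lift2 p 0 b $ 2 $ 2 * lift2 p c 0 $ 2 $ 1 = 0 * lift2 p c 0 $ 1 $ 1 + b * c] (mod int p)"
         "[lift2 p 0 b $ 2 $ 1 * lift2 p c 0 $ 1 $ 2 + lift2 p 0 b $ 2 $ 2 * lift2 p c 0 $ 2 $ 2 = 0 * lift2 p c 0 $ 1 $ 2 + b * 0] (mod int p)"
      by (intro cong_add cong_mult cong_refl g l)+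
    thus "[(lift2 p 0 b ** lift2 p c 0) $ 2 $ 1 = b * c] (mod int p)" "[(lift2 p 0 b ** lift2 p c 0) $ 2 $ 2 = 0] (mod int p)"
      by (simp_all add: mat2_mult_sel)
  qed
  finally show ?thesis using False bc by (simp add: yval_def)
qed

theorem modular_form_zero:
  assumes p: "p \<in> set small_primes" and f: "f \<in> modular_forms 1 (Gamma1 p)"
    and x: "\<And>d. xval p f d = 0"
  shows "f = 0"
proof -
  note pD = small_primesD[OF p]
  have p0: "(of_nat p :: complex) \<noteq> 0" using pD by simp
  define Y where "Y = yval p (calE p)"
  have M: "calE p \<in> modular_forms 1 (Gamma1 p)"
    using calE_diamond_modular[OF p, of 1] by (simp add: calE_diamond_def calE_eq[OF p])
  have Yo: "odd_periodic p Y" unfolding Y_def by (rule yval_odd_periodic[OF pD(1) M])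
  have yo: "odd_periodic p (yval p f)" by (rule yval_odd_periodic[OF pD(1) f])
  note do = delta_odd_periodic[OF pD(2)]
  have fY: "(\<Sum>c<p. yval p f (int c) * Y (b * int c)) = 0" for b
  proof (cases "coprime b (int p)")
    case True
    from isotropic_xy[OF pD(1) f calE_diamond_modular[OF p, of b]] show ?thesis
      using p0 by (simp add: x yval_calE_diamond[OF p True] Y_def)
  next
    case False
    hence "int p dvd b" using coprime_prime_iff[OF pD(1)] by blast
    hence "Y (b * int c) = 0" for c by (intro odd_periodic_0[OF Yo]) (simp add: cong_0_iff)
    thus ?thesis by simp
  qed
  \<comment> \<open>Read on classes up to sign, this says that the identity matrix is
    \<open>- p\<close> times \<open>Y\<close> times its transpose.\<close>
  have YY: "(\<Sum>d<p. delta p (int d * a) * delta p (int d * b)) = - of_nat p * (\<Sum>c<p. Y (a * int c) * Y (b * int c))"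
    if "coprime a (int p)" "coprime b (int p)" for a b
    using isotropic_xy[OF pD(1) calE_diamond_modular[OF p, of a] calE_diamond_modular[OF p, of b]]
    by (simp add: xval_calE_diamond[OF p] yval_calE_diamond[OF p that(1)] yval_calE_diamond[OF p that(2)] Y_def add_eq_0_iff)
  have y0: "yval p f a = 0" if a: "coprime a (int p)" for a
  proof -
    obtain a' where a': "[a * a' = 1] (mod int p)" using cong_solve_coprime_int[OF a] by blast
    \<comment> \<open>Pairing \<open>yval p f\<close> with the left side of \<open>YY\<close>
      returns \<open>4 * yval p f a\<close>, one factor 2 from each sum against
      \<open>delta\<close>; paired with the right side it gives 0 by \<open>fY\<close>.\<close>
    define w where "w = (\<lambda>d. \<Sum>c<p. yval p f (int c) * delta p (int c * d))"
    have wo: "odd_periodic p w"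
      unfolding odd_periodic_def
    proof (intro conjI allI impI)
      show "w m = w n" if "[m = n] (mod int p)" for m n
        unfolding w_def by (intro sum.cong refl arg_cong2[where f = "(*)"] delta_cong cong_mult cong_refl that)
      show "w (- n) = - w n" for n
        unfolding w_def by (simp add: odd_periodicD(2)[OF do] sum_negf)
    qed
    have "(\<Sum>c<p. yval p f (int c) * (\<Sum>d<p. delta p (int d * a) * delta p (int d * int c))) =
      (\<Sum>c<p. yval p f (int c) * (- of_nat p * (\<Sum>b<p. Y (a * int b) * Y (int c * int b))))"
    proof (intro sum.cong refl)
      fix c
      show "yval p f (int c) * (\<Sum>d<p. delta p (int d * a) * delta p (int d * int c)) =
        yval p f (int c) * (- of_nat p * (\<Sum>b<p. Y (a * int b) * Y (int c * int b)))"
      proof (cases "coprime (int c) (int p)")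
        case False
        hence "yval p f (int c) = 0" using coprime_prime_iff[OF pD(1), of "int c"] by (simp add: yval_def)
        thus ?thesis by simp
      qed (simp only: YY[OF a])
    qed
    also have "\<dots> = - of_nat p * (\<Sum>b<p. Y (a * int b) * (\<Sum>c<p. yval p f (int c) * Y (int b * int c)))"
      unfolding sum_distrib_left by (subst sum.swap) (simp add: mult_ac)
    also have "\<dots> = 0" unfolding fY by simp
    also have "(\<Sum>c<p. yval p f (int c) * (\<Sum>d<p. delta p (int d * a) * delta p (int d * int c))) =
       (\<Sum>d<p. w (int d) * delta p (int d * a))"
      unfolding w_def sum_distrib_left sum_distrib_right by (subst sum.swap) (simp add: mult_ac)
    also have "\<dots> = 2 * w a'" by (rule delta_sum_dilate[OF pD(2) wo a'])
    also have "w a' = 2 * yval p f a"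
      unfolding w_def by (rule delta_sum_dilate[OF pD(2) yo]) (use a' in \<open>simp add: mult.commute\<close>)
    finally show ?thesis by simp
  qed
  show ?thesis
  proof (rule no_cusp_forms[OF pD(1) pD(4) f])
    fix c d assume adm: "admissible p c d"
    show "cuspval (comp2 p 1 f c d) = 0"
    proof (cases "int p dvd c")
      case True
      hence "comp2 p 1 f 0 d = comp2 p 1 f c d"
        by (intro comp2_cong[OF pD(1) f adm]) (simp_all add: cong_iff_dvd_diff)
      moreover have "\<not> int p dvd d" using adm True by (simp add: admissible_def)
      ultimately show ?thesis using x[of d] by (simp add: xval_def)
    next
      case False
      have "yval p f c = 0" using False coprime_prime_iff[OF pD(1)] y0 by blast
      thus ?thesis using False cuspval_comp2_right[OF pD(1) f False, of d] by (simp add: yval_def)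
    qed
  qed
qed

text \<open>A count: the \<open>m\<close> residues of the \<open>a k\<close> and the
  \<open>m\<close> residues of their negatives are distinct and nonzero, so they exhaust the
  \<open>p - 1\<close> nonzero residues.\<close>

lemma half_system:
  assumes p: "prime p" "p > 2" and m: "m = (p - 1) div 2"
    and cop: "\<And>k. k \<in> {1..m} \<Longrightarrow> coprime (a k) (int p)"
    and dist: "\<And>j k. j \<in> {1..m} \<Longrightarrow> k \<in> {1..m} \<Longrightarrow> j \<noteq> k \<Longrightarrow> \<not> [a j = a k] (mod int p) \<and> \<not> [a j = - a k] (mod int p)"
    and d: "coprime d (int p)"
  shows "\<exists>k\<in>{1..m}. [a k = d] (mod int p) \<or> [a k = - d] (mod int p)"
proof -
  have p0: "int p > 0" using p by simp
  have "odd p" using p prime_odd_nat by blast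
  hence pm: "p = 2 * m + 1" using m by presburger
  define A where "A = (\<lambda>k. a k mod int p) ` {1..m}"
  define B where "B = (\<lambda>k. (- a k) mod int p) ` {1..m}"
  have iA: "inj_on (\<lambda>k. a k mod int p) {1..m}" using dist by (intro inj_onI) (auto simp: cong_def)
  have iB: "inj_on (\<lambda>k. (- a k) mod int p) {1..m}"
  proof (rule inj_onI)
    fix j k assume jk: "j \<in> {1..m}" "k \<in> {1..m}" "(- a j) mod int p = (- a k) mod int p"
    hence "[a j = a k] (mod int p)" using cong_minus_minus_iff[of "a j" "a k" "int p"] by (simp add: cong_def)
    thus "j = k" using dist[OF jk(1,2)] by blast
  qed
  have disj: "A \<inter> B = {}"
  proof (rule equals0I)
    fix x assume "x \<in> A \<inter> B"
    then obtain j k where jk: "j \<in> {1..m}" "k \<in> {1..m}" "a j mod int p = (- a k) mod int p" by (auto simp: A_def B_def)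
    hence c: "[a j = - a k] (mod int p)" by (simp add: cong_def)
    hence "j = k" using dist[OF jk(1,2)] by blast
    hence "int p dvd 2 * a k" using c by (simp add: cong_iff_dvd_diff)
    moreover have "\<not> int p dvd 2" using p zdvd_imp_le[of "int p" 2] by auto
    moreover have "\<not> int p dvd a k" using cop[OF jk(2)] coprime_prime_iff[OF p(1)] by blast
    ultimately show False using p(1) by (simp add: prime_dvd_mult_iff)
  qed
  have nz: "x \<noteq> 0" if xAB: "x \<in> A \<union> B" for x
  proof
    assume "x = 0"
    moreover obtain k where k: "k \<in> {1..m}" "x = a k mod int p \<or> x = (- a k) mod int p"
      using xAB unfolding A_def B_def by blast
    ultimately have "int p dvd a k \<or> int p dvd - a k" by (metis mod_0_imp_dvd)
    hence "int p dvd a k" by simp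
    with k(1) show False using cop coprime_prime_iff[OF p(1)] by blast
  qed
  have sub: "A \<union> B \<subseteq> {1..<int p}"
  proof
    fix x assume x: "x \<in> A \<union> B"
    hence "0 \<le> x" "x < int p" using p0 by (auto simp: A_def B_def)
    thus "x \<in> {1..<int p}" using nz[OF x] by simp
  qed
  have "card (A \<union> B) = card A + card B" using disj by (intro card_Un_disjoint) (auto simp: A_def B_def)
  also have "\<dots> = 2 * m" unfolding A_def B_def card_image[OF iA] card_image[OF iB] by simp
  also have "\<dots> = card {1..<int p}" by (simp add: pm)
  finally have AB: "A \<union> B = {1..<int p}" using sub by (intro card_subset_eq) auto
  have "\<not> int p dvd d" using d coprime_prime_iff[OF p(1)] by blast
  hence "d mod int p \<noteq> 0" by (simp add: dvd_eq_mod_eq_0)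
  hence "d mod int p \<in> {1..<int p}" using p0 pos_mod_sign[OF p0, of d] pos_mod_bound[OF p0, of d] by auto
  then obtain k where k: "k \<in> {1..m}" "d mod int p = a k mod int p \<or> d mod int p = (- a k) mod int p"
    unfolding AB[symmetric] by (auto simp: A_def B_def)
  have "[a k = - d] (mod int p)" if "d mod int p = (- a k) mod int p"
    using that cong_minus_minus_iff[of "a k" "- d" "int p"] by (simp add: cong_def)
  thus ?thesis using k by (auto simp: cong_def)
qed

text \<open>The inverses \<open>a' k\<close> are dual to the dilates of \<open>delta\<close> by the
  \<open>a k\<close>, and an odd function vanishing at all of them is 0, since every unit is a sign
  times some \<open>a' k\<close>.\<close>

lemma odd_periodic_expand:
  assumes p: "prime p" "p > 2" and m: "m = (p - 1) div 2"
    and cop: "\<And>k. k \<in> {1..m} \<Longrightarrow> coprime (a k) (int p)"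
    and dist: "\<And>j k. j \<in> {1..m} \<Longrightarrow> k \<in> {1..m} \<Longrightarrow> j \<noteq> k \<Longrightarrow> \<not> [a j = a k] (mod int p) \<and> \<not> [a j = - a k] (mod int p)"
    and a': "\<And>k. k \<in> {1..m} \<Longrightarrow> [a k * a' k = 1] (mod int p)"
  shows "\<And>j k. j \<in> {1..m} \<Longrightarrow> k \<in> {1..m} \<Longrightarrow> delta p (a' j * a k) = (if j = k then 1 else 0)"
    and "odd_periodic p z \<Longrightarrow> z d = (\<Sum>k\<in>{1..m}. z (a' k) * delta p (d * a k))"
proof -
  show dl: "delta p (a' j * a k) = (if j = k then 1 else 0)" if jk: "j \<in> {1..m}" "k \<in> {1..m}" for j k
  proof (cases "j = k")
    case True
    thus ?thesis using a'[OF jk(2)] by (simp add: delta_def mult.commute)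
  next
    case False
    have *: "[a j = s * a k] (mod int p)" if "[a' j * a k = s] (mod int p)" "s * s = 1" for s
    proof -
      have "[s * a j * (a' j * a k) = s * a j * s] (mod int p)" by (intro cong_mult cong_refl that)
      moreover have "[s * a k * (a j * a' j) = s * a k * 1] (mod int p)" by (intro cong_mult cong_refl a' jk)
      moreover have "s * a j * (a' j * a k) = s * a k * (a j * a' j)" by (simp only: mult_ac)
      moreover have "s * a j * s = a j" using that(2) by (simp add: mult_ac)
      ultimately show ?thesis by (metis cong_sym cong_trans mult_1_right)
    qed
    show ?thesis using *[of 1] *[of "- 1"] dist[OF jk False] False by (auto simp: delta_def)
  qed
  assume z: "odd_periodic p z"
  define w where "w = (\<lambda>d. z d - (\<Sum>k\<in>{1..m}. z (a' k) * delta p (d * a k)))"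
  note do = delta_odd_periodic[OF p(2)]
  have wc: "w b = w c" if "[b = c] (mod int p)" for b c
  proof -
    have "delta p (b * a k) = delta p (c * a k)" for k by (intro delta_cong cong_mult cong_refl that)
    thus ?thesis using odd_periodicD(1)[OF z that] by (simp only: w_def)
  qed
  have wm: "w (- b) = - w b" for b
    by (simp add: w_def odd_periodicD(2)[OF z] odd_periodicD(2)[OF do] sum_negf)
  have w0: "w (a' j) = 0" if j: "j \<in> {1..m}" for j
  proof -
    have "(\<Sum>k\<in>{1..m}. z (a' k) * delta p (a' j * a k)) = (\<Sum>k\<in>{1..m}. if k = j then z (a' j) else 0)"
      by (intro sum.cong refl) (auto simp: dl[OF j])
    thus ?thesis using j by (simp add: w_def)
  qed
  have "w d = 0"
  proof (cases "coprime d (int p)")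
    case False
    hence "int p dvd d" using coprime_prime_iff[OF p(1)] by blast
    hence "[d = 0] (mod int p)" by (simp add: cong_0_iff)
    hence "w d = w 0" by (rule wc)
    thus ?thesis using wm[of 0] by simp
  next
    case True
    then obtain d' where d': "[d * d' = 1] (mod int p)" using cong_solve_coprime_int by blast
    have "coprime d' (int p)" using d' by (metis cong_imp_coprime cong_sym coprime_1_left coprime_mult_left_iff)
    \<comment> \<open>It is the \<open>a k\<close> that cover all classes, so the covering is
      applied to the inverse of \<open>d\<close>; inverting back expresses \<open>d\<close> through
      some \<open>a' k\<close>.\<close>
    have "\<exists>k\<in>{1..m}. [a k = d'] (mod int p) \<or> [a k = - d'] (mod int p)"
      by (rule half_system[where a = a, OF p m cop dist \<open>coprime d' (int p)\<close>])
    then obtain k0 where k0: "k0 \<in> {1..m}" "[a k0 = d'] (mod int p) \<or> [a k0 = - d'] (mod int p)"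
      by blast
    hence "[a k0 = 1 * d'] (mod int p) \<or> [a k0 = - 1 * d'] (mod int p)" by simp
    with k0(1) obtain k s where k: "k \<in> {1..m}" "[a k = s * d'] (mod int p)" "s = 1 \<or> s = - 1" by blast
    have "[a k * (s * d * a' k) = s * d' * (s * d * a' k)] (mod int p)" by (intro cong_mult cong_refl k(2))
    moreover have "a k * (s * d * a' k) = (s * d) * (a k * a' k)" by (simp only: mult_ac)
    moreover have "s * d' * (s * d * a' k) = (d * d') * a' k * (s * s)" by (simp only: mult_ac)
    moreover have "s * s = 1" using k(3) by auto
    moreover have "[(s * d) * (a k * a' k) = (s * d) * 1] (mod int p)" by (intro cong_mult cong_refl a' k(1))
    moreover have "[(d * d') * a' k = 1 * a' k] (mod int p)" by (intro cong_mult cong_refl d')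
    ultimately have "[s * d = a' k] (mod int p)" by (metis cong_sym cong_trans mult_1 mult_1_right)
    hence "w (s * d) = 0" using wc w0[OF k(1)] by metis
    thus ?thesis using k(3) wm[of d] by auto
  qed
  thus "z d = (\<Sum>k\<in>{1..m}. z (a' k) * delta p (d * a k))" by (simp add: w_def)
qed

text \<open>Nonvanishing is asserted separately because \<open>internal_direct_sum\<close> alone
  would tolerate zero summands; it makes every summand a line.\<close>

theorem theorem3p2:
  fixes p :: nat
  assumes "prime p" and "5 \<le> p" and "p \<le> 19"
  shows "(\<forall>a :: nat \<Rightarrow> int.
            (\<forall>k\<in>{1..(p - 1) div 2}. coprime (a k) (int p)) \<and>
            (\<forall>j\<in>{1..(p - 1) div 2}. \<forall>k\<in>{1..(p - 1) div 2}. j \<noteq> k \<longrightarrow>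
               \<not> [a j = a k] (mod int p) \<and> \<not> [a j = - a k] (mod int p)) \<longrightarrow>
            internal_direct_sum (modular_forms 1 (Gamma1 p)) {1..(p - 1) div 2}
              (\<lambda>k. cfun.span {diamond 1 p (a k) (calE p)}) \<and>
            (\<forall>k\<in>{1..(p - 1) div 2}. diamond 1 p (a k) (calE p) \<noteq> 0)) \<and>
         (\<forall>k\<in>{1..(p - 1) div 2}.
            first_nonzero_q_coeff_eq_1 (diamond 1 p (chosen_classes p ! (k - 1)) (calE p)))"
proof (intro conjI allI impI ballI)
  have p: "p \<in> set small_primes" by (rule prime_between_5_19[OF assms])
  note pD = small_primesD[OF p]
  show "first_nonzero_q_coeff_eq_1 (diamond 1 p (chosen_classes p ! (k - 1)) (calE p))"
    if "k \<in> {1..(p - 1) div 2}" for k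
    by (rule chosen_first_coeff[OF p that])
  define m where "m = (p - 1) div 2"
  define M where "M = modular_forms 1 (Gamma1 p)"
  fix a :: "nat \<Rightarrow> int"
  assume "(\<forall>k\<in>{1..(p - 1) div 2}. coprime (a k) (int p)) \<and>
            (\<forall>j\<in>{1..(p - 1) div 2}. \<forall>k\<in>{1..(p - 1) div 2}. j \<noteq> k \<longrightarrow>
               \<not> [a j = a k] (mod int p) \<and> \<not> [a j = - a k] (mod int p))"
  note hyp = this[folded m_def]
  have cop: "coprime (a k) (int p)" if "k \<in> {1..m}" for k using hyp that by blast
  have dist: "\<not> [a j = a k] (mod int p) \<and> \<not> [a j = - a k] (mod int p)"
    if "j \<in> {1..m}" "k \<in> {1..m}" "j \<noteq> k" for j k using hyp that by blast
  have "\<forall>k\<in>{1..m}. \<exists>b. [a k * b = 1] (mod int p)" using cop cong_solve_coprime_int by blast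
  then obtain a' where a': "\<And>k. k \<in> {1..m} \<Longrightarrow> [a k * a' k = 1] (mod int p)" by metis
  have ex1: "delta p (a' j * a k) = (if j = k then 1 else 0)" if jk: "j \<in> {1..m}" "k \<in> {1..m}" for j k
    by (rule odd_periodic_expand(1)[where a = a and a' = a', OF pD(1,2) m_def _ _ _ jk])
       (use cop dist a' in blast)+
  have ex2: "z d = (\<Sum>k\<in>{1..m}. z (a' k) * delta p (d * a k))" if z: "odd_periodic p z" for z d
    by (rule odd_periodic_expand(2)[where a = a and a' = a', OF pD(1,2) m_def _ _ _ z])
       (use cop dist a' in blast)+
  define e where "e = (\<lambda>k. calE_diamond p (a k))"
  have dia: "diamond 1 p (a k) (calE p) = e k" if "k \<in> {1..m}" for k
    using diamond_calE[OF p cop[OF that]] by (simp add: e_def calE_diamond_def)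
  have eM: "e k \<in> M" for k unfolding e_def M_def by (rule calE_diamond_modular[OF p])
  have sM: "cfun.subspace M" unfolding M_def by (rule modular_forms_subspace)
  have xs: "xval p (\<Sum>k\<in>{1..m}. cscale (s k) (e k)) d = (\<Sum>k\<in>{1..m}. s k * delta p (d * a k))" for s d
    using xval_sum[OF pD(1), of "{1..m}" e s d] eM by (simp add: M_def e_def xval_calE_diamond[OF p])
  have xs': "xval p (\<Sum>k\<in>{1..m}. cscale (s k) (e k)) (a' j) = s j" if j: "j \<in> {1..m}" for s j
  proof -
    have "(\<Sum>k\<in>{1..m}. s k * delta p (a' j * a k)) = (\<Sum>k\<in>{1..m}. if k = j then s j else 0)"
      by (intro sum.cong refl) (auto simp: ex1[OF j])
    thus ?thesis unfolding xs using j by simp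
  qed
  show "diamond 1 p (a k) (calE p) \<noteq> 0" if "k \<in> {1..(p - 1) div 2}" for k
  proof
    have k: "k \<in> {1..m}" using that by (simp add: m_def)
    assume "diamond 1 p (a k) (calE p) = 0"
    hence "xval p (e k) (a' k) = xval p 0 (a' k)" using dia[OF k] by simp
    also have "\<dots> = 0" using xval_sum[OF pD(1), of "{}" e] by simp
    finally show False using ex1[OF k k] by (simp add: e_def xval_calE_diamond[OF p])
  qed
  have "internal_direct_sum M {1..m} (\<lambda>k. cfun.span {diamond 1 p (a k) (calE p)})"
    unfolding internal_direct_sum_def
  proof (intro conjI ballI)
    show "cfun.subspace M" by (rule sM)
    show "cfun.subspace (cfun.span {diamond 1 p (a k) (calE p)})" for k by (rule cfun.subspace_span)
    show "cfun.span {diamond 1 p (a k) (calE p)} \<subseteq> M" if "k \<in> {1..m}" for k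
      by (rule cfun.span_minimal[OF _ sM]) (use dia[OF that] eM in simp)
    fix f assume f: "f \<in> M"
    \<comment> \<open>The coefficient along \<open>e k\<close> is the cusp value at
      \<open>(0, a' k)\<close>, which is 1 for \<open>e k\<close> and 0 for the other basis
      elements. \<open>restrict\<close> supplies the value \<open>undefined\<close> off the index
      set that \<open>Pi\<^sub>E\<close> demands.\<close>
    define v where "v = restrict (\<lambda>k. cscale (xval p f (a' k)) (e k)) {1..m}"
    show "\<exists>!v. v \<in> Pi\<^sub>E {1..m} (\<lambda>k. cfun.span {diamond 1 p (a k) (calE p)}) \<and> f = (\<Sum>k\<in>{1..m}. v k)"
    proof (intro ex1I conjI)
      show "v \<in> Pi\<^sub>E {1..m} (\<lambda>k. cfun.span {diamond 1 p (a k) (calE p)})"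
        using dia by (auto simp: v_def cfun.span_singleton)
      let ?g = "\<Sum>k\<in>{1..m}. cscale (xval p f (a' k)) (e k)"
      have gM: "?g \<in> M" by (intro cfun.subspace_sum[OF sM] cfun.subspace_scale[OF sM] eM)
      have "f - ?g = 0"
      proof (rule modular_form_zero[OF p])
        show "f - ?g \<in> modular_forms 1 (Gamma1 p)"
          using cfun.subspace_diff[OF sM f gM] by (simp only: M_def)
        show "xval p (f - ?g) d = 0" for d
        proof -
          have "xval p (f - ?g) d = xval p f d - xval p ?g d"
            by (rule xval_diff[OF pD(1)]) (use f gM in \<open>simp_all only: M_def\<close>)
          also have "xval p ?g d = xval p f d"
            unfolding xs by (rule ex2[symmetric], rule xval_odd_periodic[OF pD(1)]) (use f in \<open>simp only: M_def\<close>)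
          finally show ?thesis by (simp only: diff_self)
        qed
      qed
      moreover have "(\<Sum>k\<in>{1..m}. v k) = ?g" by (intro sum.cong refl) (simp add: v_def)
      ultimately show "f = (\<Sum>k\<in>{1..m}. v k)" by (simp only: right_minus_eq)
    next
      fix u assume u: "u \<in> Pi\<^sub>E {1..m} (\<lambda>k. cfun.span {diamond 1 p (a k) (calE p)}) \<and> f = (\<Sum>k\<in>{1..m}. u k)"
      have "\<forall>k\<in>{1..m}. \<exists>s. u k = cscale s (e k)"
      proof
        fix k assume k: "k \<in> {1..m}"
        have "u k \<in> cfun.span {e k}"
          using PiE_mem[OF conjunct1[OF u] k] unfolding dia[OF k] .
        thus "\<exists>s. u k = cscale s (e k)" by (auto simp: cfun.span_singleton)
      qed
      then obtain s where s: "\<And>k. k \<in> {1..m} \<Longrightarrow> u k = cscale (s k) (e k)" by metis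
      have fs: "f = (\<Sum>k\<in>{1..m}. cscale (s k) (e k))"
        unfolding conjunct2[OF u] by (rule sum.cong[OF refl s])
      show "u = v"
      proof
        fix k
        show "u k = v k"
        proof (cases "k \<in> {1..m}")
          case True
          thus ?thesis using s[OF True] xs'[OF True, of s] fs by (simp add: v_def)
        next
          case False
          have "u k = undefined" by (rule PiE_arb[OF conjunct1[OF u] False])
          thus ?thesis by (simp only: v_def restrict_apply False if_False)
        qed
      qed
    qed
  qed
  thus "internal_direct_sum (modular_forms 1 (Gamma1 p)) {1..(p - 1) div 2}
              (\<lambda>k. cfun.span {diamond 1 p (a k) (calE p)})" by (simp only: M_def m_def)
qed

end
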